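(* Let $N\ge2$. For any two convex bodies $K_0,K_1\subset\mathbb R^N$ and any $\lambda\in[0,1]$, \[ {\rm Cap}_{1}(\lambda K_1+(1-\lambda)K_0)^{\frac{1}{N-1}}\ \ge\ \lambda\,{\rm Cap}_{1}(K_1)^{\frac{1}{N-1}}+(1-\lambda)\,{\rm Cap}_{1}(K_0)^{\frac{1}{N-1}}. \]
   Context: A convex body is a compact convex set with non-empty interior; $\lambda K_1+(1-\lambda)K_0=\{\lambda x_1+(1-\lambda)x_0: x_i\in K_i\}$ is the Minkowski combination. For $\alpha\in(0,N)$ and a compact set $E\subset\mathbb R^N$, the Riesz potential energy is $I_\alpha(E)=\inf\{\int_{\mathbb R^N\times\mathbb R^N}|x-y|^{-(N-\alpha)}\,d\mu(x)\,d\mu(y):\ \mu \text{ a Radon measure supported on } E,\ \mu(E)=1\}$, and the $\alpha$-Riesz capacity is ${\rm Cap}_\alpha(E)=1/I_\alpha(E)$. *)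

theory Defs
  imports "HOL-Analysis.Analysis" "HOL-Probability.Probability"
begin

definition convex_body :: "'a::euclidean_space set \<Rightarrow> bool" where
  "convex_body K \<longleftrightarrow> compact K \<and> convex K \<and> interior K \<noteq> {}"

definition minkowski_comb :: "real \<Rightarrow> 'a::euclidean_space set \<Rightarrow> 'a set \<Rightarrow> 'a set" where
  "minkowski_comb l K1 K0 = {l *\<^sub>R x1 + (1 - l) *\<^sub>R x0 | x1 x0. x1 \<in> K1 \<and> x0 \<in> K0}"

definition riesz_kernel :: "real \<Rightarrow> 'a::euclidean_space \<Rightarrow> 'a \<Rightarrow> ennreal" where
  "riesz_kernel \<alpha> x y =
     (if x = y then \<infinity> else ennreal (dist x y powr (-(real DIM('a) - \<alpha>))))"

definition riesz_admissible :: "'a::euclidean_space set \<Rightarrow> 'a measure \<Rightarrow> bool" where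
  "riesz_admissible E \<mu> \<longleftrightarrow> sets \<mu> = sets borel \<and> emeasure \<mu> E = 1 \<and> emeasure \<mu> (UNIV - E) = 0"

definition riesz_energy :: "real \<Rightarrow> 'a::euclidean_space set \<Rightarrow> ennreal" where
  "riesz_energy \<alpha> E = (INF \<mu> \<in> {\<mu>. riesz_admissible E \<mu>}.
       \<integral>\<^sup>+ x. (\<integral>\<^sup>+ y. riesz_kernel \<alpha> x y \<partial>\<mu>) \<partial>\<mu>)"

definition riesz_cap :: "real \<Rightarrow> 'a::euclidean_space set \<Rightarrow> ennreal" where
  "riesz_cap \<alpha> E = inverse (riesz_energy \<alpha> E)"

end

theory Submission
  imports Defs
begin

text \<open>The kernel \<open>|x - y|\<close> to the power \<open>-(N-1)\<close> on \<open>N\<close>-space is the Newtonian kernel of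
  \<open>(N+1)\<close>-space restricted to a hyperplane, so the claim is Borell's Brunn-Minkowski inequality for the
  Newtonian capacity of the flat bodies \<open>K \<times> {0}\<close>.  For potentials \<open>u1\<close>, \<open>u0\<close> of measures on
  \<open>K1\<close>, \<open>K0\<close> that are at most 1 off these bodies, and a strictly superharmonic \<open>\<phi>\<close> that is at least 1 on
  \<open>l K1 + (1-l) K0\<close>, a second-derivative test at a maximum of
  \<open>min (u1 x1) (u0 x0) - \<phi> (l x1 + (1-l) x0)\<close> shows that this function is nowhere positive.
  Evaluating along a ray at infinity turns the pointwise inequality into one between total masses.

  Instead of an equilibrium measure, which would require weak compactness, near-minimizers \<open>\<mu>\<close> of the
  energy are used.  Restricting \<open>\<mu>\<close> to the set where its potential is not much larger than the energy
  and is not concentrated locally gives \<open>u1\<close> and \<open>u0\<close>, by Frostman's maximum principle.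
  Averaging \<open>\<mu>\<close> over small balls and regularizing the kernel gives \<open>\<phi>\<close>; it is large only at points
  at a fixed distance from the complement, so \<open>K1\<close> and \<open>K0\<close> are first shrunk slightly.\<close>

text \<open>The extra dimension turns a nonlocal problem into a local one: potentials become
  harmonic off the bodies, so derivative tests apply. The exponent 1/(N-1) comes from the decay: at
  a small height h the potential of a mass m has a superlevel set close to a ball of radius
  (m/h)^(1/(N-1)), and the comparison puts Minkowski combinations of superlevel sets into that of
  \<open>\<phi>\<close> at the same height.

  Harmonicity alone has no strict sign for the second-derivative test. The regularization supplies
  it, and it makes \<open>\<phi>\<close> smooth even on its support. For \<open>u1\<close> and
  \<open>u0\<close> boundary behaviour is avoided by setting them to 1 on the bodies, so that only
  upper semicontinuity is used. Convexity enters through nonvanishing gradients off the bodies,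
  which the test curves divide by, and through the room gained by shrinking towards an interior
  point. The limits come in this order: \<open>\<kappa>\<close> to 0 with the averaging radius
  fixed, then the shrinking factor \<open>t\<close> to 1.\<close>

section \<open>Second-order expansions of Newtonian potentials\<close>

text \<open>\<open>g\<close> is the gradient and \<open>Q\<close> the Hessian form; the expansion is along parabolas because the
  comparison below bends its test curves to second order.\<close>

definition has_jet :: "('b::euclidean_space \<Rightarrow> real) \<Rightarrow> 'b \<Rightarrow> 'b \<Rightarrow> ('b \<Rightarrow> real) \<Rightarrow> bool" where
  "has_jet u z g Q \<longleftrightarrow> (\<forall>c v. Q (c *\<^sub>R v) = c\<^sup>2 * Q v) \<and>
     (\<forall>v w. \<exists>C r0. r0 > 0 \<and> (\<forall>r. \<bar>r\<bar> \<le> r0 \<longrightarrow>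
        \<bar>u (z + r *\<^sub>R v + r\<^sup>2 *\<^sub>R w) - (u z + r * (g \<bullet> v) + r\<^sup>2 * (Q v / 2 + g \<bullet> w))\<bar> \<le> C * \<bar>r\<bar> ^ 3))"

text \<open>The remainder is a third derivative, a multiple of t^(-s-3), which is largest at the
  left end \<open>m/2\<close> of the range. Hence \<open>C\<close> is uniform in \<open>q\<close>,
  as needed for integrating the expansion against a measure.\<close>

lemma powr_neg_taylor:
  fixes s m :: real
  assumes s: "s > 0" and m: "m > 0"
  obtains C where "C \<ge> 0"
    "\<And>q d. q \<ge> m \<Longrightarrow> \<bar>d\<bar> \<le> m/2 \<Longrightarrow>
      \<bar>(q + d) powr (-s) - (q powr (-s) - s * q powr (-s-1) * d + s*(s+1) * q powr (-s-2) * d\<^sup>2 / 2)\<bar> \<le> C * \<bar>d\<bar>^3"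
proof -
  define C where "C = s*(s+1)*(s+2)*(m/2) powr (-s-3)"
  have "C \<ge> 0" unfolding C_def using s by auto
  moreover have "\<bar>(q + d) powr (-s) - (q powr (-s) - s * q powr (-s-1) * d + s*(s+1) * q powr (-s-2) * d\<^sup>2 / 2)\<bar> \<le> C * \<bar>d\<bar>^3"
    if q: "q \<ge> m" and d: "\<bar>d\<bar> \<le> m/2" for q d
  proof (cases "d = 0")
    case True then show ?thesis by simp
  next
    case False
    define D where "D = (\<lambda>k::nat. case k of 0 \<Rightarrow> (\<lambda>t::real. t powr (-s)) | Suc 0 \<Rightarrow> (\<lambda>t. -s * t powr (-s-1))
        | Suc (Suc 0) \<Rightarrow> (\<lambda>t. s*(s+1) * t powr (-s-2)) | _ \<Rightarrow> (\<lambda>t. -(s*(s+1)*(s+2)) * t powr (-s-3)))"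
    have D0: "D 0 = (\<lambda>t. t powr (-s))" by (simp add: D_def)
    have this0: "\<forall>k t. k < 3 \<and> m/2 \<le> t \<and> t \<le> q + m \<longrightarrow> DERIV (D k) t :> D (Suc k) t"
    proof (intro allI impI)
      fix k :: nat and t :: real assume *: "k < 3 \<and> m/2 \<le> t \<and> t \<le> q + m"
      then have t: "t > 0" using m by auto
      have "k = 0 \<or> k = 1 \<or> k = 2" using * by auto
      then show "DERIV (D k) t :> D (Suc k) t"
        using t by (elim disjE) (auto simp: D_def numeral_2_eq_2 algebra_simps intro!: derivative_eq_intros)
    qed
    have bnds: "m/2 \<le> q" "q \<le> q + m" "m/2 \<le> q + d" "q + d \<le> q + m" using q d m by linarith+
    have neq: "q + d \<noteq> q" using False by simp
    from Taylor[of 3 D "\<lambda>t. t powr (-s)" "m/2" "q+m" q "q+d", OF _ D0 this0 bnds neq]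
    obtain t where t: "if q + d < q then q + d < t \<and> t < q else q < t \<and> t < q + d"
      and eq: "(q+d) powr (-s) = (\<Sum>k<3. D k q / fact k * (q+d-q)^k) + D 3 t / fact 3 * (q+d-q)^3"
      by auto
    have t2: "t \<ge> m/2" using t q d by (auto split: if_splits)
    have "(q + d) powr (-s) - (q powr (-s) - s * q powr (-s-1) * d + s*(s+1) * q powr (-s-2) * d\<^sup>2 / 2)
      = D 3 t / 6 * d^3"
      unfolding eq by (simp add: D_def numeral_3_eq_3 numeral_2_eq_2 fact_numeral)
    also have "\<bar>\<dots>\<bar> = \<bar>D 3 t\<bar> / 6 * \<bar>d\<bar>^3" by (simp add: abs_mult power_abs)
    also have "\<dots> \<le> C * \<bar>d\<bar>^3"
    proof (intro mult_right_mono)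
      have "t powr (-s-3) \<le> (m/2) powr (-s-3)"
        using t2 m s by (intro powr_mono2') auto
      then have "s*(s+1)*(s+2) * t powr (-s-3) \<le> C" unfolding C_def using s by (intro mult_left_mono) auto
      moreover have "\<bar>D 3 t\<bar> = s*(s+1)*(s+2) * t powr (-s-3)" using s by (simp add: D_def numeral_3_eq_3 abs_mult)
      moreover have "s*(s+1)*(s+2) * t powr (-s-3) \<ge> 0" using s by auto
      ultimately show "\<bar>D 3 t\<bar> / 6 \<le> C" by linarith
    qed auto
    finally show ?thesis .
  qed
  ultimately show ?thesis using that by blast
qed

text \<open>Half of the Newtonian exponent n-2, because \<open>kern\<close> is a power of the
  squared norm.\<close>

definition kexp :: "'b::euclidean_space itself \<Rightarrow> real" where
  "kexp _ = (real DIM('b) - 2) / 2"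

text \<open>With \<open>n\<close> the dimension, \<open>kern e\<close> is the Newtonian kernel with exponent \<open>-(n-2)\<close>, regularized by adding
  \<open>e\<close> to the squared norm: harmonic off 0 for \<open>e = 0\<close>, smooth and strictly superharmonic for \<open>e > 0\<close>.
  At \<open>e = 0\<close> the value at the pole is the junk value 0.\<close>

definition kern :: "real \<Rightarrow> 'b::euclidean_space \<Rightarrow> real" where
  "kern e z = (z \<bullet> z + e) powr (- kexp TYPE('b))"

text \<open>First and second derivatives of the kernel as a function of the squared norm.\<close>

definition kern_D1 :: "real \<Rightarrow> 'b::euclidean_space \<Rightarrow> real" where
  "kern_D1 e z = - kexp TYPE('b) * (z \<bullet> z + e) powr (- kexp TYPE('b) - 1)"

definition kern_D2 :: "real \<Rightarrow> 'b::euclidean_space \<Rightarrow> real" where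
  "kern_D2 e z = kexp TYPE('b) * (kexp TYPE('b) + 1) * (z \<bullet> z + e) powr (- kexp TYPE('b) - 2)"

definition pot :: "real \<Rightarrow> 'b::euclidean_space measure \<Rightarrow> 'b \<Rightarrow> real" where
  "pot e \<mu> z = (\<integral>y. kern e (z - y) \<partial>\<mu>)"

text \<open>Formal differentiation under the integral: the kernel is a function of the squared norm,
  so the chain rule gives the gradient 2 D1 z and the Hessian form 2 D1 |v|^2 + 4 D2
  (z.v)^2.\<close>

definition pot_grad :: "real \<Rightarrow> 'b::euclidean_space measure \<Rightarrow> 'b \<Rightarrow> 'b" where
  "pot_grad e \<mu> z = (\<integral>y. (2 * kern_D1 e (z - y)) *\<^sub>R (z - y) \<partial>\<mu>)"

definition pot_hess :: "real \<Rightarrow> 'b::euclidean_space measure \<Rightarrow> 'b \<Rightarrow> 'b \<Rightarrow> real" where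
  "pot_hess e \<mu> z v = (\<integral>y. 2 * kern_D1 e (z - y) * (v \<bullet> v) + 4 * kern_D2 e (z - y) * ((z - y) \<bullet> v)\<^sup>2 \<partial>\<mu>)"

lemma measurable_kern [measurable]:
  "kern e \<in> borel_measurable borel" "kern_D1 e \<in> borel_measurable borel" "kern_D2 e \<in> borel_measurable borel"
  unfolding kern_def[abs_def] kern_D1_def[abs_def] kern_D2_def[abs_def] by measurable

text \<open>\<open>C\<close> and \<open>r0\<close> depend on the position only through
  \<open>m\<close> and \<open>R\<close>, so the error bound survives integration over the sources.
  The one-variable expansion is applied to the increment of the squared norm along the
  parabola.\<close>

lemma kern_jet_bound:
  fixes v w :: "'b::euclidean_space"
  assumes s: "kexp TYPE('b) > 0" and m: "m > 0" and R: "R > 0"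
  obtains C r0 where "r0 > 0" "C \<ge> 0"
    "\<And>z r. z \<bullet> z + e \<ge> m \<Longrightarrow> norm z \<le> R \<Longrightarrow> \<bar>r\<bar> \<le> r0 \<Longrightarrow>
       \<bar>kern e (z + r *\<^sub>R v + r\<^sup>2 *\<^sub>R w) - (kern e z + r * (2 * kern_D1 e z * (z \<bullet> v))
         + r\<^sup>2 * ((2 * kern_D1 e z * (v \<bullet> v) + 4 * kern_D2 e z * (z \<bullet> v)\<^sup>2) / 2 + 2 * kern_D1 e z * (z \<bullet> w)))\<bar>
       \<le> C * \<bar>r\<bar>^3"
proof -
  define s where "s = kexp TYPE('b)"
  have s0: "s > 0" using assms s_def by simp
  obtain C0 where C0: "C0 \<ge> 0" and tay: "\<And>q d. q \<ge> m \<Longrightarrow> \<bar>d\<bar> \<le> m/2 \<Longrightarrow>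
      \<bar>(q + d) powr (-s) - (q powr (-s) - s * q powr (-s-1) * d + s*(s+1) * q powr (-s-2) * d\<^sup>2 / 2)\<bar> \<le> C0 * \<bar>d\<bar>^3"
    using powr_neg_taylor[OF s0 m] by blast
  define A where "A = s * m powr (-s-1) + s*(s+1) * m powr (-s-2)"
  have A0: "A \<ge> 0" using s0 by (auto simp: A_def)
  \<comment> \<open>\<open>B\<close> dominates the coefficients of r, r^2 and r^3 in that increment
    \<open>d\<close>; the bound \<open>m / (6 * B)\<close> on |r| then gives |d| <= 3 B |r| <= m/2,
    the range of the Taylor estimate.\<close>
  define B where "B = 1 + 2 * R * (norm v + norm w) + norm v ^ 2 + 2 * norm v * norm w + norm w ^ 2"
  have B1: "B \<ge> 1" using R by (auto simp: B_def)
  define r0 where "r0 = min 1 (m / (6 * B))"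
  define C where "C = C0 * (3*B)^3 + A * B + A * (4 * B * B)"
  have "r0 > 0" using m B1 by (auto simp: r0_def)
  moreover have "C \<ge> 0" using C0 A0 B1 by (auto simp: C_def)
  moreover have "\<bar>kern e (z + r *\<^sub>R v + r\<^sup>2 *\<^sub>R w) - (kern e z + r * (2 * kern_D1 e z * (z \<bullet> v))
         + r\<^sup>2 * ((2 * kern_D1 e z * (v \<bullet> v) + 4 * kern_D2 e z * (z \<bullet> v)\<^sup>2) / 2 + 2 * kern_D1 e z * (z \<bullet> w)))\<bar>
       \<le> C * \<bar>r\<bar>^3" if q: "z \<bullet> z + e \<ge> m" and z: "norm z \<le> R" and r: "\<bar>r\<bar> \<le> r0" for z r
  proof -
    define q where "q = z \<bullet> z + e"
    define F1 where "F1 = - s * q powr (-s-1)"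
    define F2 where "F2 = s*(s+1) * q powr (-s-2)"
    define \<alpha> where "\<alpha> = 2 * (z \<bullet> v)"
    define \<beta> where "\<beta> = v \<bullet> v + 2 * (z \<bullet> w)"
    define \<gamma> where "\<gamma> = 2 * (v \<bullet> w) + r * (w \<bullet> w)"
    define d where "d = r * \<alpha> + r^2 * \<beta> + r^3 * \<gamma>"
    have r1: "\<bar>r\<bar> \<le> 1" "\<bar>r\<bar> \<le> m / (6*B)" using r by (auto simp: r0_def)
    have cs: "\<bar>z \<bullet> v\<bar> \<le> R * norm v" "\<bar>z \<bullet> w\<bar> \<le> R * norm w" "\<bar>v \<bullet> w\<bar> \<le> norm v * norm w"
      using Cauchy_Schwarz_ineq2[of z v] Cauchy_Schwarz_ineq2[of z w] Cauchy_Schwarz_ineq2[of v w] z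
        mult_right_mono[OF z, of "norm v"] mult_right_mono[OF z, of "norm w"] by auto
    have n0: "R * norm v \<ge> 0" "R * norm w \<ge> 0" "norm v * norm w \<ge> 0" "norm v ^2 \<ge> 0" "norm w ^2 \<ge> 0" using R by auto
    have Bx: "B = 1 + 2 * (R * norm v) + 2 * (R * norm w) + norm v ^ 2 + 2 * (norm v * norm w) + norm w ^ 2"
      by (simp add: B_def algebra_simps)
    have a: "\<bar>\<alpha>\<bar> \<le> B" unfolding \<alpha>_def Bx using cs n0 by linarith
    have b: "\<bar>\<beta>\<bar> \<le> B" unfolding \<beta>_def Bx power2_norm_eq_inner[symmetric] using cs n0 by linarith
    have "\<bar>r * (w \<bullet> w)\<bar> \<le> norm w ^2" using r1 mult_right_mono[of "\<bar>r\<bar>" 1 "w \<bullet> w"]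
      by (simp add: abs_mult power2_norm_eq_inner)
    then have c: "\<bar>\<gamma>\<bar> \<le> B" unfolding \<gamma>_def Bx using cs n0 by linarith
    have r23: "\<bar>r\<bar>^2 \<le> \<bar>r\<bar>" "\<bar>r\<bar>^3 \<le> \<bar>r\<bar>" using r1 power_decreasing[of 1 2 "\<bar>r\<bar>"] power_decreasing[of 1 3 "\<bar>r\<bar>"] by auto
    have rb: "\<bar>r * \<alpha>\<bar> \<le> \<bar>r\<bar> * B" "\<bar>r^2 * \<beta>\<bar> \<le> \<bar>r\<bar> * B" "\<bar>r^3 * \<gamma>\<bar> \<le> \<bar>r\<bar> * B"
      using a b c r23 by (auto simp: abs_mult power_abs intro!: mult_mono)
    have dB: "\<bar>d\<bar> \<le> 3 * B * \<bar>r\<bar>" unfolding d_def using rb by (simp add: mult_ac)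
    also have "\<dots> \<le> m / 2" using r1(2) B1 by (simp add: field_simps)
    finally have dm: "\<bar>d\<bar> \<le> m/2" .
    have qd: "(z + r *\<^sub>R v + r\<^sup>2 *\<^sub>R w) \<bullet> (z + r *\<^sub>R v + r\<^sup>2 *\<^sub>R w) + e = q + d"
      unfolding q_def d_def \<alpha>_def \<beta>_def \<gamma>_def
      by (simp add: inner_add_left inner_add_right inner_commute power2_eq_square power3_eq_cube algebra_simps)
    have qm: "q \<ge> m" using q q_def by simp
    have T: "\<bar>(q + d) powr (-s) - (q powr (-s) + F1 * d + F2 * d\<^sup>2 / 2)\<bar> \<le> C0 * \<bar>d\<bar>^3"
      using tay[OF qm dm] unfolding F1_def F2_def by (simp add: mult.assoc)
    have F1A: "\<bar>F1\<bar> \<le> A" and F2A: "\<bar>F2\<bar> \<le> A"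
    proof -
      have 1: "q powr (-s-1) \<le> m powr (-s-1)" "q powr (-s-2) \<le> m powr (-s-2)"
        using qm m s0 by (auto intro!: powr_mono2')
      have "s * q powr (-s-1) \<le> s * m powr (-s-1)" "s*(s+1) * q powr (-s-2) \<le> s*(s+1) * m powr (-s-2)"
        using 1 s0 by (auto intro!: mult_left_mono)
      moreover have "s * q powr (-s-1) \<ge> 0" "s*(s+1) * q powr (-s-2) \<ge> 0" using s0 by auto
      moreover have "s * m powr (-s-1) \<ge> 0" "s*(s+1) * m powr (-s-2) \<ge> 0" using s0 by auto
      moreover have "\<bar>F1\<bar> = s * q powr (-s-1)" "\<bar>F2\<bar> = s*(s+1) * q powr (-s-2)"
        unfolding F1_def F2_def using s0 by (simp_all add: abs_mult)
      ultimately show "\<bar>F1\<bar> \<le> A" "\<bar>F2\<bar> \<le> A" unfolding A_def by linarith+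
    qed
    \<comment> \<open>\<open>r^3 * E2\<close> is d^2 - (r \<alpha>)^2, factored as a difference of
      squares.\<close>
    define E2 where "E2 = (\<beta> + r * \<gamma>) * (2 * \<alpha> + r * \<beta> + r^2 * \<gamma>)"
    have E2: "\<bar>E2\<bar> \<le> 2*B * (4*B)"
    proof -
      have "\<bar>r*\<gamma>\<bar> \<le> 1 * B" "\<bar>r*\<beta>\<bar> \<le> 1 * B" unfolding abs_mult using r1 b c by (intro mult_mono; simp)+
      moreover have "\<bar>r^2*\<gamma>\<bar> \<le> 1 * B" unfolding abs_mult using r1 c B1 r23 by (intro mult_mono) (auto simp: power_abs)
      ultimately have "\<bar>\<beta> + r * \<gamma>\<bar> \<le> 2*B" "\<bar>2 * \<alpha> + r * \<beta> + r^2 * \<gamma>\<bar> \<le> 4*B"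
        using a b by linarith+
      then show ?thesis unfolding E2_def abs_mult using B1 by (intro mult_mono) auto
    qed
    have key: "F1 * d + F2 * d\<^sup>2/2 - (r * (F1 * \<alpha>) + r\<^sup>2 * (F1 * \<beta> + F2 * \<alpha>\<^sup>2 / 2)) = r^3 * (F1 * \<gamma> + F2 / 2 * E2)"
      unfolding d_def E2_def by (simp add: field_simps power2_eq_square power3_eq_cube)
    have "\<bar>F1 * \<gamma> + F2 / 2 * E2\<bar> \<le> A * B + A * (4 * B * B)"
    proof -
      have "\<bar>F1 * \<gamma>\<bar> \<le> A * B" unfolding abs_mult using F1A c A0 by (intro mult_mono) auto
      moreover have "\<bar>F2 * E2\<bar> \<le> A * (2*B*(4*B))" unfolding abs_mult using F2A E2 A0 by (intro mult_mono) auto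
      ultimately show ?thesis by (simp add: field_simps)
    qed
    then have k2: "\<bar>r^3 * (F1 * \<gamma> + F2 / 2 * E2)\<bar> \<le> \<bar>r\<bar>^3 * (A * B + A * (4 * B * B))"
      unfolding abs_mult power_abs by (intro mult_left_mono) auto
    have k3: "C0 * \<bar>d\<bar>^3 \<le> C0 * (3*B)^3 * \<bar>r\<bar>^3"
      using mult_left_mono[OF power_mono[OF dB, of 3] C0] by (simp add: power_mult_distrib mult_ac)
    have lhs: "kern e (z + r *\<^sub>R v + r\<^sup>2 *\<^sub>R w) = (q + d) powr (-s)" "kern e z = q powr (-s)"
      "kern_D1 e z = F1" "kern_D2 e z = F2"
      unfolding kern_def kern_D1_def kern_D2_def qd F1_def F2_def by (simp_all add: s_def q_def)
    have "r * (2 * F1 * (z \<bullet> v)) + r\<^sup>2 * ((2 * F1 * (v \<bullet> v) + 4 * F2 * (z \<bullet> v)\<^sup>2) / 2 + 2 * F1 * (z \<bullet> w))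
       = r * (F1 * \<alpha>) + r\<^sup>2 * (F1 * \<beta> + F2 * \<alpha>\<^sup>2 / 2)"
      by (simp add: \<alpha>_def \<beta>_def power2_eq_square field_simps)
    then have eq: "(q + d) powr (-s) - (q powr (-s) + r * (2 * F1 * (z \<bullet> v)) + r\<^sup>2 * ((2 * F1 * (v \<bullet> v) + 4 * F2 * (z \<bullet> v)\<^sup>2) / 2 + 2 * F1 * (z \<bullet> w)))
       = ((q + d) powr (-s) - (q powr (-s) + F1 * d + F2 * d\<^sup>2 / 2)) + r^3 * (F1 * \<gamma> + F2 / 2 * E2)"
      using key by linarith
    have "C * \<bar>r\<bar>^3 = C0 * (3*B)^3 * \<bar>r\<bar>^3 + \<bar>r\<bar>^3 * (A * B + A * (4 * B * B))"
      by (simp add: C_def algebra_simps)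
    then show ?thesis unfolding lhs eq using T k2 k3 by linarith
  qed
  ultimately show ?thesis using that by blast
qed

lemma kern_deriv_bounds:
  fixes z :: "'b::euclidean_space"
  assumes s: "kexp TYPE('b) > 0" and m: "m > 0" "z \<bullet> z + e \<ge> m"
  shows "0 < kern e z" "kern e z \<le> m powr (- kexp TYPE('b))"
    "kern_D1 e z < 0" "\<bar>kern_D1 e z\<bar> \<le> kexp TYPE('b) * m powr (- kexp TYPE('b) - 1)"
    "\<bar>kern_D2 e z\<bar> \<le> kexp TYPE('b) * (kexp TYPE('b) + 1) * m powr (- kexp TYPE('b) - 2)"
  using assms unfolding kern_def kern_D1_def kern_D2_def
  by (auto simp: abs_mult intro!: powr_mono2' mult_left_mono mult_pos_pos)

lemma pot_integrable:
  fixes z :: "'b::euclidean_space"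
  assumes s: "kexp TYPE('b) > 0" and m: "m > 0" and fin: "finite_measure \<mu>" and sets: "sets \<mu> = sets borel"
    and ae: "AE y in \<mu>. (z - y) \<bullet> (z - y) + e \<ge> m" and R: "AE y in \<mu>. norm (z - y) \<le> R"
  shows "integrable \<mu> (\<lambda>y. kern e (z - y))"
    "integrable \<mu> (\<lambda>y. kern_D1 e (z - y))"
    "integrable \<mu> (\<lambda>y. kern_D1 e (z - y) *\<^sub>R (z - y))"
    "integrable \<mu> (\<lambda>y. kern_D2 e (z - y) * ((z - y) \<bullet> v)\<^sup>2)"
proof -
  note [measurable_cong] = sets
  interpret finite_measure \<mu> by fact
  show "integrable \<mu> (\<lambda>y. kern e (z - y))"
    by (rule integrable_const_bound[where B="m powr (- kexp TYPE('b))"])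
      (use ae in \<open>auto elim!: eventually_mono simp: kern_deriv_bounds[OF s m] abs_of_pos\<close>)
  have 1: "AE y in \<mu>. \<bar>kern_D1 e (z - y)\<bar> \<le> kexp TYPE('b) * m powr (- kexp TYPE('b) - 1)"
    using ae by eventually_elim (rule kern_deriv_bounds[OF s m])
  show "integrable \<mu> (\<lambda>y. kern_D1 e (z - y))"
    by (rule integrable_const_bound[where B="kexp TYPE('b) * m powr (- kexp TYPE('b) - 1)"])
      (use 1 in auto)
  show "integrable \<mu> (\<lambda>y. kern_D1 e (z - y) *\<^sub>R (z - y))"
  proof (rule integrable_const_bound[where B="kexp TYPE('b) * m powr (- kexp TYPE('b) - 1) * R"])
    show "AE y in \<mu>. norm (kern_D1 e (z - y) *\<^sub>R (z - y)) \<le> kexp TYPE('b) * m powr (- kexp TYPE('b) - 1) * R"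
      using 1 R by eventually_elim (use s in \<open>auto intro!: mult_mono\<close>)
  qed measurable
  show "integrable \<mu> (\<lambda>y. kern_D2 e (z - y) * ((z - y) \<bullet> v)\<^sup>2)"
  proof (rule integrable_const_bound[where B="(kexp TYPE('b) * (kexp TYPE('b) + 1) * m powr (- kexp TYPE('b) - 2)) * (R * norm v)\<^sup>2"])
    show "AE y in \<mu>. norm (kern_D2 e (z - y) * ((z - y) \<bullet> v)\<^sup>2) \<le> (kexp TYPE('b) * (kexp TYPE('b) + 1) * m powr (- kexp TYPE('b) - 2)) * (R * norm v)\<^sup>2"
      using ae R
    proof eventually_elim
      case (elim y)
      have "\<bar>(z - y) \<bullet> v\<bar> \<le> R * norm v"
        using Cauchy_Schwarz_ineq2[of "z-y" v] mult_right_mono[OF elim(2), of "norm v"] by auto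
      then have "((z - y) \<bullet> v)\<^sup>2 \<le> (R * norm v)\<^sup>2" using power_mono[of "\<bar>(z - y) \<bullet> v\<bar>" _ 2] by simp
      then show ?case using kern_deriv_bounds(5)[OF s m elim(1)] s
        by (simp only: real_norm_def abs_mult abs_power2) (intro mult_mono, auto)
    qed
  qed measurable
qed

text \<open>The kernel expansion is integrated term by term. The last assumption keeps the displaced
  points away from the singularity, so that the kernel is integrable there too.\<close>

lemma pot_has_jet:
  fixes z :: "'b::euclidean_space"
  assumes s: "kexp TYPE('b) > 0" and m: "m > 0" and fin: "finite_measure \<mu>" and sets: "sets \<mu> = sets borel"
    and ae: "AE y in \<mu>. (z - y) \<bullet> (z - y) + e \<ge> m" and R: "AE y in \<mu>. norm (z - y) \<le> R"
    and ae': "\<forall>\<^sub>F z' in nhds z. AE y in \<mu>. (z' - y) \<bullet> (z' - y) + e \<ge> m/2"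
  shows "has_jet (pot e \<mu>) z (pot_grad e \<mu> z) (pot_hess e \<mu> z)"
  unfolding has_jet_def
proof (intro conjI allI)
  interpret finite_measure \<mu> by fact
  note [measurable_cong] = sets
  note int = pot_integrable[OF s m fin sets ae R]
  show "pot_hess e \<mu> z (c *\<^sub>R v) = c\<^sup>2 * pot_hess e \<mu> z v" for c v
    unfolding pot_hess_def by (subst integral_mult_right_zero[symmetric])
      (simp add: algebra_simps power_mult_distrib power2_eq_square)
  fix v w :: 'b
  have R': "AE y in \<mu>. norm (z - y) \<le> max R 1" using R by eventually_elim auto
  obtain C r0 where r0: "r0 > 0" "C \<ge> 0" and bd: "\<And>z r. z \<bullet> z + e \<ge> m \<Longrightarrow> norm z \<le> max R 1 \<Longrightarrow> \<bar>r\<bar> \<le> r0 \<Longrightarrow>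
       \<bar>kern e (z + r *\<^sub>R v + r\<^sup>2 *\<^sub>R w) - (kern e z + r * (2 * kern_D1 e z * (z \<bullet> v))
         + r\<^sup>2 * ((2 * kern_D1 e z * (v \<bullet> v) + 4 * kern_D2 e z * (z \<bullet> v)\<^sup>2) / 2 + 2 * kern_D1 e z * (z \<bullet> w)))\<bar>
       \<le> C * \<bar>r\<bar>^3"
    by (rule kern_jet_bound[OF s m, of "max R 1" e v w]) auto
  have "((\<lambda>r::real. z + r *\<^sub>R v + r\<^sup>2 *\<^sub>R w) \<longlongrightarrow> z + 0 *\<^sub>R v + 0\<^sup>2 *\<^sub>R w) (nhds 0)"
    by (intro tendsto_intros filterlim_ident)
  then have "\<forall>\<^sub>F r in nhds (0::real). AE y in \<mu>. (z + r *\<^sub>R v + r\<^sup>2 *\<^sub>R w - y) \<bullet> (z + r *\<^sub>R v + r\<^sup>2 *\<^sub>R w - y) + e \<ge> m/2"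
    using ae' by (auto simp: filterlim_iff)
  then obtain r1 where r1: "r1 > 0" "\<And>r. \<bar>r\<bar> < r1 \<Longrightarrow> AE y in \<mu>. (z + r *\<^sub>R v + r\<^sup>2 *\<^sub>R w - y) \<bullet> (z + r *\<^sub>R v + r\<^sup>2 *\<^sub>R w - y) + e \<ge> m/2"
    unfolding eventually_nhds_metric by (auto simp: dist_norm)
  show "\<exists>C r0. 0 < r0 \<and> (\<forall>r. \<bar>r\<bar> \<le> r0 \<longrightarrow> \<bar>pot e \<mu> (z + r *\<^sub>R v + r\<^sup>2 *\<^sub>R w) - (pot e \<mu> z + r * (pot_grad e \<mu> z \<bullet> v) +
        r\<^sup>2 * (pot_hess e \<mu> z v / 2 + pot_grad e \<mu> z \<bullet> w))\<bar> \<le> C * \<bar>r\<bar> ^ 3)"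
  proof (intro exI conjI allI impI)
    show "0 < min r0 (r1/2)" using r0 r1 by auto
    fix r :: real assume r: "\<bar>r\<bar> \<le> min r0 (r1/2)"
    have rr: "\<bar>r\<bar> < r1" using r r1 by auto
    let ?z = "z + r *\<^sub>R v + r\<^sup>2 *\<^sub>R w"
    have Rz: "AE y in \<mu>. norm (?z - y) \<le> R + norm (r *\<^sub>R v + r\<^sup>2 *\<^sub>R w)"
      using R
    proof eventually_elim
      case (elim y)
      have "norm (?z - y) \<le> norm (z - y) + norm (r *\<^sub>R v + r\<^sup>2 *\<^sub>R w)"
        using norm_triangle_ineq[of "z - y" "r *\<^sub>R v + r\<^sup>2 *\<^sub>R w"] by (simp add: algebra_simps)
      with elim show ?case by linarith
    qed
    have i1: "integrable \<mu> (\<lambda>y. kern e (?z - y))"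
      by (rule pot_integrable(1)[OF s _ fin sets r1(2)[OF rr] Rz]) (use m in auto)
    let ?T = "\<lambda>y. kern e (z - y) + r * (2 * kern_D1 e (z - y) * ((z - y) \<bullet> v))
         + r\<^sup>2 * ((2 * kern_D1 e (z - y) * (v \<bullet> v) + 4 * kern_D2 e (z - y) * ((z - y) \<bullet> v)\<^sup>2) / 2 + 2 * kern_D1 e (z - y) * ((z - y) \<bullet> w))"
    have ig: "integrable \<mu> (\<lambda>y. kern_D1 e (z - y) * ((z - y) \<bullet> x))" for x
      using integrable_inner_left[OF int(3), of x] by simp
    have g: "pot_grad e \<mu> z \<bullet> x = (\<integral>y. 2 * kern_D1 e (z - y) * ((z - y) \<bullet> x) \<partial>\<mu>)" for x
      unfolding pot_grad_def using int(3)
      by (subst integral_inner_left[symmetric]) (auto simp: scaleR_scaleR[symmetric] mult.assoc simp del: scaleR_scaleR)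
    have iT: "integrable \<mu> ?T" using int ig
      by (auto simp: mult.assoc intro!: integrable_add integrable_mult_right integrable_divide_zero)
    have TI: "(\<integral>y. ?T y \<partial>\<mu>) = pot e \<mu> z + r * (pot_grad e \<mu> z \<bullet> v) + r\<^sup>2 * (pot_hess e \<mu> z v / 2 + pot_grad e \<mu> z \<bullet> w)"
    proof -
      have 1: "integrable \<mu> (\<lambda>y. 2 * kern_D1 e (z - y) * ((z - y) \<bullet> x))" for x
        using integrable_mult_right[OF ig, of 2 x] by (simp add: mult.assoc)
      have 2: "integrable \<mu> (\<lambda>y. 2 * kern_D1 e (z - y) * (v \<bullet> v) + 4 * kern_D2 e (z - y) * ((z - y) \<bullet> v)\<^sup>2)"
        using int by (auto simp: mult.assoc intro!: integrable_add)
      show ?thesis unfolding g pot_def pot_hess_def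
        using int(1) 1 2 by (simp add: integral_add integral_divide_zero)
    qed
    have E: "pot e \<mu> ?z - (\<integral>y. ?T y \<partial>\<mu>) = (\<integral>y. kern e (?z - y) - ?T y \<partial>\<mu>)"
      unfolding pot_def using i1 iT by (simp del: integral_mult_right_zero)
    have F: "\<bar>pot e \<mu> ?z - (\<integral>y. ?T y \<partial>\<mu>)\<bar> \<le> (\<integral>y. C * \<bar>r\<bar>^3 \<partial>\<mu>)" unfolding E
    proof (rule integral_abs_bound[THEN order_trans], rule integral_mono_AE)
      show "integrable \<mu> (\<lambda>y. \<bar>kern e (?z - y) - ?T y\<bar>)" using i1 iT by auto
      show "AE y in \<mu>. \<bar>kern e (?z - y) - ?T y\<bar> \<le> C * \<bar>r\<bar>^3"
        using ae R'
      proof eventually_elim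
        case (elim y)
        have zy: "?z - y = z - y + r *\<^sub>R v + r\<^sup>2 *\<^sub>R w" by (simp add: algebra_simps)
        have "\<bar>r\<bar> \<le> r0" using r by simp
        then show ?case unfolding zy by (rule bd[OF elim])
      qed
    qed auto
    have K: "(\<integral>y. C * \<bar>r\<bar>^3 \<partial>\<mu>) = (C * measure \<mu> (space \<mu>)) * \<bar>r\<bar> ^ 3" by simp
    show "\<bar>pot e \<mu> ?z - (pot e \<mu> z + r * (pot_grad e \<mu> z \<bullet> v) +
        r\<^sup>2 * (pot_hess e \<mu> z v / 2 + pot_grad e \<mu> z \<bullet> w))\<bar> \<le> (C * measure \<mu> (space \<mu>)) * \<bar>r\<bar> ^ 3"
      using F unfolding TI K .
  qed
qed

text \<open>The trace of the kernel's Hessian is 2 n D1 + 4 D2 (q - e), with q the regularized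
  squared distance. Since n = 2 s + 2 for s = \<open>kexp\<close>, everything without the factor
  \<open>e\<close> cancels: harmonic for \<open>e = 0\<close>, a strict sign for
  \<open>e > 0\<close>.\<close>

lemma pot_hess_trace:
  fixes z :: "'b::euclidean_space"
  assumes s: "kexp TYPE('b) > 0" and m: "m > 0" and fin: "finite_measure \<mu>" and sets: "sets \<mu> = sets borel"
    and ae: "AE y in \<mu>. (z - y) \<bullet> (z - y) + e \<ge> m" and R: "AE y in \<mu>. norm (z - y) \<le> R"
  shows "(\<Sum>b\<in>Basis. pot_hess e \<mu> z b) = - 2 * DIM('b) * kexp TYPE('b) * e * (\<integral>y. ((z - y) \<bullet> (z - y) + e) powr (- kexp TYPE('b) - 2) \<partial>\<mu>)"
proof -
  note int = pot_integrable[OF s m fin sets ae R]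
  have "(\<Sum>b\<in>Basis. pot_hess e \<mu> z b) = (\<integral>y. (\<Sum>b\<in>Basis. 2 * kern_D1 e (z - y) * (b \<bullet> b) + 4 * kern_D2 e (z - y) * ((z - y) \<bullet> b)\<^sup>2) \<partial>\<mu>)"
    unfolding pot_hess_def by (rule Bochner_Integration.integral_sum[symmetric]) (use int in \<open>auto simp: mult.assoc\<close>)
  also have "\<dots> = (\<integral>y. - (2 * DIM('b) * kexp TYPE('b) * e) * ((z - y) \<bullet> (z - y) + e) powr (- kexp TYPE('b) - 2) \<partial>\<mu>)"
  proof (rule integral_cong_AE)
    note [measurable_cong] = sets
    show "(\<lambda>y. (\<Sum>b\<in>Basis. 2 * kern_D1 e (z - y) * (b \<bullet> b) + 4 * kern_D2 e (z - y) * ((z - y) \<bullet> b)\<^sup>2)) \<in> borel_measurable \<mu>"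
      by measurable
    show "(\<lambda>y. - (2 * DIM('b) * kexp TYPE('b) * e) * ((z - y) \<bullet> (z - y) + e) powr (- kexp TYPE('b) - 2)) \<in> borel_measurable \<mu>" by measurable
    show "AE y in \<mu>. (\<Sum>b\<in>Basis. 2 * kern_D1 e (z - y) * (b \<bullet> b) + 4 * kern_D2 e (z - y) * ((z - y) \<bullet> b)\<^sup>2) =
          - (2 * DIM('b) * kexp TYPE('b) * e) * ((z - y) \<bullet> (z - y) + e) powr (- kexp TYPE('b) - 2)"
      using ae
    proof eventually_elim
      case (elim y)
      let ?x = "z - y" and ?s = "kexp TYPE('b)"
      define q where "q = ?x \<bullet> ?x + e"
      have q: "q > 0" using elim m q_def by auto
      have xx: "(\<Sum>b\<in>Basis. (?x \<bullet> b)\<^sup>2) = q - e" unfolding q_def euclidean_inner[of ?x ?x] by (simp add: power2_eq_square)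
      have pw: "q powr (- ?s - 1) = q * q powr (- ?s - 2)" 
      using q by (simp add: powr_diff power2_eq_square)
      have ds: "real DIM('b) = 2 * ?s + 2" by (simp add: kexp_def field_simps)
      have "(\<Sum>b\<in>(Basis::'b set). 2 * kern_D1 e ?x * (b \<bullet> b) + 4 * kern_D2 e ?x * (?x \<bullet> b)\<^sup>2)
        = 2 * kern_D1 e ?x * DIM('b) + 4 * kern_D2 e ?x * (q - e)"
        unfolding xx[symmetric] sum.distrib sum_distrib_left by simp
      also have "\<dots> = - (2 * DIM('b) * ?s * e) * q powr (- ?s - 2)"
        unfolding kern_D1_def kern_D2_def q_def[symmetric] pw by (simp add: ds algebra_simps)
      finally show ?case by (simp add: q_def)
    qed
  qed
  finally show ?thesis by simp
qed

section \<open>Comparison of minima along Minkowski combinations\<close>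

text \<open>The coefficient \<open>b\<close> is half of a second derivative. Only an expansion at 0
  is asked for, so that the minimum of two functions can qualify.\<close>

definition expands2 :: "(real \<Rightarrow> real) \<Rightarrow> real \<Rightarrow> real \<Rightarrow> real \<Rightarrow> bool" where
  "expands2 F c a b \<longleftrightarrow> (\<exists>C r0. r0 > 0 \<and> (\<forall>r. \<bar>r\<bar> \<le> r0 \<longrightarrow> \<bar>F r - (c + r * a + r\<^sup>2 * b)\<bar> \<le> C * \<bar>r\<bar> ^ 3))"

lemma has_jet_expands2:
  "has_jet u z g Q \<Longrightarrow> expands2 (\<lambda>r. u (z + r *\<^sub>R v + r\<^sup>2 *\<^sub>R w)) (u z) (g \<bullet> v) (Q v / 2 + g \<bullet> w)"
  unfolding has_jet_def expands2_def by blast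

text \<open>Common coefficients exclude a kink, and each value of the minimum is a value of
  \<open>F\<close> or of \<open>G\<close>.\<close>

lemma expands2_min:
  assumes "expands2 F c a b" "expands2 G c a b"
  shows "expands2 (\<lambda>r. min (F r) (G r)) c a b"
proof -
  obtain C r0 C' r0' where *: "r0 > 0" "r0' > 0"
    "\<And>r. \<bar>r\<bar> \<le> r0 \<Longrightarrow> \<bar>F r - (c + r * a + r\<^sup>2 * b)\<bar> \<le> C * \<bar>r\<bar> ^ 3"
    "\<And>r. \<bar>r\<bar> \<le> r0' \<Longrightarrow> \<bar>G r - (c + r * a + r\<^sup>2 * b)\<bar> \<le> C' * \<bar>r\<bar> ^ 3"
    using assms unfolding expands2_def by blast
  show ?thesis unfolding expands2_def
  proof (intro exI conjI allI impI)
    show "0 < min r0 r0'" using * by simp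
    fix r :: real assume r: "\<bar>r\<bar> \<le> min r0 r0'"
    have "C * \<bar>r\<bar>^3 \<le> max C C' * \<bar>r\<bar>^3" "C' * \<bar>r\<bar>^3 \<le> max C C' * \<bar>r\<bar>^3"
      by (auto intro!: mult_right_mono)
    moreover have "\<bar>r\<bar> \<le> r0" "\<bar>r\<bar> \<le> r0'" using r by auto
    note *(3)[OF this(1)] *(4)[OF this(2)]
    ultimately show "\<bar>min (F r) (G r) - (c + r * a + r\<^sup>2 * b)\<bar> \<le> max C C' * \<bar>r\<bar> ^ 3"
      unfolding min_def by (cases "F r \<le> G r") auto
  qed
qed

text \<open>Adding the inequalities at r and -r cancels the first-order terms; dividing by r^2
  compares the second-order ones up to O(r).\<close>

lemma expands2_le:
  assumes "expands2 F c a b" "expands2 G c' a' b'" and d: "d > 0"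
    and le: "\<And>r. \<bar>r\<bar> < d \<Longrightarrow> F r - G r \<le> c - c'"
  shows "b \<le> b'"
proof (rule ccontr)
  assume n: "\<not> b \<le> b'"
  obtain C r0 C' r0' where *: "r0 > 0" "r0' > 0"
    "\<And>r. \<bar>r\<bar> \<le> r0 \<Longrightarrow> \<bar>F r - (c + r * a + r\<^sup>2 * b)\<bar> \<le> C * \<bar>r\<bar> ^ 3"
    "\<And>r. \<bar>r\<bar> \<le> r0' \<Longrightarrow> \<bar>G r - (c' + r * a' + r\<^sup>2 * b')\<bar> \<le> C' * \<bar>r\<bar> ^ 3"
    using assms unfolding expands2_def by blast
  define M where "M = \<bar>C\<bar> + \<bar>C'\<bar> + 1"
  \<comment> \<open>The last bound makes the cubic error, divided by r^2, at most half of the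
    supposed gap \<open>b - b'\<close>.\<close>
  define r where "r = min (d/2) (min (min r0 r0') ((b - b') / (2 * M)))"
  have M: "M > 0" "C + C' < M" by (auto simp: M_def)
  have r: "r > 0" "r < d" "r \<le> r0" "r \<le> r0'" "r \<le> (b - b') / (2 * M)"
    using * d n M by (auto simp: r_def min_less_iff_disj)
  have "F r - G r \<le> c - c'" "F (-r) - G (-r) \<le> c - c'" using le r by auto
  moreover have "\<bar>F r - (c + r * a + r\<^sup>2 * b)\<bar> \<le> C * r ^ 3" "\<bar>F (-r) - (c - r * a + r\<^sup>2 * b)\<bar> \<le> C * r ^ 3"
    "\<bar>G r - (c' + r * a' + r\<^sup>2 * b')\<bar> \<le> C' * r ^ 3" "\<bar>G (-r) - (c' - r * a' + r\<^sup>2 * b')\<bar> \<le> C' * r ^ 3"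
    using *(3)[of r] *(3)[of "-r"] *(4)[of r] *(4)[of "-r"] r by auto
  ultimately have "r\<^sup>2 * b - r\<^sup>2 * b' \<le> C * r^3 + C' * r^3" by linarith
  then have "r\<^sup>2 * (b - b') \<le> r\<^sup>2 * ((C + C') * r)" by (simp add: algebra_simps power2_eq_square power3_eq_cube)
  then have "b - b' \<le> (C + C') * r" using r by simp
  also have "\<dots> \<le> M * r" using M r by (intro mult_right_mono) auto
  also have "\<dots> \<le> (b - b') / 2" using r(5) M by (simp add: field_simps)
  finally show False using n by simp
qed

lemma expands2_increasing:
  assumes "expands2 F c a b" and a: "a > 0"
  shows "\<forall>\<^sub>F r in at_right 0. F r > c"
proof -
  obtain C r0 where *: "r0 > 0" "\<And>r. \<bar>r\<bar> \<le> r0 \<Longrightarrow> \<bar>F r - (c + r * a + r\<^sup>2 * b)\<bar> \<le> C * \<bar>r\<bar> ^ 3"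
    using assms unfolding expands2_def by blast
  have "((\<lambda>r. a + r * b - C * r\<^sup>2) \<longlongrightarrow> a + 0 * b - C * 0\<^sup>2) (at_right 0)" by (intro tendsto_intros)
  then have "\<forall>\<^sub>F r in at_right 0. a + r * b - C * r\<^sup>2 > 0" using a by (auto dest: order_tendstoD)
  moreover have "\<forall>\<^sub>F r in at_right 0. r < r0" "\<forall>\<^sub>F r::real in at_right 0. r > 0"
    using *(1) by (auto simp: eventually_at_right_field)
  ultimately show ?thesis
  proof eventually_elim
    case (elim r)
    have "r * (a + r * b - C * r\<^sup>2) > 0" using elim by simp
    then have "r * a + r\<^sup>2 * b - C * r^3 > 0" by (simp add: algebra_simps power2_eq_square power3_eq_cube)
    moreover have "\<bar>F r - (c + r * a + r\<^sup>2 * b)\<bar> \<le> C * r ^ 3" using *(2)[of r] elim by simp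
    ultimately show ?case by linarith
  qed
qed

text \<open>Along each basis direction the test gives c^2 Q <= Q', and summing contradicts the signs
  of the Laplacians. The factor \<open>c\<close> is for a Minkowski combination of which only one
  point moves; \<open>c = 1\<close> is the usual maximum principle.\<close>

lemma no_local_max_subharmonic_minus_strict_superharmonic:
  fixes f \<phi> :: "'b::euclidean_space \<Rightarrow> real"
  assumes f: "has_jet f z g Q" "(\<Sum>b\<in>Basis. Q b) \<ge> 0"
    and \<phi>: "has_jet \<phi> x g' Q'" "(\<Sum>b\<in>Basis. Q' b) < 0"
    and le: "\<forall>\<^sub>F h in nhds 0. f (z + c *\<^sub>R h) - \<phi> (x + h) \<le> f z - \<phi> x"
  shows False
proof -
  obtain d where d: "d > 0" "\<And>h. norm h < d \<Longrightarrow> f (z + c *\<^sub>R h) - \<phi> (x + h) \<le> f z - \<phi> x"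
    using le by (auto simp: eventually_nhds_metric)
  have "c\<^sup>2 * Q b \<le> Q' b" if b: "b \<in> Basis" for b
  proof -
    have 1: "expands2 (\<lambda>r. f (z + c *\<^sub>R (r *\<^sub>R b))) (f z) (g \<bullet> (c *\<^sub>R b)) (Q (c *\<^sub>R b) / 2)"
      using has_jet_expands2[OF f(1), of "c *\<^sub>R b" 0] by (simp add: mult.commute)
    have 2: "expands2 (\<lambda>r. \<phi> (x + r *\<^sub>R b)) (\<phi> x) (g' \<bullet> b) (Q' b / 2)"
      using has_jet_expands2[OF \<phi>(1), of b 0] by simp
    have "Q (c *\<^sub>R b) / 2 \<le> Q' b / 2"
      by (rule expands2_le[OF 1 2 d(1)]) (use b d(2) in \<open>simp del: scaleR_scaleR\<close>)
    then show ?thesis using f(1) by (simp add: has_jet_def)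
  qed
  then have "(\<Sum>b\<in>Basis. c\<^sup>2 * Q b) \<le> (\<Sum>b\<in>Basis. Q' b)" by (rule sum_mono)
  moreover have "(\<Sum>b\<in>Basis. c\<^sup>2 * Q b) \<ge> 0" using f(2) by (simp add: sum_distrib_left[symmetric])
  ultimately show False using \<phi>(2) by simp
qed

text \<open>Meant for potentials extended by a constant into the bodies, which may jump there.
  Without a maximum, the sets where \<open>f\<close> is below one of its values would cover
  \<open>S\<close>; in a finite subcover the point with the largest such value is left out.\<close>

lemma compact_attains_max_usc:
  fixes f :: "'a::topological_space \<Rightarrow> real"
  assumes "compact S" "S \<noteq> {}" and usc: "\<And>c. open {x. f x < c}"
  shows "\<exists>x\<in>S. \<forall>y\<in>S. f y \<le> f x"
proof (rule ccontr)
  assume nt: "\<not> (\<exists>x\<in>S. \<forall>y\<in>S. f y \<le> f x)"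
  have "\<exists>y\<in>S. f x < f y" if "x \<in> S" for x
    using nt that by (meson not_le)
  then have "S \<subseteq> (\<Union>y\<in>S. {x. f x < f y})" by blast
  then obtain T where T: "T \<subseteq> S" "finite T" "S \<subseteq> (\<Union>y\<in>T. {x. f x < f y})"
    using compactE_image[OF assms(1), of S "\<lambda>y. {x. f x < f y}"] usc by blast
  have "T \<noteq> {}" using T assms(2) by auto
  then have "Max (f ` T) \<in> f ` T" using T by (intro Max_in) auto
  then obtain y where y: "y \<in> T" "f y = Max (f ` T)" by auto
  then have "f y' \<le> f y" if "y' \<in> T" for y' using that T by auto
  moreover obtain y' where "y' \<in> T" "f y < f y'" using T y by blast
  ultimately show False by force
qed

text \<open>At a maximum the two gradients are parallel, \<open>g1 = a e\<close> and \<open>g0 = b e\<close>.  The curves are chosen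
  so that both functions agree to second order along them while the combination moves on a straight
  line; the common second-order coefficient is then a positive combination of the two Hessians.\<close>

lemma no_max_of_min_equal_case:
  fixes u1 u0 \<phi> :: "'b::euclidean_space \<Rightarrow> real"
  assumes l: "0 < l" "l < 1"
    and u1: "has_jet u1 x1 g1 Q1" "(\<Sum>b\<in>Basis. Q1 b) \<ge> 0" "g1 \<noteq> 0"
    and u0: "has_jet u0 x0 g0 Q0" "(\<Sum>b\<in>Basis. Q0 b) \<ge> 0" "g0 \<noteq> 0"
    and \<phi>: "has_jet \<phi> (l *\<^sub>R x1 + (1-l) *\<^sub>R x0) g Q" "(\<Sum>b\<in>Basis. Q b) < 0"
    and eq: "u1 x1 = u0 x0"
    and d: "d > 0" and max: "\<And>y1 y0. dist y1 x1 < d \<Longrightarrow> dist y0 x0 < d \<Longrightarrow>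
        min (u1 y1) (u0 y0) - \<phi> (l *\<^sub>R y1 + (1-l) *\<^sub>R y0) \<le> u1 x1 - \<phi> (l *\<^sub>R x1 + (1-l) *\<^sub>R x0)"
  shows False
proof -
  define a where "a = norm g1"
  define b where "b = norm g0"
  define e where "e = g1 /\<^sub>R a"
  have a: "a > 0" and b: "b > 0" using u1 u0 by (auto simp: a_def b_def)
  have near: "\<forall>\<^sub>F r in nhds (0::real). dist (y + r *\<^sub>R v + r\<^sup>2 *\<^sub>R w) y < d" for y v w :: 'b
  proof -
    have "((\<lambda>r::real. dist (y + r *\<^sub>R v + r\<^sup>2 *\<^sub>R w) y) \<longlongrightarrow> dist (y + 0 *\<^sub>R v + 0\<^sup>2 *\<^sub>R w) y) (nhds 0)"
      by (intro tendsto_intros filterlim_ident)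
    then show ?thesis using d by (auto dest: order_tendstoD)
  qed
  have e: "g1 = a *\<^sub>R e" "norm e = 1" using a u1(3) by (auto simp: e_def a_def)
  have g0: "g0 = b *\<^sub>R e"
  proof (rule ccontr)
    assume n: "g0 \<noteq> b *\<^sub>R e"
    define f where "f = g0 /\<^sub>R b"
    have f: "g0 = b *\<^sub>R f" "norm f = 1" using b u0(3) by (auto simp: f_def b_def)
    have "e \<noteq> f" using n f by auto
    moreover have ee: "e \<bullet> e = 1" "f \<bullet> f = 1" using e f by (auto simp: norm_eq_1)
    moreover have "(e - f) \<bullet> (e - f) = 2 - 2 * (e \<bullet> f)" using ee by (simp add: inner_diff_left inner_diff_right inner_commute)
    ultimately have ef: "e \<bullet> f < 1" using inner_gt_zero_iff[of "e - f"] by auto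
    \<comment> \<open>Both functions increase when \<open>x1\<close> moves along
      \<open>v / l\<close> and \<open>x0\<close> along \<open>- v / (1-l)\<close>, while the
      combination stays fixed.\<close>
    define v where "v = e - f"
    have "g1 \<bullet> v > 0" "g0 \<bullet> (- v) > 0"
      unfolding e(1) f(1) v_def using a b ee ef by (auto simp: inner_diff_right inner_commute)
    then have p: "g1 \<bullet> (v /\<^sub>R l) > 0" "g0 \<bullet> (- v /\<^sub>R (1 - l)) > 0"
      using l by (auto simp: mult_pos_neg)
    have "\<forall>\<^sub>F r in at_right 0. u1 (x1 + r *\<^sub>R (v /\<^sub>R l) + r\<^sup>2 *\<^sub>R 0) > u1 x1"
      by (rule expands2_increasing[OF has_jet_expands2[OF u1(1)] p(1)])
    moreover have "\<forall>\<^sub>F r in at_right 0. u0 (x0 + r *\<^sub>R (- v /\<^sub>R (1 - l)) + r\<^sup>2 *\<^sub>R 0) > u0 x0"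
      by (rule expands2_increasing[OF has_jet_expands2[OF u0(1)] p(2)])
    moreover have "\<forall>\<^sub>F r in at_right (0::real). dist (x1 + r *\<^sub>R (v /\<^sub>R l) + r\<^sup>2 *\<^sub>R 0) x1 < d"
      "\<forall>\<^sub>F r in at_right (0::real). dist (x0 + r *\<^sub>R (- v /\<^sub>R (1 - l)) + r\<^sup>2 *\<^sub>R 0) x0 < d"
      unfolding eventually_at_filter by (rule eventually_mono[OF near], blast)+
    ultimately have "\<forall>\<^sub>F r in at_right (0::real). False"
    proof eventually_elim
      case (elim r)
      have "l *\<^sub>R (x1 + r *\<^sub>R (v /\<^sub>R l) + r\<^sup>2 *\<^sub>R 0) + (1-l) *\<^sub>R (x0 + r *\<^sub>R (- v /\<^sub>R (1 - l)) + r\<^sup>2 *\<^sub>R 0) = l *\<^sub>R x1 + (1-l) *\<^sub>R x0"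
        using l by (simp add: scaleR_add_right scaleR_diff_right field_simps)
      with max[OF elim(3,4)] elim(1,2) eq show ?case by (auto simp: min_def split: if_splits)
    qed
    then show False by simp
  qed
  \<comment> \<open>The speeds \<open>\<rho>1\<close> and \<open>\<rho>0\<close> solve two
    equations: the combination has velocity \<open>v\<close>, and both functions have the same
    first-order coefficient.\<close>
  define D where "D = l * b + (1-l) * a"
  have D: "D > 0" using l a b by (simp add: D_def add_pos_pos)
  define \<rho>1 where "\<rho>1 = b / D"
  define \<rho>0 where "\<rho>0 = a / D"
  have \<rho>: "l * \<rho>1 + (1-l) * \<rho>0 = 1" "\<rho>1 * a = \<rho>0 * b"
  proof -
    have "l * \<rho>1 + (1-l) * \<rho>0 = D / D"
      unfolding \<rho>1_def \<rho>0_def times_divide_eq_right add_divide_distrib[symmetric] D_def ..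
    then show "l * \<rho>1 + (1-l) * \<rho>0 = 1" "\<rho>1 * a = \<rho>0 * b" using D by (auto simp: \<rho>1_def \<rho>0_def)
  qed
  have hom: "Q1 (c *\<^sub>R v) = c\<^sup>2 * Q1 v" "Q0 (c *\<^sub>R v) = c\<^sup>2 * Q0 v" for c v
    using u1(1) u0(1) by (auto simp: has_jet_def)
  define S where "S = (\<lambda>v. l * b / D * \<rho>1\<^sup>2 * Q1 v + (1-l) * a / D * \<rho>0\<^sup>2 * Q0 v)"
  have "S v \<le> Q v" for v
  proof -
    define A1 where "A1 = Q1 (\<rho>1 *\<^sub>R v) / 2"
    define A0 where "A0 = Q0 (\<rho>0 *\<^sub>R v) / 2"
    \<comment> \<open>Bending by \<open>(1-l) * k\<close> and \<open>- l * k\<close> along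
      \<open>e\<close> cancels in the combination. This \<open>k\<close> solves A1 + (1-l) a k = A0
      - l b k; the common value \<open>S v / 2\<close> is a weighted mean of \<open>A1\<close> and
      \<open>A0\<close>.\<close>
    define k where "k = (A0 - A1) / D"
    have kD: "k * D = A0 - A1" using D by (simp add: k_def)
    have S1: "A1 + g1 \<bullet> (((1-l) * k) *\<^sub>R e) = S v / 2"
    proof -
      have "A1 + g1 \<bullet> (((1-l) * k) *\<^sub>R e) = A1 + (1-l) * a * k" using e by (simp add: norm_eq_1)
      also have "\<dots> = S v / 2"
      proof -
        have "D * (A1 + (1-l) * a * k) = D * A1 + (1-l) * a * (k * D)" by (simp add: algebra_simps)
        also have "\<dots> = l * b * A1 + (1-l) * a * A0" unfolding kD by (simp add: D_def algebra_simps)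
        finally have "A1 + (1-l) * a * k = (l * b * A1 + (1-l) * a * A0) / D" using D by (simp add: field_simps)
        then show ?thesis by (simp add: S_def A1_def A0_def hom add_divide_distrib)
      qed
      finally show ?thesis .
    qed
    have S0: "A0 + g0 \<bullet> ((- l * k) *\<^sub>R e) = S v / 2"
    proof -
      have "A0 + g0 \<bullet> ((- l * k) *\<^sub>R e) = A0 - l * b * k" using e g0 by (simp add: norm_eq_1)
      also have "\<dots> = A1 + (1-l) * a * k" using kD unfolding D_def by (simp add: algebra_simps)
      also have "\<dots> = S v / 2" using S1 e by (simp add: norm_eq_1 mult_ac)
      finally show ?thesis .
    qed
    define c1 where "c1 = (\<lambda>r::real. x1 + r *\<^sub>R (\<rho>1 *\<^sub>R v) + r\<^sup>2 *\<^sub>R (((1-l) * k) *\<^sub>R e))"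
    define c0 where "c0 = (\<lambda>r::real. x0 + r *\<^sub>R (\<rho>0 *\<^sub>R v) + r\<^sup>2 *\<^sub>R ((- l * k) *\<^sub>R e))"
    have X1: "expands2 (\<lambda>r. u1 (c1 r)) (u1 x1) (\<rho>1 * a * (e \<bullet> v)) (S v / 2)"
    proof -
      have "expands2 (\<lambda>r. u1 (c1 r)) (u1 x1) (g1 \<bullet> (\<rho>1 *\<^sub>R v)) (A1 + g1 \<bullet> (((1-l) * k) *\<^sub>R e))"
        unfolding c1_def A1_def by (rule has_jet_expands2[OF u1(1)])
      moreover have "g1 \<bullet> (\<rho>1 *\<^sub>R v) = \<rho>1 * a * (e \<bullet> v)" by (simp add: e(1))
      ultimately show ?thesis unfolding S1 by (simp only:)
    qed
    have X0: "expands2 (\<lambda>r. u0 (c0 r)) (u1 x1) (\<rho>1 * a * (e \<bullet> v)) (S v / 2)"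
    proof -
      have "expands2 (\<lambda>r. u0 (c0 r)) (u0 x0) (g0 \<bullet> (\<rho>0 *\<^sub>R v)) (A0 + g0 \<bullet> ((- l * k) *\<^sub>R e))"
        unfolding c0_def A0_def by (rule has_jet_expands2[OF u0(1)])
      moreover have "g0 \<bullet> (\<rho>0 *\<^sub>R v) = \<rho>1 * a * (e \<bullet> v)" by (simp add: g0 \<rho>(2))
      ultimately show ?thesis unfolding S0 eq by (simp only:)
    qed
    have XF: "expands2 (\<lambda>r. \<phi> (l *\<^sub>R x1 + (1-l) *\<^sub>R x0 + r *\<^sub>R v + r\<^sup>2 *\<^sub>R 0)) (\<phi> (l *\<^sub>R x1 + (1-l) *\<^sub>R x0)) (g \<bullet> v) (Q v / 2)"
      using has_jet_expands2[OF \<phi>(1), of v 0] by simp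
    have comb: "l *\<^sub>R c1 r + (1-l) *\<^sub>R c0 r = l *\<^sub>R x1 + (1-l) *\<^sub>R x0 + r *\<^sub>R v + r\<^sup>2 *\<^sub>R 0" for r
    proof -
      have "l *\<^sub>R c1 r + (1-l) *\<^sub>R c0 r = l *\<^sub>R x1 + (1-l) *\<^sub>R x0 + (l * \<rho>1 + (1-l) * \<rho>0) *\<^sub>R (r *\<^sub>R v)
         + (r\<^sup>2 * (l * ((1-l)*k) + (1-l) * (-l*k))) *\<^sub>R e"
        unfolding c1_def c0_def by (simp add: algebra_simps)
      then show ?thesis unfolding \<rho>(1) by simp
    qed
    have "\<forall>\<^sub>F r in nhds 0. dist (c1 r) x1 < d \<and> dist (c0 r) x0 < d"
      unfolding c1_def c0_def by (intro eventually_conj near)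
    then obtain d' where d': "d' > 0" "\<And>r. \<bar>r\<bar> < d' \<Longrightarrow> dist (c1 r) x1 < d \<and> dist (c0 r) x0 < d"
      by (auto simp: eventually_nhds_metric dist_real_def)
    have "S v / 2 \<le> Q v / 2"
      by (rule expands2_le[OF expands2_min[OF X1 X0] XF d'(1)]) (use max d'(2) comb in metis)
    then show ?thesis by simp
  qed
  then have "(\<Sum>v\<in>Basis. S v) \<le> (\<Sum>v\<in>Basis. Q v)" by (intro sum_mono)
  moreover have "(\<Sum>v\<in>Basis. S v) \<ge> 0"
    unfolding S_def sum.distrib sum_distrib_left[symmetric] using u1(2) u0(2) l a b D
    by (intro add_nonneg_nonneg mult_nonneg_nonneg divide_nonneg_nonneg) auto
  ultimately show False using \<phi>(2) by simp
qed

text \<open>Decay at infinity makes a positive supremum a maximum. Both points in the bodies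
  contradict the bound on \<open>\<phi>\<close> there. If one potential is strictly smaller, or the
  other point lies in its body, only one potential is active and the one-point test applies. Equal
  values off both bodies need the two-point curves.\<close>

lemma minimum_comparison:
  fixes u1 u0 \<phi> :: "'b::euclidean_space \<Rightarrow> real"
  assumes l: "0 < l" "l < 1" and K1: "compact K1" and K0: "compact K0"
    and u1: "\<And>z. z \<notin> K1 \<Longrightarrow> u1 z \<le> 1 \<and> isCont u1 z \<and> (\<exists>g Q. has_jet u1 z g Q \<and> (\<Sum>b\<in>Basis. Q b) \<ge> 0 \<and> g \<noteq> 0)"
    and u0: "\<And>z. z \<notin> K0 \<Longrightarrow> u0 z \<le> 1 \<and> isCont u0 z \<and> (\<exists>g Q. has_jet u0 z g Q \<and> (\<Sum>b\<in>Basis. Q b) \<ge> 0 \<and> g \<noteq> 0)"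
    and dec: "(u1 \<longlongrightarrow> 0) at_infinity" "(u0 \<longlongrightarrow> 0) at_infinity"
    and \<phi>: "continuous_on UNIV \<phi>" "\<And>z. \<phi> z \<ge> 0" "\<And>z. \<exists>g Q. has_jet \<phi> z g Q \<and> (\<Sum>b\<in>Basis. Q b) < 0"
    and \<phi>1: "\<And>x1 x0. x1 \<in> K1 \<Longrightarrow> x0 \<in> K0 \<Longrightarrow> \<phi> (l *\<^sub>R x1 + (1-l) *\<^sub>R x0) \<ge> 1"
    and a: "a1 \<notin> K1" "a0 \<notin> K0"
  shows "min (u1 a1) (u0 a0) \<le> \<phi> (l *\<^sub>R a1 + (1-l) *\<^sub>R a0)"
proof (rule ccontr)
  \<comment> \<open>Since 1 bounds \<open>u1\<close> off \<open>K1\<close>, this extension is upper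
    semicontinuous whatever \<open>u1\<close> does near the boundary.\<close>
  define U1 where "U1 = (\<lambda>z. if z \<in> K1 then 1 else u1 z)"
  define U0 where "U0 = (\<lambda>z. if z \<in> K0 then 1 else u0 z)"
  define F where "F = (\<lambda>p. min (U1 (fst p)) (U0 (snd p)) - \<phi> (l *\<^sub>R fst p + (1-l) *\<^sub>R snd p))"
  define \<delta> where "\<delta> = F (a1, a0)"
  assume "\<not> ?thesis"
  then have \<delta>: "\<delta> > 0" using a by (auto simp: \<delta>_def F_def U1_def U0_def min_le_iff_disj not_le)
  obtain B1 where B1: "\<And>z. norm z \<ge> B1 \<Longrightarrow> u1 z < \<delta>"
    using order_tendstoD(2)[OF dec(1) \<delta>] by (auto simp: eventually_at_infinity)
  obtain B0 where B0: "\<And>z. norm z \<ge> B0 \<Longrightarrow> u0 z < \<delta>"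
    using order_tendstoD(2)[OF dec(2) \<delta>] by (auto simp: eventually_at_infinity)
  obtain C1 where C1: "\<And>z. z \<in> K1 \<Longrightarrow> norm z \<le> C1" using compact_imp_bounded[OF K1] by (auto simp: bounded_iff)
  obtain C0 where C0: "\<And>z. z \<in> K0 \<Longrightarrow> norm z \<le> C0" using compact_imp_bounded[OF K0] by (auto simp: bounded_iff)
  define R where "R = \<bar>B1\<bar> + \<bar>B0\<bar> + \<bar>C1\<bar> + \<bar>C0\<bar> + norm a1 + norm a0"
  have U1R: "U1 z < \<delta>" if "norm z > R" for z
  proof -
    have "z \<notin> K1" using C1[of z] that norm_ge_zero[of a1] norm_ge_zero[of a0] unfolding R_def by linarith
    moreover have "norm z \<ge> B1" using that norm_ge_zero[of a1] norm_ge_zero[of a0] unfolding R_def by linarith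
    ultimately show ?thesis using B1 by (simp add: U1_def)
  qed
  have U0R: "U0 z < \<delta>" if "norm z > R" for z
  proof -
    have "z \<notin> K0" using C0[of z] that norm_ge_zero[of a1] norm_ge_zero[of a0] unfolding R_def by linarith
    moreover have "norm z \<ge> B0" using that norm_ge_zero[of a1] norm_ge_zero[of a0] unfolding R_def by linarith
    ultimately show ?thesis using B0 by (simp add: U0_def)
  qed
  have o1: "open {z. U1 z < c}" for c
  proof (cases "c > 1")
    case True
    then have "{z. U1 z < c} = UNIV" using u1 by (force simp: U1_def)
    then show ?thesis by simp
  next
    case False
    have eq: "{z. U1 z < c} = u1 -` {..<c} \<inter> (-K1)" using False by (auto simp: U1_def)
    have "continuous_on (-K1) u1" using u1 by (auto intro: continuous_at_imp_continuous_on)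
    then have "open (u1 -` {..<c} \<inter> (-K1))"
      using continuous_on_open_vimage[of "-K1" u1] K1 by (auto simp: compact_imp_closed open_Compl)
    then show ?thesis unfolding eq .
  qed
  have o0: "open {z. U0 z < c}" for c
  proof (cases "c > 1")
    case True
    then have "{z. U0 z < c} = UNIV" using u0 by (force simp: U0_def)
    then show ?thesis by simp
  next
    case False
    have eq: "{z. U0 z < c} = u0 -` {..<c} \<inter> (-K0)" using False by (auto simp: U0_def)
    have "continuous_on (-K0) u0" using u0 by (auto intro: continuous_at_imp_continuous_on)
    then have "open (u0 -` {..<c} \<inter> (-K0))"
      using continuous_on_open_vimage[of "-K0" u0] K0 by (auto simp: compact_imp_closed open_Compl)
    then show ?thesis unfolding eq .
  qed
  have usc: "open {p. F p < c}" for c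
  proof -
    \<comment> \<open>A real \<open>d\<close> strictly between the minimum and
      \<open>c + \<phi>\<close> turns the inequality into a union of open conditions.\<close>
    have eq: "{p. F p < c} = (\<Union>d. ({z. U1 z < d} \<times> UNIV \<union> UNIV \<times> {z. U0 z < d}) \<inter> {p. \<phi> (l *\<^sub>R fst p + (1-l) *\<^sub>R snd p) > d - c})"
    proof (intro equalityI subsetI)
      fix p assume "p \<in> {p. F p < c}"
      then have "min (U1 (fst p)) (U0 (snd p)) < c + \<phi> (l *\<^sub>R fst p + (1-l) *\<^sub>R snd p)" by (simp add: F_def)
      then obtain d where "min (U1 (fst p)) (U0 (snd p)) < d" "d < c + \<phi> (l *\<^sub>R fst p + (1-l) *\<^sub>R snd p)" using dense by blast
      then show "p \<in> (\<Union>d. ({z. U1 z < d} \<times> UNIV \<union> UNIV \<times> {z. U0 z < d}) \<inter> {p. \<phi> (l *\<^sub>R fst p + (1-l) *\<^sub>R snd p) > d - c})"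
        by (intro UN_I[of d]) (auto simp: min_less_iff_disj mem_Times_iff)
    qed (auto simp: F_def min_less_iff_disj)
    have "continuous_on UNIV (\<lambda>p::'b\<times>'b. \<phi> (l *\<^sub>R fst p + (1-l) *\<^sub>R snd p))"
      by (intro continuous_on_compose2[OF \<phi>(1)] continuous_intros) auto
    then have "open {p::'b\<times>'b. \<phi> (l *\<^sub>R fst p + (1-l) *\<^sub>R snd p) > k}" for k
      by (intro open_Collect_less continuous_intros)
    then show ?thesis unfolding eq by (intro open_UN ballI open_Int open_Un open_Times o1 o0 open_UNIV)
  qed
  let ?S = "cball (0::'b) R \<times> cball (0::'b) R"
  have aS: "(a1, a0) \<in> ?S" by (auto simp: R_def)
  obtain p where p: "p \<in> ?S" "\<And>q. q \<in> ?S \<Longrightarrow> F q \<le> F p"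
    using compact_attains_max_usc[of ?S F, OF compact_Times[OF compact_cball compact_cball] _ usc] aS by blast
  obtain x1 x0 where px: "p = (x1, x0)" by fastforce
  have Fp: "F p \<ge> \<delta>" using p(2)[OF aS] by (simp add: \<delta>_def)
  have gmax: "F q \<le> F p" for q
  proof (cases "q \<in> ?S")
    case False
    then have "norm (fst q) > R \<or> norm (snd q) > R" by (auto simp: mem_Times_iff)
    then have "min (U1 (fst q)) (U0 (snd q)) < \<delta>" using U1R U0R by (auto simp: min_less_iff_disj)
    then show ?thesis using Fp \<phi>(2)[of "l *\<^sub>R fst q + (1-l) *\<^sub>R snd q"] by (simp add: F_def)
  qed (use p in auto)
  let ?x = "l *\<^sub>R x1 + (1-l) *\<^sub>R x0"
  have max: "min (U1 y1) (U0 y0) - \<phi> (l *\<^sub>R y1 + (1-l) *\<^sub>R y0) \<le> min (U1 x1) (U0 x0) - \<phi> ?x" for y1 y0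
    using gmax[of "(y1,y0)"] by (simp add: F_def px)
  obtain g Q where gQ: "has_jet \<phi> ?x g Q" "(\<Sum>b\<in>Basis. Q b) < 0" using \<phi>(3) by blast
  have off1: "\<forall>\<^sub>F y in nhds x1. y \<notin> K1" if "x1 \<notin> K1"
    using K1 that by (intro eventually_nhds_in_open[of "-K1", simplified]) (auto simp: compact_imp_closed open_Compl)
  have off0: "\<forall>\<^sub>F y in nhds x0. y \<notin> K0" if "x0 \<notin> K0"
    using K0 that by (intro eventually_nhds_in_open[of "-K0", simplified]) (auto simp: compact_imp_closed open_Compl)
  have sh: "((\<lambda>h. y + c *\<^sub>R h) \<longlongrightarrow> y) (nhds 0)" for y :: 'b and c
    using tendsto_add[OF tendsto_const tendsto_scaleR[OF tendsto_const filterlim_ident], of y c "0::'b"] by simp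
  \<comment> \<open>With \<open>x1\<close> frozen the minimum is \<open>u0\<close> near
    \<open>x0\<close>; moving the combination by \<open>h\<close> means moving \<open>x0\<close> by
    \<open>h / (1-l)\<close>.\<close>
  have ev0: False if x0: "x0 \<notin> K0" and ev: "\<forall>\<^sub>F y in nhds x0. u0 y \<le> U1 x1"
  proof -
    obtain g0 Q0 where u0': "has_jet u0 x0 g0 Q0" "(\<Sum>b\<in>Basis. Q0 b) \<ge> 0" using u0[OF x0] by blast
    show False
    proof (rule no_local_max_subharmonic_minus_strict_superharmonic[OF u0' gQ])
      have "\<forall>\<^sub>F y in nhds x0. u0 y \<le> U1 x1 \<and> y \<notin> K0" using ev off0[OF x0] by eventually_elim auto
      then have "\<forall>\<^sub>F h in nhds 0. u0 (x0 + (1/(1-l)) *\<^sub>R h) \<le> U1 x1 \<and> x0 + (1/(1-l)) *\<^sub>R h \<notin> K0"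
        using sh[of x0 "1/(1-l)"] by (auto simp: filterlim_iff)
      then show "\<forall>\<^sub>F h in nhds 0. u0 (x0 + (1/(1-l)) *\<^sub>R h) - \<phi> (?x + h) \<le> u0 x0 - \<phi> ?x"
      proof eventually_elim
        case (elim h)
        have "u0 x0 \<le> U1 x1" using ev by (rule eventually_nhds_x_imp_x)
        then have m: "min (U1 x1) (U0 x0) = u0 x0" using x0 by (simp add: U0_def)
        have c: "l *\<^sub>R x1 + (1-l) *\<^sub>R (x0 + (1/(1-l)) *\<^sub>R h) = ?x + h" using l by (simp add: scaleR_add_right)
        have m': "min (U1 x1) (U0 (x0 + (1/(1-l)) *\<^sub>R h)) = u0 (x0 + (1/(1-l)) *\<^sub>R h)"
          using elim by (simp add: U0_def min_absorb2)
        show ?case using max[of x1 "x0 + (1/(1-l)) *\<^sub>R h"] unfolding c m m' .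
      qed
    qed
  qed
  have ev1: False if x1: "x1 \<notin> K1" and ev: "\<forall>\<^sub>F y in nhds x1. u1 y \<le> U0 x0"
  proof -
    obtain g1 Q1 where u1': "has_jet u1 x1 g1 Q1" "(\<Sum>b\<in>Basis. Q1 b) \<ge> 0" using u1[OF x1] by blast
    show False
    proof (rule no_local_max_subharmonic_minus_strict_superharmonic[OF u1' gQ])
      have "\<forall>\<^sub>F y in nhds x1. u1 y \<le> U0 x0 \<and> y \<notin> K1" using ev off1[OF x1] by eventually_elim auto
      then have "\<forall>\<^sub>F h in nhds 0. u1 (x1 + (1/l) *\<^sub>R h) \<le> U0 x0 \<and> x1 + (1/l) *\<^sub>R h \<notin> K1"
        using sh[of x1 "1/l"] by (auto simp: filterlim_iff)
      then show "\<forall>\<^sub>F h in nhds 0. u1 (x1 + (1/l) *\<^sub>R h) - \<phi> (?x + h) \<le> u1 x1 - \<phi> ?x"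
      proof eventually_elim
        case (elim h)
        have "u1 x1 \<le> U0 x0" using ev by (rule eventually_nhds_x_imp_x)
        then have m: "min (U1 x1) (U0 x0) = u1 x1" using x1 by (simp add: U1_def)
        have c: "l *\<^sub>R (x1 + (1/l) *\<^sub>R h) + (1-l) *\<^sub>R x0 = ?x + h" using l by (simp add: scaleR_add_right)
        have m': "min (U1 (x1 + (1/l) *\<^sub>R h)) (U0 x0) = u1 (x1 + (1/l) *\<^sub>R h)"
          using elim by (simp add: U1_def min_absorb1)
        show ?case using max[of "x1 + (1/l) *\<^sub>R h" x0] unfolding c m m' .
      qed
    qed
  qed
  consider "x1 \<in> K1" "x0 \<in> K0" | "x1 \<in> K1" "x0 \<notin> K0" | "x1 \<notin> K1" "x0 \<in> K0" | "x1 \<notin> K1" "x0 \<notin> K0" by blast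
  then show False
  proof cases
    case 1
    then show False using \<phi>1[OF 1] Fp \<delta> by (simp add: F_def px U1_def U0_def)
  next
    case 2
    then show False using u0 by (intro ev0) (auto simp: U1_def intro: eventually_mono[OF off0])
  next
    case 3
    then show False using u1 by (intro ev1) (auto simp: U0_def intro: eventually_mono[OF off1])
  next
    case 4
    have c: "(u1 \<longlongrightarrow> u1 x1) (nhds x1)" "(u0 \<longlongrightarrow> u0 x0) (nhds x0)"
      using u1[OF 4(1)] u0[OF 4(2)] by (auto simp: isCont_def tendsto_nhds_iff)
    consider "u0 x0 < u1 x1" | "u1 x1 < u0 x0" | "u1 x1 = u0 x0" by linarith
    then show False
    proof cases
      case a: 1
      show False by (rule ev0[OF 4(2)])
         (use order_tendstoD(2)[OF c(2) a] 4 in \<open>auto simp: U1_def elim: eventually_mono\<close>)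
    next
      case a: 2
      show False by (rule ev1[OF 4(1)])
         (use order_tendstoD(2)[OF c(1) a] 4 in \<open>auto simp: U0_def elim: eventually_mono\<close>)
    next
      case a: 3
      obtain g1 Q1 where u1': "has_jet u1 x1 g1 Q1" "(\<Sum>b\<in>Basis. Q1 b) \<ge> 0" "g1 \<noteq> 0" using u1[OF 4(1)] by blast
      obtain g0 Q0 where u0': "has_jet u0 x0 g0 Q0" "(\<Sum>b\<in>Basis. Q0 b) \<ge> 0" "g0 \<noteq> 0" using u0[OF 4(2)] by blast
      obtain d1 where d1: "d1 > 0" "\<And>y. dist y x1 < d1 \<Longrightarrow> y \<notin> K1" using off1[OF 4(1)] by (auto simp: eventually_nhds_metric)
      obtain d0 where d0: "d0 > 0" "\<And>y. dist y x0 < d0 \<Longrightarrow> y \<notin> K0" using off0[OF 4(2)] by (auto simp: eventually_nhds_metric)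
      show False
      proof (rule no_max_of_min_equal_case[OF l u1' u0' gQ a])
        show "min d1 d0 > 0" using d1 d0 by simp
        fix y1 y0 assume "dist y1 x1 < min d1 d0" "dist y0 x0 < min d1 d0"
        then have "y1 \<notin> K1" "y0 \<notin> K0" using d1 d0 by auto
        then show "min (u1 y1) (u0 y0) - \<phi> (l *\<^sub>R y1 + (1-l) *\<^sub>R y0) \<le> u1 x1 - \<phi> ?x"
          using max[of y1 y0] 4 a by (simp add: U1_def U0_def)
      qed
    qed
  qed
qed

section \<open>Potentials of compactly supported measures\<close>

lemma has_jet_cmult:
  assumes "has_jet u z g Q"
  shows "has_jet (\<lambda>z. k * u z) z (k *\<^sub>R g) (\<lambda>v. k * Q v)"
  unfolding has_jet_def
proof (intro conjI allI)
  show "k * Q (c *\<^sub>R v) = c\<^sup>2 * (k * Q v)" for c v using assms by (simp add: has_jet_def)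
  fix v w
  obtain C r0 where r0: "r0 > 0" "\<And>r. \<bar>r\<bar> \<le> r0 \<Longrightarrow>
    \<bar>u (z + r *\<^sub>R v + r\<^sup>2 *\<^sub>R w) - (u z + r * (g \<bullet> v) + r\<^sup>2 * (Q v / 2 + g \<bullet> w))\<bar> \<le> C * \<bar>r\<bar> ^ 3"
    using assms unfolding has_jet_def by meson
  show "\<exists>C r0. 0 < r0 \<and> (\<forall>r. \<bar>r\<bar> \<le> r0 \<longrightarrow> \<bar>k * u (z + r *\<^sub>R v + r\<^sup>2 *\<^sub>R w) -
      (k * u z + r * (k *\<^sub>R g \<bullet> v) + r\<^sup>2 * (k * Q v / 2 + k *\<^sub>R g \<bullet> w))\<bar> \<le> C * \<bar>r\<bar> ^ 3)"
  proof (intro exI conjI allI impI)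
    fix r :: real assume r: "\<bar>r\<bar> \<le> r0"
    have "k * u (z + r *\<^sub>R v + r\<^sup>2 *\<^sub>R w) - (k * u z + r * (k *\<^sub>R g \<bullet> v) + r\<^sup>2 * (k * Q v / 2 + k *\<^sub>R g \<bullet> w))
      = k * (u (z + r *\<^sub>R v + r\<^sup>2 *\<^sub>R w) - (u z + r * (g \<bullet> v) + r\<^sup>2 * (Q v / 2 + g \<bullet> w)))"
      by (simp add: algebra_simps)
    then show "\<bar>k * u (z + r *\<^sub>R v + r\<^sup>2 *\<^sub>R w) - (k * u z + r * (k *\<^sub>R g \<bullet> v) + r\<^sup>2 * (k * Q v / 2 + k *\<^sub>R g \<bullet> w))\<bar>
      \<le> (\<bar>k\<bar> * C) * \<bar>r\<bar> ^ 3"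
      using mult_left_mono[OF r0(2)[OF r], of "\<bar>k\<bar>"] by (simp only: abs_mult mult.assoc)
  qed (use r0 in auto)
qed

lemma square_powr:
  fixes x s :: real
  assumes "x > 0"
  shows "x\<^sup>2 powr (- s) = x powr (- 2 * s)"
proof -
  have "x\<^sup>2 = x powr 2" using assms powr_realpow[of x 2] by simp
  then show ?thesis by (simp add: powr_powr)
qed

lemma dist_sq_bounds_off_compact:
  fixes K :: "'b::euclidean_space set"
  assumes K: "compact K" and e: "e > 0 \<or> e = 0 \<and> z \<notin> K"
  obtains m R where "m > 0" "\<And>y. y \<in> K \<Longrightarrow> m \<le> (z - y) \<bullet> (z - y) + e" "\<And>y. y \<in> K \<Longrightarrow> norm (z - y) \<le> R"
    "\<forall>\<^sub>F z' in nhds z. \<forall>y\<in>K. m / 2 \<le> (z' - y) \<bullet> (z' - y) + e"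
proof -
  obtain B where "\<And>y. y \<in> K \<Longrightarrow> norm y \<le> B" using compact_imp_bounded[OF K] by (auto simp: bounded_iff)
  then have R: "norm (z - y) \<le> norm z + B" if "y \<in> K" for y using that norm_triangle_ineq4[of z y] by fastforce
  show ?thesis
  proof (cases "e > 0")
    case True
    have "e / 2 \<le> x \<bullet> x + e" "e \<le> x \<bullet> x + e" for x :: 'b using True inner_ge_zero[of x] by linarith+
    then show ?thesis using that[of e "norm z + B"] True R by auto
  next
    case False
    then have z: "e = 0" "z \<notin> K" using e by auto
    have "open (-K)" using K by (simp add: compact_imp_closed open_Compl)
    then obtain d where d: "d > 0" "ball z d \<subseteq> -K" using z by (meson ComplI openE)
    have d1: "norm (z - y) \<ge> d" if "y \<in> K" for y using d that by (auto simp: subset_iff dist_norm) (meson linorder_not_less)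
    have "(d)\<^sup>2 \<le> (z - y) \<bullet> (z - y) + e" if "y \<in> K" for y
      unfolding power2_norm_eq_inner[symmetric] z using d1[OF that] d by (simp add: power_mono)
    \<comment> \<open>A move by less than d/4 leaves a distance of at least 3d/4, and 9/16 exceeds
      1/2.\<close>
    moreover have "\<forall>\<^sub>F z' in nhds z. dist z' z < d / 4" using d by (intro eventually_nhds_metric[THEN iffD2] exI[of _ "d/4"]) auto
    then have "\<forall>\<^sub>F z' in nhds z. \<forall>y\<in>K. d\<^sup>2 / 2 \<le> (z' - y) \<bullet> (z' - y) + e"
    proof eventually_elim
      case (elim z')
      show ?case
      proof
        fix y assume "y \<in> K"
        have "norm (z - y) \<le> norm (z' - y) + dist z' z" using norm_triangle_ineq[of "z' - y" "z - z'"] by (simp add: dist_norm norm_minus_commute)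
        then have "norm (z' - y) \<ge> 3/4 * d" using d1[OF \<open>y \<in> K\<close>] elim by simp
        then have "(norm (z' - y))\<^sup>2 \<ge> (3/4*d)\<^sup>2" using d by (intro power_mono) auto
        moreover have "(3/4*d)\<^sup>2 \<ge> d\<^sup>2/2" by (simp add: power2_eq_square)
        ultimately show "d\<^sup>2 / 2 \<le> (z' - y) \<bullet> (z' - y) + e" unfolding z power2_norm_eq_inner[symmetric] by linarith
      qed
    qed
    ultimately show ?thesis using that[of "d\<^sup>2" "norm z + B"] d R by auto
  qed
qed

text \<open>The dimension bound makes the kernel exponent positive. Asking only that almost every
  point lies in \<open>K\<close> lets one measure be used with several compact sets.\<close>

locale compact_potential =
  fixes K :: "'b::euclidean_space set" and \<mu> :: "'b measure"
  assumes dim: "DIM('b) \<ge> 3" and K: "compact K" and finite: "finite_measure \<mu>" and sets: "sets \<mu> = sets borel"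
    and supp: "AE y in \<mu>. y \<in> K" and pos: "measure \<mu> (space \<mu>) > 0"
begin

lemma s_pos: "kexp TYPE('b) > 0" using dim by (simp add: kexp_def)

lemma K_ne: "K \<noteq> {}"
proof
  assume "K = {}"
  then have "AE y in \<mu>. False" using supp by simp
  then have "emeasure \<mu> (space \<mu>) = 0" using ae_filter_eq_bot_iff trivial_limit_def by blast
  then show False using pos by (simp add: measure_def)
qed

text \<open>Two regimes in one statement: the singular potential off \<open>K\<close> and the
  regularized one everywhere. The strict sign of the Laplacian comes from the positive mass.\<close>

lemma pot_regular:
  assumes e: "e > 0 \<or> e = 0 \<and> z \<notin> K"
  shows "has_jet (pot e \<mu>) z (pot_grad e \<mu> z) (pot_hess e \<mu> z)"
    "e = 0 \<Longrightarrow> (\<Sum>b\<in>Basis. pot_hess e \<mu> z b) = 0"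
    "e > 0 \<Longrightarrow> (\<Sum>b\<in>Basis. pot_hess e \<mu> z b) < 0"
    "isCont (pot e \<mu>) z" "integrable \<mu> (\<lambda>y. kern e (z - y))"
    "integrable \<mu> (\<lambda>y. kern_D1 e (z - y) *\<^sub>R (z - y))"
proof -
  interpret finite_measure \<mu> by (rule finite)
  note [measurable_cong] = sets
  obtain m R where m: "m > 0" and 1: "\<And>y. y \<in> K \<Longrightarrow> m \<le> (z - y) \<bullet> (z - y) + e" and 2: "\<And>y. y \<in> K \<Longrightarrow> norm (z - y) \<le> R"
    and 3: "\<forall>\<^sub>F z' in nhds z. \<forall>y\<in>K. m / 2 \<le> (z' - y) \<bullet> (z' - y) + e"
    using dist_sq_bounds_off_compact[OF K e] by blast
  have a1: "AE y in \<mu>. m \<le> (z - y) \<bullet> (z - y) + e" using supp by eventually_elim (rule 1)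
  have a2: "AE y in \<mu>. norm (z - y) \<le> R" using supp by eventually_elim (rule 2)
  have a3: "\<forall>\<^sub>F z' in nhds z. AE y in \<mu>. m / 2 \<le> (z' - y) \<bullet> (z' - y) + e"
    using 3 by eventually_elim (use supp in \<open>auto elim: eventually_mono\<close>)
  show "has_jet (pot e \<mu>) z (pot_grad e \<mu> z) (pot_hess e \<mu> z)"
    by (rule pot_has_jet[OF s_pos m finite sets a1 a2 a3])
  show "integrable \<mu> (\<lambda>y. kern e (z - y))" "integrable \<mu> (\<lambda>y. kern_D1 e (z - y) *\<^sub>R (z - y))"
    by (rule pot_integrable[OF s_pos m finite sets a1 a2])+
  have tr: "(\<Sum>b\<in>Basis. pot_hess e \<mu> z b) = - 2 * DIM('b) * kexp TYPE('b) * e * (\<integral>y. ((z - y) \<bullet> (z - y) + e) powr (- kexp TYPE('b) - 2) \<partial>\<mu>)"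
    by (rule pot_hess_trace[OF s_pos m finite sets a1 a2])
  show "e = 0 \<Longrightarrow> (\<Sum>b\<in>Basis. pot_hess e \<mu> z b) = 0" using tr by simp
  show "(\<Sum>b\<in>Basis. pot_hess e \<mu> z b) < 0" if "e > 0"
  proof -
    have "integrable \<mu> (\<lambda>y. ((z - y) \<bullet> (z - y) + e) powr (- kexp TYPE('b) - 2))"
      by (rule integrable_const_bound[where B="m powr (- kexp TYPE('b) - 2)"])
        (use a1 m s_pos in \<open>auto elim!: eventually_mono intro!: powr_mono2'\<close>)
    moreover have "AE y in \<mu>. 0 < ((z - y) \<bullet> (z - y) + e) powr (- kexp TYPE('b) - 2)"
      using a1 by eventually_elim (use m in auto)
    moreover have "emeasure \<mu> (space \<mu>) \<noteq> 0" using pos by (auto simp: measure_def)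
    ultimately have "(\<integral>y. 0 \<partial>\<mu>) < (\<integral>y. ((z - y) \<bullet> (z - y) + e) powr (- kexp TYPE('b) - 2) \<partial>\<mu>)"
      by (intro integral_less_AE_space) auto
    then show ?thesis unfolding tr using that s_pos by (simp add: mult_pos_pos mult_neg_pos)
  qed
  show "isCont (pot e \<mu>) z"
    unfolding isCont_def tendsto_at_iff_sequentially comp_def
  proof (intro allI impI)
    fix X assume X: "X \<longlonglongrightarrow> z"
    then obtain N where N: "\<And>n. n \<ge> N \<Longrightarrow> AE y in \<mu>. m / 2 \<le> (X n - y) \<bullet> (X n - y) + e"
      using a3 by (auto simp: filterlim_iff eventually_sequentially)
    have "(\<lambda>n. \<integral>y. kern e (X (n + N) - y) \<partial>\<mu>) \<longlonglongrightarrow> (\<integral>y. kern e (z - y) \<partial>\<mu>)"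
    proof (rule integral_dominated_convergence[where w="\<lambda>_. (m/2) powr (- kexp TYPE('b))"])
      show "AE y in \<mu>. (\<lambda>n. kern e (X (n + N) - y)) \<longlonglongrightarrow> kern e (z - y)"
        using a1
      proof eventually_elim
        case (elim y)
        have "(\<lambda>n. X (n + N)) \<longlonglongrightarrow> z" using X by (rule LIMSEQ_ignore_initial_segment)
        then show ?case unfolding kern_def using elim m by (intro tendsto_intros) auto
      qed
      show "AE y in \<mu>. norm (kern e (X (n + N) - y)) \<le> (m/2) powr (- kexp TYPE('b))" for n
        using N[of "n+N"] by (auto elim!: eventually_mono simp: abs_of_pos kern_deriv_bounds[OF s_pos half_gt_zero[OF m]])
    qed auto
    then have "(\<lambda>n. \<integral>y. kern e (X n - y) \<partial>\<mu>) \<longlonglongrightarrow> (\<integral>y. kern e (z - y) \<partial>\<mu>)" by (rule LIMSEQ_offset)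
    then show "(\<lambda>n. pot e \<mu> (X n)) \<longlonglongrightarrow> pot e \<mu> z" unfolding pot_def .
  qed
qed

lemma pot_nonneg: "pot e \<mu> z \<ge> 0"
  unfolding pot_def kern_def by (intro integral_nonneg_AE) auto

text \<open>\<open>pot_lower\<close> is the matching bound for \<open>e = 0\<close>: far away the
  potential is the mass times |z|^(-(n-2)), up to a shift of |z| by \<open>R\<close>. This is how
  masses are read off at infinity.\<close>

lemma pot_upper:
  assumes R: "\<And>y. y \<in> K \<Longrightarrow> norm y \<le> R" and z: "norm z > R" and e: "e \<ge> 0"
  shows "pot e \<mu> z \<le> measure \<mu> (space \<mu>) * (norm z - R) powr (- 2 * kexp TYPE('b))"
proof -
  interpret finite_measure \<mu> by (rule finite)
  have zK: "z \<notin> K" using R z by force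
  have "pot e \<mu> z \<le> (\<integral>y. (norm z - R) powr (- 2 * kexp TYPE('b)) \<partial>\<mu>)"
    unfolding pot_def
  proof (rule integral_mono_AE)
    show "integrable \<mu> (\<lambda>y. kern e (z - y))" using pot_regular(5)[of e z] e zK by linarith
    show "AE y in \<mu>. kern e (z - y) \<le> (norm z - R) powr (- 2 * kexp TYPE('b))"
      using supp
    proof eventually_elim
      case (elim y)
      have "norm z - R \<le> norm (z - y)" using R[OF elim] norm_triangle_ineq2[of z y] by linarith
      then have "(norm z - R)\<^sup>2 \<le> (z - y) \<bullet> (z - y) + e" unfolding power2_norm_eq_inner[symmetric]
        using z e by (intro add_increasing2 power_mono) auto
      then have "kern e (z - y) \<le> (norm z - R)\<^sup>2 powr (- kexp TYPE('b))"
        unfolding kern_def using z s_pos by (intro powr_mono2') auto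
      also have "\<dots> = (norm z - R) powr (- 2 * kexp TYPE('b))" using z
        by (subst square_powr) auto
      finally show ?case .
    qed
  qed auto
  then show ?thesis by simp
qed

lemma pot_lower:
  assumes R: "\<And>y. y \<in> K \<Longrightarrow> norm y \<le> R" and z: "z \<notin> K"
  shows "pot 0 \<mu> z \<ge> measure \<mu> (space \<mu>) * (norm z + R) powr (- 2 * kexp TYPE('b))"
proof -
  interpret finite_measure \<mu> by (rule finite)
  have "(\<integral>y. (norm z + R) powr (- 2 * kexp TYPE('b)) \<partial>\<mu>) \<le> pot 0 \<mu> z"
    unfolding pot_def
  proof (rule integral_mono_AE)
    show "integrable \<mu> (\<lambda>y. kern 0 (z - y))" using pot_regular(5)[of 0 z] z by auto
    show "AE y in \<mu>. (norm z + R) powr (- 2 * kexp TYPE('b)) \<le> kern 0 (z - y)"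
      using supp
    proof eventually_elim
      case (elim y)
      have n: "norm (z - y) \<le> norm z + R" using R[OF elim] norm_triangle_ineq4[of z y] by linarith
      moreover have p: "norm (z - y) > 0" using elim z by auto
      ultimately have "(norm z + R)\<^sup>2 \<ge> (z - y) \<bullet> (z - y) + 0" unfolding power2_norm_eq_inner[symmetric]
        by (simp add: power_mono)
      then have "kern 0 (z - y) \<ge> (norm z + R)\<^sup>2 powr (- kexp TYPE('b))"
        unfolding kern_def using p s_pos by (intro powr_mono2') auto
      also have "(norm z + R)\<^sup>2 powr (- kexp TYPE('b)) = (norm z + R) powr (- 2 * kexp TYPE('b))" using n p
        using order.strict_trans2[OF p n] by (subst square_powr) auto
      finally show ?case by simp
    qed
  qed auto
  then show ?thesis by simp
qed

lemma pot_tendsto_0: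
  assumes e: "e \<ge> 0"
  shows "(pot e \<mu> \<longlongrightarrow> 0) at_infinity"
proof -
  obtain R where R: "\<And>y. y \<in> K \<Longrightarrow> norm y \<le> R" using compact_imp_bounded[OF K] by (auto simp: bounded_iff)
  have f: "filterlim (\<lambda>z::'b. norm z - R) at_top at_infinity"
    using filterlim_tendsto_add_at_top[OF tendsto_const[of "-R"] filterlim_norm_at_top] by (simp add: add.commute)
  have lim: "((\<lambda>z::'b. measure \<mu> (space \<mu>) * (norm z - R) powr (- 2 * kexp TYPE('b))) \<longlongrightarrow> 0) at_infinity"
    by (intro tendsto_mult_right_zero tendsto_neg_powr f) (use s_pos in auto)
  have up: "\<forall>\<^sub>F z in at_infinity. pot e \<mu> z \<le> measure \<mu> (space \<mu>) * (norm z - R) powr (- 2 * kexp TYPE('b))"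
    unfolding eventually_at_infinity
    by (intro exI[of _ "R + 1"] allI impI pot_upper[OF R _ e]) auto
  show ?thesis
    by (rule tendsto_sandwich[OF always_eventually up tendsto_const lim]) (simp add: pot_nonneg)
qed

text \<open>A hyperplane separates \<open>z\<close> from \<open>K\<close>, and every source pulls
  \<open>z\<close> strictly towards the side of \<open>K\<close>, so the contributions cannot
  cancel.\<close>

lemma pot_grad_nonzero:
  assumes "convex K" and z: "z \<notin> K"
  shows "pot_grad 0 \<mu> z \<noteq> 0"
proof
  assume 0: "pot_grad 0 \<mu> z = 0"
  interpret finite_measure \<mu> by (rule finite)
  note [measurable_cong] = sets
  obtain a b where ab: "a \<bullet> z < b" "\<And>y. y \<in> K \<Longrightarrow> a \<bullet> y > b"
    using separating_hyperplane_closed_point[OF assms(1) compact_imp_closed[OF K] z] by auto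
  have i: "integrable \<mu> (\<lambda>y. (2 * kern_D1 0 (z - y)) *\<^sub>R (z - y))"
    using integrable_scaleR_right[OF pot_regular(6)[of 0 z], of 2] z by simp
  have "pot_grad 0 \<mu> z \<bullet> a = (\<integral>y. ((2 * kern_D1 0 (z - y)) *\<^sub>R (z - y)) \<bullet> a \<partial>\<mu>)"
    unfolding pot_grad_def using i by (subst integral_inner_left) auto
  moreover have "(\<integral>y. 0 \<partial>\<mu>) < (\<integral>y. ((2 * kern_D1 0 (z - y)) *\<^sub>R (z - y)) \<bullet> a \<partial>\<mu>)"
  proof (rule integral_less_AE_space)
    show "integrable \<mu> (\<lambda>y. ((2 * kern_D1 0 (z - y)) *\<^sub>R (z - y)) \<bullet> a)" using i by (intro integrable_inner_left) auto
    show "emeasure \<mu> (space \<mu>) \<noteq> 0" using pos by (auto simp: measure_def)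
    show "AE y in \<mu>. 0 < ((2 * kern_D1 0 (z - y)) *\<^sub>R (z - y)) \<bullet> a"
      using supp
    proof eventually_elim
      case (elim y)
      have "z \<noteq> y" using elim z by auto
      then have "kern_D1 0 (z - y) < 0" using kern_deriv_bounds(3)[OF s_pos, of "(z-y) \<bullet> (z-y)" "z - y" 0] by simp
      moreover have "(z - y) \<bullet> a < 0" using ab(1) ab(2)[OF elim] by (simp add: inner_commute[of _ a] inner_diff_right)
      ultimately show ?case by (simp add: mult_neg_neg)
    qed
  qed auto
  ultimately show False using 0 by simp
qed

text \<open>To obtain a strict sign, a small multiple of a strictly superharmonic function is
  subtracted: the potential \<open>?w\<close>, with regularization 1, of a unit point mass at
  0.\<close>

lemma pot_max_principle:
  assumes r: "r > 0" and M: "M \<ge> 0"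
    and near: "\<And>z. z \<notin> K \<Longrightarrow> infdist z K < r \<Longrightarrow> pot 0 \<mu> z \<le> M"
    and z0: "z0 \<notin> K"
  shows "pot 0 \<mu> z0 \<le> M"
proof (rule ccontr)
  let ?u = "pot 0 \<mu>"
  assume "\<not> ?thesis"
  then have uM: "?u z0 > M" by simp
  interpret w: compact_potential "{0::'b}" "return borel 0"
  proof (rule compact_potential.intro)
    show "finite_measure (return borel (0::'b))" by (intro prob_space.finite_measure prob_space_return) simp
    show "AE y in return borel (0::'b). y \<in> {0}" by (subst AE_return) auto
    show "0 < measure (return borel (0::'b)) (space (return borel 0))" by (simp add: measure_return)
  qed (auto simp: dim)
  let ?w = "pot 1 (return borel (0::'b))"
  \<comment> \<open>This costs at most half of the excess over \<open>M\<close> at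
    \<open>z0\<close>. As \<open>?w\<close> is nonnegative, the potential itself exceeds
    \<open>M\<close> at a maximum of \<open>F\<close>.\<close>
  define \<tau> where "\<tau> = (?u z0 - M) / (2 * (?w z0 + 1))"
  have w0: "?w z \<ge> 0" for z by (rule w.pot_nonneg)
  have \<tau>: "\<tau> > 0" using uM w0[of z0] by (auto simp: \<tau>_def intro!: divide_pos_pos)
  define F where "F = (\<lambda>z. ?u z - \<tau> * ?w z)"
  have Fu: "F z \<le> ?u z" for z using w0[of z] \<tau> by (simp add: F_def)
  have "\<tau> * ?w z0 \<le> \<tau> * (?w z0 + 1)" using \<tau> by simp
  also have "\<dots> = (?u z0 - M) / 2" using w0[of z0] by (simp add: \<tau>_def field_simps)
  finally have F0: "F z0 > M" using uM by (simp add: F_def)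
  obtain R where R: "\<And>z. norm z \<ge> R \<Longrightarrow> ?u z < F z0"
    using order_tendstoD(2)[OF pot_tendsto_0[of 0], of "F z0"] F0 M by (auto simp: eventually_at_infinity)
  \<comment> \<open>The gap between r/2 and r matters: where the potential exceeds \<open>M\<close>,
    the distance to \<open>K\<close> is at least \<open>r\<close>, so a maximum over this set lies
    in its interior.\<close>
  let ?S = "cball 0 R \<inter> {z. infdist z K \<ge> r/2}"
  have offK: "z \<notin> K" if "infdist z K \<ge> r/2" for z using that r by auto
  have cl: "closed {z. infdist z K \<ge> r/2}" by (intro closed_Collect_le continuous_intros)
  have cont: "continuous_on ?S F"
    unfolding F_def using pot_regular(4)[of 0] w.pot_regular(4)[of 1] offK
    by (intro continuous_intros continuous_at_imp_continuous_on) auto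
  have big: "infdist z K \<ge> r \<and> norm z < R" if "?u z \<ge> F z0" "z \<notin> K" for z
    using near[OF that(2)] that(1) F0 R[of z] by (meson leD le_less_trans not_le order.strict_trans2)
  have z0S: "z0 \<in> ?S" using big[OF Fu z0] r by auto
  obtain x where x: "x \<in> ?S" "\<And>y. y \<in> ?S \<Longrightarrow> F y \<le> F x"
    using continuous_attains_sup[OF compact_Int_closed[OF compact_cball cl] _ cont] z0S by blast
  have "?u x \<ge> F z0" using x(2)[OF z0S] Fu[of x] by linarith
  then have xb: "infdist x K \<ge> r" "norm x < R" using big x offK by auto
  have "open {y. norm y < R \<and> infdist y K > r/2}"
    by (intro open_Collect_conj open_Collect_less continuous_intros)
  then have ev: "\<forall>\<^sub>F y in nhds x. y \<in> {y. norm y < R \<and> infdist y K > r/2}"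
    using xb r by (intro eventually_nhds_in_open) auto
  have sh: "((\<lambda>h. x + h) \<longlongrightarrow> x) (nhds 0)"
    using tendsto_add[OF tendsto_const[of x] filterlim_ident[of "nhds (0::'b)"]] by simp
  have xK: "x \<notin> K" using offK x by auto
  show False
  proof (rule no_local_max_subharmonic_minus_strict_superharmonic)
    show "has_jet ?u x (pot_grad 0 \<mu> x) (pot_hess 0 \<mu> x)" "(\<Sum>b\<in>Basis. pot_hess 0 \<mu> x b) \<ge> 0"
      using pot_regular(1,2)[of 0 x] xK by auto
    show "has_jet (\<lambda>z. \<tau> * ?w z) x (\<tau> *\<^sub>R pot_grad 1 (return borel 0) x) (\<lambda>v. \<tau> * pot_hess 1 (return borel 0) x v)"
      by (intro has_jet_cmult w.pot_regular) auto
    show "(\<Sum>b\<in>Basis. \<tau> * pot_hess 1 (return borel 0) x b) < 0"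
      using w.pot_regular(3)[of 1 x] \<tau> by (simp add: sum_distrib_left[symmetric] mult_pos_neg)
    have "\<forall>\<^sub>F h in nhds 0. x + h \<in> {y. norm y < R \<and> infdist y K > r/2}"
      using sh ev by (auto simp: filterlim_iff)
    then show "\<forall>\<^sub>F h in nhds 0. ?u (x + 1 *\<^sub>R h) - \<tau> * ?w (x + h) \<le> ?u x - \<tau> * ?w x"
    proof eventually_elim
      case (elim h)
      then have "x + h \<in> ?S" by auto
      from x(2)[OF this] show ?case by (simp add: F_def)
    qed
  qed
qed

end

text \<open>A quotient of mass by level is the mass left after scaling the potential to level 1; it
  plays the role of a capacity.\<close>

lemma mass_comparison:
  fixes K1 K0 :: "'b::euclidean_space set"
  assumes l: "0 < l" "l < 1" and p1: "compact_potential K1 \<mu>1" "convex K1" and p0: "compact_potential K0 \<mu>0" "convex K0"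
    and p: "compact_potential K \<nu>" and e: "e > 0" and V: "V1 > 0" "V0 > 0" "V > 0"
    and le1: "\<And>z. z \<notin> K1 \<Longrightarrow> pot 0 \<mu>1 z \<le> V1" and le0: "\<And>z. z \<notin> K0 \<Longrightarrow> pot 0 \<mu>0 z \<le> V0"
    and ge: "\<And>x1 x0. x1 \<in> K1 \<Longrightarrow> x0 \<in> K0 \<Longrightarrow> pot e \<nu> (l *\<^sub>R x1 + (1-l) *\<^sub>R x0) \<ge> V"
  shows "l * (measure \<mu>1 (space \<mu>1) / V1) powr (1 / (real DIM('b) - 2))
     + (1-l) * (measure \<mu>0 (space \<mu>0) / V0) powr (1 / (real DIM('b) - 2))
     \<le> (measure \<nu> (space \<nu>) / V) powr (1 / (real DIM('b) - 2))"
proof -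
  interpret p1: compact_potential K1 \<mu>1 by fact
  interpret p0: compact_potential K0 \<mu>0 by fact
  interpret p: compact_potential K \<nu> by fact
  define q where "q = real DIM('b) - 2"
  have q: "q > 0" "2 * kexp TYPE('b) = q" using p.dim by (auto simp: q_def kexp_def)
  define m1 where "m1 = measure \<mu>1 (space \<mu>1) / V1"
  define m0 where "m0 = measure \<mu>0 (space \<mu>0) / V0"
  define m where "m = measure \<nu> (space \<nu>) / V"
  have mpos: "m1 > 0" "m0 > 0" "m > 0" using p1.pos p0.pos p.pos V by (auto simp: m1_def m0_def m_def)
  have comp: "min ((1/V1) * pot 0 \<mu>1 a1) ((1/V0) * pot 0 \<mu>0 a0) \<le> (1/V) * pot e \<nu> (l *\<^sub>R a1 + (1-l) *\<^sub>R a0)"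
    if a: "a1 \<notin> K1" "a0 \<notin> K0" for a1 a0
  proof (rule minimum_comparison[OF l p1.K p0.K _ _ _ _ _ _ _ _ a])
    fix z assume z: "z \<notin> K1"
    show "1/V1 * pot 0 \<mu>1 z \<le> 1 \<and> isCont (\<lambda>z. 1/V1 * pot 0 \<mu>1 z) z \<and>
        (\<exists>g Q. has_jet (\<lambda>z. 1/V1 * pot 0 \<mu>1 z) z g Q \<and> 0 \<le> (\<Sum>b\<in>Basis. Q b) \<and> g \<noteq> 0)"
    proof (intro conjI exI)
      show "has_jet (\<lambda>z. 1/V1 * pot 0 \<mu>1 z) z ((1/V1) *\<^sub>R pot_grad 0 \<mu>1 z) (\<lambda>v. 1/V1 * pot_hess 0 \<mu>1 z v)"
        using z by (intro has_jet_cmult p1.pot_regular) auto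
      show "isCont (\<lambda>z. 1/V1 * pot 0 \<mu>1 z) z" using p1.pot_regular(4)[of 0 z] z by (intro continuous_intros) auto
    qed (use le1[OF z] V p1.pot_grad_nonzero[OF p1(2) z] p1.pot_regular(2)[of 0 z] z in \<open>auto simp: sum_divide_distrib[symmetric]\<close>)
  next
    fix z assume z: "z \<notin> K0"
    show "1/V0 * pot 0 \<mu>0 z \<le> 1 \<and> isCont (\<lambda>z. 1/V0 * pot 0 \<mu>0 z) z \<and>
        (\<exists>g Q. has_jet (\<lambda>z. 1/V0 * pot 0 \<mu>0 z) z g Q \<and> 0 \<le> (\<Sum>b\<in>Basis. Q b) \<and> g \<noteq> 0)"
    proof (intro conjI exI)
      show "has_jet (\<lambda>z. 1/V0 * pot 0 \<mu>0 z) z ((1/V0) *\<^sub>R pot_grad 0 \<mu>0 z) (\<lambda>v. 1/V0 * pot_hess 0 \<mu>0 z v)"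
        using z by (intro has_jet_cmult p0.pot_regular) auto
      show "isCont (\<lambda>z. 1/V0 * pot 0 \<mu>0 z) z" using p0.pot_regular(4)[of 0 z] z by (intro continuous_intros) auto
    qed (use le0[OF z] V p0.pot_grad_nonzero[OF p0(2) z] p0.pot_regular(2)[of 0 z] z in \<open>auto simp: sum_divide_distrib[symmetric]\<close>)
  next
    show "((\<lambda>z. 1/V1 * pot 0 \<mu>1 z) \<longlongrightarrow> 0) at_infinity" "((\<lambda>z. 1/V0 * pot 0 \<mu>0 z) \<longlongrightarrow> 0) at_infinity"
      by (intro tendsto_mult_right_zero p1.pot_tendsto_0 p0.pot_tendsto_0; simp)+
    show "continuous_on UNIV (\<lambda>z. 1/V * pot e \<nu> z)"
      using p.pot_regular(4)[of e] e by (intro continuous_intros continuous_at_imp_continuous_on) auto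
    show "0 \<le> 1/V * pot e \<nu> z" for z using p.pot_nonneg[of e z] V by simp
    show "\<exists>g Q. has_jet (\<lambda>z. 1/V * pot e \<nu> z) z g Q \<and> (\<Sum>b\<in>Basis. Q b) < 0" for z
    proof (intro conjI exI)
      show "has_jet (\<lambda>z. 1/V * pot e \<nu> z) z ((1/V) *\<^sub>R pot_grad e \<nu> z) (\<lambda>v. 1/V * pot_hess e \<nu> z v)"
        using e by (intro has_jet_cmult p.pot_regular) auto
    qed (use V p.pot_regular(3)[of e z] e in \<open>auto simp: sum_divide_distrib[symmetric] divide_neg_pos\<close>)
    show "1 \<le> 1/V * pot e \<nu> (l *\<^sub>R x1 + (1 - l) *\<^sub>R x0)" if "x1 \<in> K1" "x0 \<in> K0" for x1 x0
      using ge[OF that] V by simp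
  qed
  have "bounded (K1 \<union> K0 \<union> K)" using p1.K p0.K p.K by (simp add: compact_imp_bounded)
  then obtain R where R: "R > 0" "\<And>y. y \<in> K1 \<union> K0 \<union> K \<Longrightarrow> norm y \<le> R" unfolding bounded_pos by blast
  define A where "A = l * m1 powr (1/q) + (1-l) * m0 powr (1/q)"
  have A: "A > 0" using l mpos by (auto simp: A_def intro!: add_pos_pos mult_pos_pos)
  obtain b :: 'b where b: "b \<in> Basis" using SOME_Basis by blast
  have pw: "1/W * (M * (k powr (1/q) * T) powr (-q)) = T powr (-q)"
    if "k > 0" "W > 0" "k = M / W" "T > 0" for k W M T :: real
  proof -
    have "(k powr (1/q) * T) powr (-q) = T powr (-q) / k"
      using that(1,4) q by (simp add: powr_mult powr_powr powr_minus_divide)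
    moreover have "M = k * W" using that by simp
    ultimately show ?thesis using that(1,2) by simp
  qed
  have ev: "\<forall>\<^sub>F T in at_top. A - 2 * R / T \<le> m powr (1/q)"
  proof -
    have "\<forall>\<^sub>F T in at_top. T > 3 * R / m1 powr (1/q) \<and> T > 3 * R / m0 powr (1/q) \<and> T > 3 * R / A \<and> T > 0"
      by (intro eventually_conj eventually_gt_at_top)
    then show ?thesis
    proof eventually_elim
      case (elim T)
      \<comment> \<open>At the radii \<open>r1\<close> and \<open>r0\<close> the lower bounds for
        both scaled potentials equal the same level T^(-q). Their combination is
        \<open>T * A - R\<close>, and the upper bound there yields the claim. The factor 3 in the
        thresholds keeps all three points off the ball of radius \<open>R\<close>.\<close>
      define r1 where "r1 = m1 powr (1/q) * T - R"
      define r0 where "r0 = m0 powr (1/q) * T - R"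
      have r1: "r1 > R" and r0: "r0 > R" and TA: "T * A > 3 * R" using elim mpos A R by (auto simp: r1_def r0_def field_simps)
      have n: "norm (r1 *\<^sub>R b) = r1" "norm (r0 *\<^sub>R b) = r0" using b r1 r0 R by auto
      have off: "r1 *\<^sub>R b \<notin> K1" "r0 *\<^sub>R b \<notin> K0" using R(2) n r1 r0 by force+
      have "1/V1 * pot 0 \<mu>1 (r1 *\<^sub>R b) \<ge> 1/V1 * (measure \<mu>1 (space \<mu>1) * (r1 + R) powr (-q))"
        using p1.pot_lower[of R "r1 *\<^sub>R b"] off R V n q(2) by (intro mult_left_mono) auto
      also have "1/V1 * (measure \<mu>1 (space \<mu>1) * (r1 + R) powr (-q)) = T powr (-q)"
        using pw[OF mpos(1) V(1) m1_def, of T] elim by (simp add: r1_def)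
      finally have u1: "1/V1 * pot 0 \<mu>1 (r1 *\<^sub>R b) \<ge> T powr (-q)" .
      have "1/V0 * pot 0 \<mu>0 (r0 *\<^sub>R b) \<ge> 1/V0 * (measure \<mu>0 (space \<mu>0) * (r0 + R) powr (-q))"
        using p0.pot_lower[of R "r0 *\<^sub>R b"] off R V n q(2) by (intro mult_left_mono) auto
      also have "1/V0 * (measure \<mu>0 (space \<mu>0) * (r0 + R) powr (-q)) = T powr (-q)"
        using pw[OF mpos(2) V(2) m0_def, of T] elim by (simp add: r0_def)
      finally have u0: "1/V0 * pot 0 \<mu>0 (r0 *\<^sub>R b) \<ge> T powr (-q)" .
      have x: "l *\<^sub>R (r1 *\<^sub>R b) + (1-l) *\<^sub>R (r0 *\<^sub>R b) = (T * A - R) *\<^sub>R b"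
        by (simp add: r1_def r0_def A_def algebra_simps)
      have nx: "norm ((T * A - R) *\<^sub>R b) = T * A - R" using b TA R by simp
      have "T powr (-q) \<le> 1/V * pot e \<nu> ((T * A - R) *\<^sub>R b)"
        using comp[OF off] u1 u0 unfolding x by linarith
      also have "\<dots> \<le> 1/V * (measure \<nu> (space \<nu>) * (T * A - R - R) powr (-q))"
        using p.pot_upper[of R "(T * A - R) *\<^sub>R b" e] R TA V e q(2) unfolding nx by (intro mult_left_mono) auto
      also have "\<dots> = m * (T * A - 2 * R) powr (-q)" by (simp add: m_def)
      finally have "T powr (-q) \<le> m * (T * A - 2 * R) powr (-q)" .
      then have "(T * A - 2 * R) powr q \<le> m * T powr q"
        using elim TA R by (simp add: powr_minus field_simps)
      then have "((T * A - 2 * R) powr q) powr (1/q) \<le> (m * T powr q) powr (1/q)" using q by (intro powr_mono2) auto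
      then have "T * A - 2 * R \<le> m powr (1/q) * T"
        using elim TA R q mpos by (simp add: powr_powr powr_mult)
      then show ?case using elim by (simp add: field_simps)
    qed
  qed
  have "((\<lambda>T. A - 2 * R / T) \<longlongrightarrow> A - 0) at_top"
    by (intro tendsto_intros tendsto_divide_0[OF tendsto_const] filterlim_at_top_imp_at_infinity filterlim_ident)
  then have "A - 0 \<le> m powr (1/q)" by (rule tendsto_upperbound[OF _ ev]) simp
  then show ?thesis by (simp add: A_def m_def m1_def m0_def q_def)
qed

section \<open>Riesz energies\<close>

lemma measurable_riesz_kernel [measurable]:
  "(\<lambda>p. riesz_kernel \<alpha> (fst p) (snd p)) \<in> borel_measurable (borel \<Otimes>\<^sub>M (borel :: 'a::euclidean_space measure))"
  unfolding riesz_kernel_def by measurable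

lemma measurable_riesz_kernel' [measurable (raw)]:
  assumes "f \<in> borel_measurable M" "g \<in> borel_measurable M"
  shows "(\<lambda>x. riesz_kernel \<alpha> (f x) (g x)) \<in> borel_measurable M"
  using measurable_compose[OF measurable_Pair[OF assms] measurable_riesz_kernel] by simp

lemma riesz_kernel_sym: "riesz_kernel \<alpha> x y = riesz_kernel \<alpha> y x"
  by (simp add: riesz_kernel_def dist_commute)

text \<open>The polarized energy; \<open>riesz_energy\<close> minimizes it on the diagonal.\<close>

definition mutual :: "'a::euclidean_space measure \<Rightarrow> 'a measure \<Rightarrow> ennreal" where
  "mutual \<mu> \<sigma> = (\<integral>\<^sup>+x. (\<integral>\<^sup>+y. riesz_kernel 1 x y \<partial>\<sigma>) \<partial>\<mu>)"

lemma riesz_admissible_prob: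
  assumes "riesz_admissible K \<mu>"
  shows "prob_space \<mu>" "sets \<mu> = sets borel" "space \<mu> = UNIV"
proof -
  show s: "sets \<mu> = sets borel" and sp: "space \<mu> = UNIV"
    using assms sets_eq_imp_space_eq[of \<mu> borel] by (auto simp: riesz_admissible_def)
  \<comment> \<open>A non-measurable set has \<open>emeasure\<close> 0, so mass 1 makes
    \<open>K\<close> measurable.\<close>
  have K: "K \<in> sets \<mu>" using assms emeasure_notin_sets[of K \<mu>] by (auto simp: riesz_admissible_def)
  have "emeasure \<mu> (K \<union> (UNIV - K)) = 1"
    using assms K s by (subst plus_emeasure[symmetric]) (auto simp: riesz_admissible_def)
  then show "prob_space \<mu>" by (intro prob_spaceI) (simp add: sp)
qed

lemma riesz_admissible_AE:
  assumes "riesz_admissible K \<mu>"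
  shows "AE x in \<mu>. x \<in> K"
proof -
  have K: "K \<in> sets \<mu>" using assms emeasure_notin_sets[of K \<mu>] by (auto simp: riesz_admissible_def)
  show ?thesis
    using assms K riesz_admissible_prob(3)[OF assms] sets.compl_sets[OF K]
    by (intro AE_I[of _ _ "UNIV - K"]) (auto simp: riesz_admissible_def)
qed

lemma riesz_admissibleI:
  assumes "prob_space \<mu>" "sets \<mu> = sets borel" "AE x in \<mu>. x \<in> K" "K \<in> sets borel"
  shows "riesz_admissible K \<mu>"
proof -
  interpret prob_space \<mu> by fact
  have sp: "space \<mu> = UNIV" using sets_eq_imp_space_eq[OF assms(2)] by simp
  have "emeasure \<mu> K = 1" using assms by (intro emeasure_eq_1_AE) auto
  moreover have "emeasure \<mu> (UNIV - K) = 0"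
    using emeasure_eq_0_AE[of "\<lambda>x. x \<notin> K" \<mu>] assms(3) sp by (simp add: set_diff_eq)
  ultimately show ?thesis using assms by (simp add: riesz_admissible_def)
qed

lemma mutual_commute:
  assumes "riesz_admissible K \<mu>" "riesz_admissible K' \<sigma>"
  shows "mutual \<mu> \<sigma> = mutual \<sigma> \<mu>"
proof -
  interpret m: prob_space \<mu> by (rule riesz_admissible_prob[OF assms(1)])
  interpret s: prob_space \<sigma> by (rule riesz_admissible_prob[OF assms(2)])
  interpret pair_sigma_finite \<sigma> \<mu> ..
  note [measurable_cong] = riesz_admissible_prob(2)[OF assms(1)] riesz_admissible_prob(2)[OF assms(2)]
  have "mutual \<mu> \<sigma> = (\<integral>\<^sup>+x. (\<integral>\<^sup>+y. riesz_kernel 1 y x \<partial>\<sigma>) \<partial>\<mu>)"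
    unfolding mutual_def by (simp add: riesz_kernel_sym)
  also have "\<dots> = mutual \<sigma> \<mu>"
    unfolding mutual_def by (rule Fubini') measurable
  finally show ?thesis .
qed

lemma riesz_energy_le: "riesz_admissible K \<mu> \<Longrightarrow> riesz_energy 1 K \<le> mutual \<mu> \<mu>"
  unfolding riesz_energy_def mutual_def by (intro INF_lower) auto

text \<open>The mixture is a two-stage experiment: a Bernoulli variable with parameter
  \<open>t\<close> selects \<sigma> or \<mu>. The integral formula is then that of the monadic
  bind.\<close>

lemma convex_combination_measure:
  fixes \<mu> \<sigma> :: "'a::euclidean_space measure" and t :: real
  assumes m: "riesz_admissible K \<mu>" and s: "riesz_admissible K \<sigma>" and t: "0 \<le> t" "t \<le> 1"
  obtains \<rho> where "riesz_admissible K \<rho>"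
    "\<And>f. f \<in> borel_measurable borel \<Longrightarrow> (\<integral>\<^sup>+x. f x \<partial>\<rho>) = ennreal t * (\<integral>\<^sup>+x. f x \<partial>\<sigma>) + ennreal (1-t) * (\<integral>\<^sup>+x. f x \<partial>\<mu>)"
proof -
  define N where "N = (\<lambda>b. if b then \<sigma> else \<mu>)"
  define \<rho> where "\<rho> = measure_pmf (bernoulli_pmf t) \<bind> N"
  have N: "N \<in> measurable (measure_pmf (bernoulli_pmf t)) (subprob_algebra borel)"
    unfolding measurable_pmf_measure1 N_def
    using riesz_admissible_prob[OF m] riesz_admissible_prob[OF s]
    by (auto simp: space_subprob_algebra intro: prob_space_imp_subprob_space split: if_splits)
  have sets: "sets \<rho> = sets borel" unfolding \<rho>_def
    by (rule sets_bind) (use N in \<open>auto simp: N_def riesz_admissible_prob(2)[OF m] riesz_admissible_prob(2)[OF s]\<close>)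
  have int: "(\<integral>\<^sup>+x. f x \<partial>\<rho>) = ennreal t * (\<integral>\<^sup>+x. f x \<partial>\<sigma>) + ennreal (1-t) * (\<integral>\<^sup>+x. f x \<partial>\<mu>)"
    if f: "f \<in> borel_measurable borel" for f
    unfolding \<rho>_def nn_integral_bind[OF f N] using t by (simp add: N_def mult.commute)
  have "emeasure \<rho> A = ennreal t * emeasure \<sigma> A + ennreal (1-t) * emeasure \<mu> A" if "A \<in> sets borel" for A
    using int[of "indicator A"] that sets riesz_admissible_prob(2)[OF m] riesz_admissible_prob(2)[OF s] by simp
  moreover have "K \<in> sets borel" using m emeasure_notin_sets[of K \<mu>] by (auto simp: riesz_admissible_def)
  ultimately have "riesz_admissible K \<rho>"
    using m s t sets unfolding riesz_admissible_def
    by (auto simp: ennreal_plus[symmetric] simp del: ennreal_plus)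
  then show ?thesis using that int by blast
qed

text \<open>First variation: the energy of \<open>(1-t) \<mu> + t \<sigma>\<close> is at least the infimum \<open>i\<close>.\<close>

lemma mutual_energy_lower_bound:
  fixes K :: "'a::euclidean_space set"
  assumes i: "riesz_energy 1 K = ennreal i" "i \<ge> 0" and A: "A \<ge> 0" and \<kappa>: "\<kappa> > 0"
  obtains \<epsilon> where "\<epsilon> > 0" "\<epsilon> \<le> \<kappa>"
    "\<And>\<mu> \<sigma>. riesz_admissible K \<mu> \<Longrightarrow> riesz_admissible K \<sigma> \<Longrightarrow> mutual \<mu> \<mu> \<le> ennreal (i + \<epsilon>) \<Longrightarrow> mutual \<sigma> \<sigma> \<le> ennreal A
       \<Longrightarrow> mutual \<mu> \<sigma> \<ge> ennreal (i - \<kappa>)"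
proof -
  \<comment> \<open>Expanding the energy of the mixture bounds 2 (1-t) (i - x) by t A +
    \<epsilon>/t, with x the mutual energy. Both terms are at most \<kappa>/2, and 2 (1-t) >= 1. The
    choice precedes the measures and depends on \<open>A\<close> and \<kappa> only.\<close>
  define t where "t = min (1/2) (\<kappa> / (2 * (A + 1)))"
  have t: "t > 0" "t \<le> 1/2" "t \<le> \<kappa> / (2 * (A + 1))"
    using A \<kappa> unfolding t_def by (simp_all only: min.cobounded1 min.cobounded2) simp
  define \<epsilon> where "\<epsilon> = t * \<kappa> / 2"
  have \<epsilon>: "\<epsilon> > 0" using t \<kappa> by (simp add: \<epsilon>_def)
  have "t * \<kappa> \<le> 1 * \<kappa>" using t \<kappa> by (intro mult_right_mono) auto
  then have "\<epsilon> \<le> \<kappa>" using \<kappa> by (simp add: \<epsilon>_def)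
  moreover have "mutual \<mu> \<sigma> \<ge> ennreal (i - \<kappa>)"
    if m: "riesz_admissible K \<mu>" and s: "riesz_admissible K \<sigma>" and Em: "mutual \<mu> \<mu> \<le> ennreal (i + \<epsilon>)" and Es: "mutual \<sigma> \<sigma> \<le> ennreal A"
    for \<mu> \<sigma>
  proof (cases "mutual \<mu> \<sigma>")
    case (real x)
    interpret m: prob_space \<mu> by (rule riesz_admissible_prob[OF m])
    interpret s: prob_space \<sigma> by (rule riesz_admissible_prob[OF s])
    note [measurable_cong] = riesz_admissible_prob(2)[OF m] riesz_admissible_prob(2)[OF s]
    obtain \<rho> where r: "riesz_admissible K \<rho>" and int:
      "\<And>f. f \<in> borel_measurable borel \<Longrightarrow> (\<integral>\<^sup>+x. f x \<partial>\<rho>) = ennreal t * (\<integral>\<^sup>+x. f x \<partial>\<sigma>) + ennreal (1-t) * (\<integral>\<^sup>+x. f x \<partial>\<mu>)"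
      using convex_combination_measure[OF m s, of t] t by auto
    have mut: "mutual \<rho> \<nu> = ennreal t * mutual \<sigma> \<nu> + ennreal (1-t) * mutual \<mu> \<nu>" if "prob_space \<nu>" "sets \<nu> = sets borel" for \<nu>
    proof -
      interpret n: prob_space \<nu> by fact
      note [measurable_cong] = that(2)
      show ?thesis unfolding mutual_def by (rule int) measurable
    qed
    have "ennreal i \<le> mutual \<rho> \<rho>" using riesz_energy_le[OF r] i by simp
    also have "\<dots> = ennreal t * mutual \<rho> \<sigma> + ennreal (1-t) * mutual \<rho> \<mu>"
      using mut[OF riesz_admissible_prob(1,2)[OF r]] mutual_commute[OF r m] mutual_commute[OF r s] by simp
    also have "\<dots> = ennreal t * (ennreal t * mutual \<sigma> \<sigma> + ennreal (1-t) * mutual \<mu> \<sigma>)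
       + ennreal (1-t) * (ennreal t * mutual \<mu> \<sigma> + ennreal (1-t) * mutual \<mu> \<mu>)"
      using mut[OF riesz_admissible_prob(1,2)[OF m]] mut[OF riesz_admissible_prob(1,2)[OF s]] mutual_commute[OF m s] by simp
    also have "\<dots> \<le> ennreal t * (ennreal t * ennreal A + ennreal (1-t) * ennreal x)
       + ennreal (1-t) * (ennreal t * ennreal x + ennreal (1-t) * ennreal (i + \<epsilon>))"
      unfolding real by (intro add_mono mult_left_mono Em Es order_refl) auto
    also have "\<dots> = ennreal (t * (t * A + (1-t) * x) + (1-t) * (t * x + (1-t) * (i + \<epsilon>)))"
      using t A real i \<epsilon> by (simp add: ennreal_mult'' ennreal_mult ennreal_plus)
    finally have "i \<le> t * (t * A + (1-t) * x) + (1-t) * (t * x + (1-t) * (i + \<epsilon>))"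
      using t A real i \<epsilon> by (subst (asm) ennreal_le_iff) auto
    then have 1: "2 * t * (1-t) * (i - x) \<le> t * (t * A) + (1-t)\<^sup>2 * \<epsilon> - t\<^sup>2 * i"
      by (simp add: algebra_simps power2_eq_square)
    have "t * (A + 1) \<le> \<kappa> / 2" using t(3) A by (simp add: field_simps)
    then have "t * A \<le> \<kappa> / 2" using t by (simp add: algebra_simps)
    then have "t * (t * A) \<le> t * (\<kappa> / 2)" using t by (intro mult_left_mono) auto
    moreover have "(1-t)\<^sup>2 * \<epsilon> \<le> 1 * \<epsilon>" using t \<epsilon> by (intro mult_right_mono power_le_one) auto
    moreover have "t\<^sup>2 * i \<ge> 0" using i by simp
    ultimately have "2 * t * (1-t) * (i - x) \<le> t * \<kappa>" using 1 by (simp add: \<epsilon>_def)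
    then have "t * (2 * (1-t) * (i - x)) \<le> t * \<kappa>" by (simp add: mult_ac)
    then have 2: "2 * (1-t) * (i - x) \<le> \<kappa>" using t by simp
    have "i - x \<le> \<kappa>"
    proof (cases "i - x \<ge> 0")
      case True
      have "1 * (i - x) \<le> 2 * (1-t) * (i - x)" using True t by (intro mult_right_mono) auto
      then show ?thesis using 2 by simp
    qed (use \<kappa> in auto)
    then show ?thesis using real by (simp add: ennreal_leI)
  qed simp
  ultimately show ?thesis using that \<epsilon> by blast
qed

section \<open>Uniform measures on balls and their local potentials\<close>

lemma riesz_kernel_translate: "riesz_kernel \<alpha> (a + x) (a + y) = riesz_kernel \<alpha> x y"
  "riesz_kernel \<alpha> (a - x) (a - y) = riesz_kernel \<alpha> x y"
  by (auto simp: riesz_kernel_def dist_norm norm_minus_commute)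

text \<open>Dyadic shells: for |z| between \<open>R (Suc j)\<close> and \<open>R j\<close> the
  kernel is at most \<open>c j\<close>, and the volume of the ball of radius \<open>R j\<close>
  turns this into a multiple of 2^(-j) r, a geometric series. The bound is linear in
  \<open>r\<close>, so it serves for finiteness and for smallness.\<close>

lemma riesz_kernel_ball_integral:
  fixes r :: real
  assumes r: "r > 0"
  shows "(\<integral>\<^sup>+z. riesz_kernel 1 z 0 * indicator (ball (0::'a::euclidean_space) r) z \<partial>lborel)
    \<le> ennreal (unit_ball_vol (DIM('a)) * 2 ^ DIM('a) * r)"
proof -
  define N where "N = DIM('a)"
  have N: "N \<ge> 1" by (simp add: N_def DIM_positive Suc_leI)
  define R where "R = (\<lambda>j::nat. r / 2 ^ j)"
  define c where "c = (\<lambda>j. ennreal (R (Suc j) powr (-(real N - 1))))"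
  have R0: "R j > 0" for j using r by (simp add: R_def)
  have shell: "riesz_kernel 1 z 0 * indicator (ball 0 r) z \<le> (\<Sum>j. c j * indicator (ball 0 (R j)) z)" if z: "z \<noteq> 0" for z :: 'a
  proof (cases "z \<in> ball 0 r")
    case True
    then have nz: "0 < norm z" "norm z < r" using z by auto
    define P where "P = (\<lambda>j. R j \<le> norm z)"
    have "(\<lambda>j. r * (1/2) ^ j) \<longlonglongrightarrow> 0" by (intro tendsto_mult_right_zero LIMSEQ_power_zero) simp
    then have "R \<longlonglongrightarrow> 0" by (simp add: R_def power_one_over)
    then have "\<exists>j. P j" using order_tendstoD(2)[of R 0 sequentially "norm z"] nz
      by (auto simp: P_def eventually_sequentially intro: less_imp_le)
    then obtain k where k: "P k" "\<And>j. j < k \<Longrightarrow> \<not> P j" using LeastI_ex[of P] not_less_Least by blast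
    have "\<not> P 0" using nz by (simp add: P_def R_def)
    then obtain j where kj: "k = Suc j" using k(1) by (cases k) auto
    have j: "R (Suc j) \<le> norm z" "norm z < R j" using k(1) k(2)[of j] by (auto simp: P_def kj)
    have "riesz_kernel 1 z 0 * indicator (ball 0 r) z = ennreal (norm z powr (-(real N - 1)))"
      using True z by (simp add: riesz_kernel_def N_def)
    also have "\<dots> \<le> c j" unfolding c_def using j R0 N by (intro ennreal_leI powr_mono2') auto
    also have "\<dots> = c j * indicator (ball 0 (R j)) z" using j by simp
    also have "\<dots> \<le> (\<Sum>j. c j * indicator (ball 0 (R j)) z)"
    proof -
      define f where "f = (\<lambda>j. c j * indicator (ball 0 (R j)) z)"
      have "sum f {j} \<le> suminf f" by (rule sum_le_suminf) auto
      then have "f j \<le> suminf f" by simp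
      then show ?thesis unfolding f_def .
    qed
    finally show ?thesis .
  qed simp
  have "(\<integral>\<^sup>+z. riesz_kernel 1 z 0 * indicator (ball (0::'a) r) z \<partial>lborel)
    \<le> (\<integral>\<^sup>+z. (\<Sum>j. c j * indicator (ball (0::'a) (R j)) z) \<partial>lborel)"
  proof (rule nn_integral_mono_AE)
    have "AE z in lborel. z \<noteq> (0::'a)" by (intro AE_I[of _ _ "{0}"]) auto
    then show "AE z in lborel. riesz_kernel 1 z 0 * indicator (ball (0::'a) r) z \<le> (\<Sum>j. c j * indicator (ball (0::'a) (R j)) z)"
      by eventually_elim (rule shell)
  qed
  also have "\<dots> = (\<Sum>j. c j * emeasure lborel (ball (0::'a) (R j)))"
    by (subst nn_integral_suminf)
      (auto simp: nn_integral_cmult_indicator intro!: borel_measurable_times_ennreal borel_measurable_indicator)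
  also have "\<dots> = (\<Sum>j. ennreal (unit_ball_vol N * 2 ^ N * r * (1/2) ^ Suc j))"
  proof (rule suminf_cong)
    fix j
    have "R (Suc j) powr (-(real N - 1)) * R j ^ N = R (Suc j) powr (-(real N - 1)) * (2 ^ N * R (Suc j) powr N)"
    proof -
      have "R j = 2 * R (Suc j)" by (simp add: R_def)
      then have "R j ^ N = 2 ^ N * R (Suc j) ^ N" by (simp only: power_mult_distrib)
      then show ?thesis using powr_realpow[OF R0, of "Suc j" N] by (simp only:)
    qed
    also have "\<dots> = 2 ^ N * (R (Suc j) powr (-(real N - 1) + N))" by (subst powr_add) simp
    also have "\<dots> = 2 ^ N * R (Suc j)" using R0 by (simp add: less_imp_le)
    finally have e: "R (Suc j) powr (-(real N - 1)) * R j ^ N = 2 ^ N * (r * (1/2) ^ Suc j)" by (simp add: R_def power_one_over)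
    have "c j * emeasure lborel (ball (0::'a) (R j)) = ennreal (R (Suc j) powr (-(real N - 1)) * (unit_ball_vol N * R j ^ N))"
      using R0[of j] by (simp add: c_def emeasure_ball N_def ennreal_mult'' unit_ball_vol_nonneg)
    also have "R (Suc j) powr (-(real N - 1)) * (unit_ball_vol N * R j ^ N) = unit_ball_vol N * 2 ^ N * r * (1/2) ^ Suc j"
      using e by (simp add: mult_ac)
    finally show "c j * emeasure lborel (ball (0::'a) (R j)) = ennreal (unit_ball_vol N * 2 ^ N * r * (1/2) ^ Suc j)" .
  qed
  also have "\<dots> = ennreal (unit_ball_vol N * 2 ^ N * r)"
  proof -
    have "(\<lambda>j. unit_ball_vol N * 2 ^ N * r * (1/2) ^ Suc j) sums (unit_ball_vol N * 2 ^ N * r * 1)"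
      by (intro sums_mult power_half_series)
    then show ?thesis using r by (intro suminf_ennreal_eq) (auto simp: unit_ball_vol_nonneg)
  qed
  finally show ?thesis by (simp add: N_def)
qed

definition ball_measure :: "real \<Rightarrow> 'a::euclidean_space measure" where
  "ball_measure \<delta> = uniform_measure lborel (ball 0 \<delta>)"

lemma ball_measure:
  assumes d: "\<delta> > 0"
  shows "prob_space (ball_measure \<delta> :: 'a::euclidean_space measure)" "sets (ball_measure \<delta> :: 'a measure) = sets borel"
    "AE h in (ball_measure \<delta> :: 'a measure). norm h < \<delta>"
proof -
  have v: "emeasure lborel (ball (0::'a) \<delta>) \<noteq> 0" "emeasure lborel (ball (0::'a) \<delta>) \<noteq> \<infinity>"
    using d content_ball_pos[of \<delta> "0::'a"] emeasure_lborel_ball_finite[of "0::'a" \<delta>]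
    by (auto simp: measure_def)
  show "prob_space (ball_measure \<delta> :: 'a measure)" unfolding ball_measure_def by (rule prob_space_uniform_measure[OF v])
  show "sets (ball_measure \<delta> :: 'a measure) = sets borel" by (simp add: ball_measure_def)
  show "AE h in (ball_measure \<delta> :: 'a measure). norm h < \<delta>" unfolding ball_measure_def
    by (rule AE_uniform_measureI) auto
qed

text \<open>Passing from the ball to the whole space and translating makes the bound uniform in
  \<open>x\<close>. It is used with \<open>r = 2 * \<delta>\<close> for the total energy and with
  small \<open>r\<close> for the singular part.\<close>

lemma ball_measure_local_potential:
  fixes x :: "'a::euclidean_space"
  assumes d: "\<delta> > 0" and r: "r > 0"
  shows "(\<integral>\<^sup>+h. riesz_kernel 1 x h * indicator {h. dist x h < r} h \<partial>ball_measure \<delta>)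
    \<le> ennreal (2 ^ DIM('a) * r / \<delta> ^ DIM('a))"
proof -
  let ?v = "unit_ball_vol (DIM('a))"
  have vd: "emeasure lborel (ball (0::'a) \<delta>) = ennreal (?v * \<delta> ^ DIM('a))" using d by (simp add: emeasure_ball)
  have "(\<integral>\<^sup>+h. riesz_kernel 1 x h * indicator {h. dist x h < r} h \<partial>ball_measure \<delta>)
    = (\<integral>\<^sup>+h. riesz_kernel 1 x h * indicator {h. dist x h < r} h * indicator (ball 0 \<delta>) h \<partial>lborel) / emeasure lborel (ball (0::'a) \<delta>)"
    unfolding ball_measure_def by (subst nn_integral_uniform_measure) auto
  also have "\<dots> \<le> (\<integral>\<^sup>+h. riesz_kernel 1 x h * indicator {h. dist x h < r} h \<partial>lborel) / emeasure lborel (ball (0::'a) \<delta>)"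
    by (intro divide_right_mono_ennreal nn_integral_mono) (auto simp: indicator_def)
  also have "(\<integral>\<^sup>+h. riesz_kernel 1 x h * indicator {h. dist x h < r} h \<partial>lborel)
    = (\<integral>\<^sup>+h. riesz_kernel 1 x h * indicator {h. dist x h < r} h \<partial>distr lborel borel ((+) x))"
    by (simp add: lborel_distr_plus)
  also have "\<dots> = (\<integral>\<^sup>+z. riesz_kernel 1 z 0 * indicator (ball (0::'a) r) z \<partial>lborel)"
    by (subst nn_integral_distr) (auto intro!: nn_integral_cong simp: riesz_kernel_def indicator_def dist_norm)
  also have "\<dots> \<le> ennreal (?v * 2 ^ DIM('a) * r)" by (rule riesz_kernel_ball_integral[OF r])
  also have "ennreal (?v * 2 ^ DIM('a) * r) / emeasure lborel (ball (0::'a) \<delta>) = ennreal (2 ^ DIM('a) * r / \<delta> ^ DIM('a))"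
  proof -
    have "?v \<noteq> 0" by (metis less_irrefl of_nat_0_le_iff unit_ball_vol_pos)
    then show ?thesis unfolding vd using d r by (subst divide_ennreal) (auto simp: field_simps)
  qed
  finally show ?thesis by (simp add: divide_right_mono_ennreal)
qed

section \<open>The Riesz kernel as a Newtonian kernel, and its regularization\<close>

lemma kexp_prod_real: "kexp TYPE('a::euclidean_space \<times> real) = (real DIM('a) - 1) / 2"
  by (simp add: kexp_def)

text \<open>The diagonal is excluded because \<open>riesz_kernel\<close> is infinite there while
  \<open>kern 0\<close> takes the default value 0.\<close>

lemma riesz_kernel_eq_kern:
  fixes x y :: "'a::euclidean_space"
  assumes "x \<noteq> y"
  shows "riesz_kernel 1 x y = ennreal (kern 0 ((x - y, 0) :: 'a \<times> real))"
proof -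
  have "- 2 * ((real DIM('a) - 1) / 2) = - (real DIM('a) - 1)" by simp
  moreover have "dist x y > 0" using assms by simp
  ultimately have "((x - y) \<bullet> (x - y)) powr (- ((real DIM('a) - 1) / 2)) = dist x y powr (- (real DIM('a) - 1))"
    unfolding dist_norm power2_norm_eq_inner[symmetric] by (metis square_powr)
  then show ?thesis using assms
    by (simp add: riesz_kernel_def kern_def kexp_prod_real)
qed

lemma near_minimizer:
  assumes "riesz_energy 1 K = ennreal i" "i \<ge> 0" "\<epsilon> > 0"
  obtains \<mu> where "riesz_admissible K \<mu>" "mutual \<mu> \<mu> \<le> ennreal (i + \<epsilon>)"
proof -
  have "riesz_energy 1 K < ennreal (i + \<epsilon>)" using assms by (simp add: ennreal_less_iff)
  then show ?thesis using that
    unfolding riesz_energy_def INF_less_iff mutual_def[symmetric] by (auto intro: less_imp_le)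
qed

text \<open>Beyond distance \<open>r\<close> the squared distance q satisfies q + e <= q (1 +
  e/r^2), so regularizing costs a factor that tends to 1 with \<open>e\<close>. The part within
  \<open>r\<close> is kept aside unregularized.\<close>

lemma riesz_kernel_le_local_plus_kern:
  fixes x y :: "'a::euclidean_space"
  assumes r: "r > 0" and e: "e > 0"
  shows "riesz_kernel 1 x y \<le> riesz_kernel 1 x y * indicator {h. dist x h < r} y
    + ennreal ((1 + e / r\<^sup>2) powr ((real DIM('a) - 1) / 2) * kern e ((x - y, 0) :: 'a \<times> real))"
proof (cases "dist x y < r")
  case False
  define s where "s = (real DIM('a) - 1) / 2"
  define q where "q = (x - y) \<bullet> (x - y)"
  have s: "s \<ge> 0" by (simp add: s_def Suc_leI DIM_positive)
  have xy: "x \<noteq> y" using False r by auto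
  have q: "q \<ge> r\<^sup>2" using False r unfolding q_def power2_norm_eq_inner[symmetric] dist_norm by (intro power_mono) auto
  then have q0: "q > 0" using r by (meson less_le_trans zero_less_power)
  have "q + e \<le> q * (1 + e / r\<^sup>2)"
  proof -
    have "e * r\<^sup>2 \<le> e * q" using q e by (intro mult_left_mono) auto
    then show ?thesis using r by (simp add: field_simps)
  qed
  then have "(q * (1 + e / r\<^sup>2)) powr (- s) \<le> (q + e) powr (- s)" using q0 e s by (intro powr_mono2') auto
  moreover have pp: "1 + e / r\<^sup>2 > 0" using e r by (intro add_pos_pos) auto
  ultimately have "q powr (-s) / (1 + e / r\<^sup>2) powr s \<le> (q + e) powr (- s)"
    using q0 by (simp add: powr_mult powr_minus_divide)
  then have "q powr (-s) \<le> (1 + e / r\<^sup>2) powr s * (q + e) powr (- s)"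
    using pp by (subst (asm) pos_divide_le_eq) (auto simp: mult.commute)
  then have "riesz_kernel 1 x y \<le> ennreal ((1 + e / r\<^sup>2) powr s * kern e ((x - y, 0) :: 'a \<times> real))"
    unfolding riesz_kernel_eq_kern[OF xy] by (intro ennreal_leI) (simp add: kern_def kexp_prod_real s_def q_def)
  then show ?thesis unfolding s_def by (metis add_increasing zero_le)
qed simp

text \<open>Points of the ball are less than \<open>2 * \<delta>\<close> apart, so the local
  potential at that radius is the whole potential.\<close>

lemma ball_measure_energy:
  assumes d: "\<delta> > 0"
  shows "mutual (ball_measure \<delta>) (ball_measure \<delta> :: 'a::euclidean_space measure) \<le> ennreal (2 ^ DIM('a) * (2 * \<delta>) / \<delta> ^ DIM('a))"
proof -
  note bm = ball_measure[OF d, where 'a='a]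
  interpret prob_space "ball_measure \<delta> :: 'a measure" by (rule bm)
  note [measurable_cong] = bm(2)
  let ?A = "ennreal (2 ^ DIM('a) * (2 * \<delta>) / \<delta> ^ DIM('a))"
  have "mutual (ball_measure \<delta>) (ball_measure \<delta> :: 'a measure) \<le> (\<integral>\<^sup>+x. ?A \<partial>(ball_measure \<delta> :: 'a measure))"
    unfolding mutual_def
  proof (rule nn_integral_mono_AE)
    show "AE x in (ball_measure \<delta> :: 'a measure). (\<integral>\<^sup>+ y. riesz_kernel 1 x y \<partial>ball_measure \<delta>) \<le> ?A" using bm(3)
    proof eventually_elim
      case (elim x)
      have "(\<integral>\<^sup>+ y. riesz_kernel 1 x y \<partial>ball_measure \<delta>) \<le> (\<integral>\<^sup>+h. riesz_kernel 1 x h * indicator {h. dist x h < 2 * \<delta>} h \<partial>ball_measure \<delta>)"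
      proof (rule nn_integral_mono_AE)
        show "AE h in ball_measure \<delta>. riesz_kernel 1 x h \<le> riesz_kernel 1 x h * indicator {h. dist x h < 2 * \<delta>} h"
          using bm(3)
        proof eventually_elim
          case (elim h)
          have "dist x h \<le> norm x + norm h" by (simp add: dist_norm norm_triangle_ineq4)
          then show ?case using elim \<open>norm x < \<delta>\<close> by simp
        qed
      qed
      also have "\<dots> \<le> ?A" using ball_measure_local_potential[OF d, of "2 * \<delta>" x] d by simp
      finally show ?case .
    qed
  qed
  also have "\<dots> = ?A" using emeasure_space_1 by simp
  finally show ?thesis .
qed

text \<open>Averaging a near-minimizer over small balls makes its potential almost at least the energy
  at every point where the ball fits into \<open>K\<close>.\<close>

lemma averaged_potential_lower_bound:
  fixes K :: "'a::euclidean_space set"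
  assumes dim: "DIM('a) \<ge> 2" and cK: "compact K" and i: "riesz_energy 1 K = ennreal i" "i \<ge> 0" and d: "\<delta> > 0"
    and \<kappa>: "\<kappa> > 0"
  obtains \<nu> :: "('a \<times> real) measure" and e K' where "compact_potential K' \<nu>" "e > 0" "measure \<nu> (space \<nu>) = 1"
    "\<And>x. cball x \<delta> \<subseteq> K \<Longrightarrow> i - 2 * \<kappa> \<le> (1 + \<kappa>) * pot e \<nu> (x, 0)"
proof -
  define \<sigma> where "\<sigma> = (ball_measure \<delta> :: 'a measure)"
  note bm = ball_measure[OF d, where 'a='a, folded \<sigma>_def]
  interpret s: prob_space \<sigma> by (rule bm)
  define A where "A = 2 ^ DIM('a) * (2 * \<delta>) / \<delta> ^ DIM('a)"
  have A: "A \<ge> 0" using d by (simp add: A_def)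
  obtain \<epsilon> where \<epsilon>: "\<epsilon> > 0" and low: "\<And>\<mu> \<sigma>. riesz_admissible K \<mu> \<Longrightarrow> riesz_admissible K \<sigma> \<Longrightarrow>
      mutual \<mu> \<mu> \<le> ennreal (i + \<epsilon>) \<Longrightarrow> mutual \<sigma> \<sigma> \<le> ennreal A \<Longrightarrow> mutual \<mu> \<sigma> \<ge> ennreal (i - \<kappa>)"
    using mutual_energy_lower_bound[OF i A \<kappa>] by metis
  obtain \<mu> where m: "riesz_admissible K \<mu>" "mutual \<mu> \<mu> \<le> ennreal (i + \<epsilon>)" using near_minimizer[OF i \<epsilon>] .
  interpret m: prob_space \<mu> by (rule riesz_admissible_prob[OF m(1)])
  interpret pp: pair_prob_space \<mu> \<sigma> ..
  note [measurable_cong] = riesz_admissible_prob(2)[OF m(1)] bm(2)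
  \<comment> \<open>This \<open>r\<close> bounds the local part by \<kappa>; then \<open>e\<close>
    is taken so small that the regularization factor is below 1 + \<kappa>. Together with the
    \<kappa> lost in \<open>low\<close> this explains the \<open>2 * \<kappa>\<close>.\<close>
  define r where "r = \<kappa> * \<delta> ^ DIM('a) / 2 ^ DIM('a)"
  have r: "r > 0" "2 ^ DIM('a) * r / \<delta> ^ DIM('a) = \<kappa>" using \<kappa> d by (auto simp: r_def)
  have "((\<lambda>e. (1 + e / r\<^sup>2) powr ((real DIM('a) - 1) / 2)) \<longlongrightarrow> (1 + 0 / r\<^sup>2) powr ((real DIM('a) - 1) / 2)) (at_right 0)"
    by (intro tendsto_intros) (use r in auto)
  then have "\<forall>\<^sub>F e in at_right 0. (1 + e / r\<^sup>2) powr ((real DIM('a) - 1) / 2) < 1 + \<kappa>"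
    using \<kappa> by (auto dest!: order_tendstoD(2)[where a="1+\<kappa>"])
  then obtain e where e: "e > 0" "(1 + e / r\<^sup>2) powr ((real DIM('a) - 1) / 2) < 1 + \<kappa>"
    using eventually_happens[OF eventually_conj[OF _ eventually_at_right_less[of 0]], of "\<lambda>e. (1 + e / r\<^sup>2) powr ((real DIM('a) - 1) / 2) < 1 + \<kappa>"]
    by (auto simp: trivial_limit_at_right_real)
  define T where "T = (\<lambda>p :: 'a \<times> 'a. (fst p + snd p, 0::real))"
  have T [measurable]: "T \<in> borel_measurable (\<mu> \<Otimes>\<^sub>M \<sigma>)" unfolding T_def by measurable
  \<comment> \<open>The convolution of \<mu> with the ball measure, placed in the
    hyperplane.\<close>
  define \<nu> where "\<nu> = distr (\<mu> \<Otimes>\<^sub>M \<sigma>) borel T"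
  interpret n: prob_space \<nu> unfolding \<nu>_def by (rule pp.prob_space_distr[OF T])
  obtain B where B: "\<And>y. y \<in> K \<Longrightarrow> norm y \<le> B" using compact_imp_bounded[OF cK] by (auto simp: bounded_iff)
  interpret compact_potential "cball (0::'a \<times> real) (B + \<delta>)" \<nu>
  proof (rule compact_potential.intro)
    show "AE y in \<nu>. y \<in> cball 0 (B + \<delta>)" unfolding \<nu>_def
    proof (subst AE_distr_iff)
      show "AE p in \<mu> \<Otimes>\<^sub>M \<sigma>. T p \<in> cball 0 (B + \<delta>)"
      proof (rule pp.AE_pair_measure)
        show "AE y in \<mu>. AE h in \<sigma>. T (y, h) \<in> cball 0 (B + \<delta>)"
          using riesz_admissible_AE[OF m(1)]
        proof eventually_elim
          case (elim y)
          show ?case using bm(3)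
          proof eventually_elim
            case (elim h)
            have "norm (T (y, h)) = norm (y + h)" by (simp add: T_def norm_Pair)
            then show ?case using norm_triangle_ineq[of y h] B[OF \<open>y \<in> K\<close>] elim by simp
          qed
        qed
      qed (unfold T_def mem_cball, measurable)
    qed auto
  qed (use dim n.finite_measure n.prob_space in \<open>auto simp: \<nu>_def\<close>)
  have "i - 2 * \<kappa> \<le> (1 + \<kappa>) * pot e \<nu> (x, 0)" if x: "cball x \<delta> \<subseteq> K" for x
  proof -
    \<comment> \<open>The uniform measure on the ball around \<open>x\<close>; its mutual energy
      with \<mu> is the averaged potential at \<open>x\<close>. By translation invariance the energy
      bound \<open>A\<close> holds for all \<open>x\<close> at once. The sign in
      \<open>x - h\<close> fits the distance |x - (y + h)|.\<close>
    define \<tau> where "\<tau> = distr \<sigma> borel (\<lambda>h. x - h)"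
    have tau: "riesz_admissible K \<tau>"
    proof (rule riesz_admissibleI)
      show "prob_space \<tau>" unfolding \<tau>_def by (rule s.prob_space_distr) measurable
      show "AE y in \<tau>. y \<in> K" unfolding \<tau>_def
      proof (subst AE_distr_iff)
        show "AE h in \<sigma>. x - h \<in> K" using bm(3)
          by eventually_elim (use x in \<open>auto simp: subset_iff dist_norm\<close>)
      qed (use cK in \<open>auto intro!: borel_closed compact_imp_closed\<close>)
    qed (use cK in \<open>auto simp: \<tau>_def intro!: borel_closed compact_imp_closed\<close>)
    have "mutual \<tau> \<tau> = mutual \<sigma> \<sigma>"
      unfolding mutual_def \<tau>_def by (simp add: nn_integral_distr riesz_kernel_translate)
    then have "ennreal (i - \<kappa>) \<le> mutual \<mu> \<tau>"
      using low[OF m(1) tau m(2)] ball_measure_energy[OF d, where 'a='a] by (simp add: A_def \<sigma>_def)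
    also have "\<dots> = (\<integral>\<^sup>+y. (\<integral>\<^sup>+h. riesz_kernel 1 (x - y) h \<partial>\<sigma>) \<partial>\<mu>)"
      unfolding mutual_def \<tau>_def
      by (simp add: nn_integral_distr) (intro nn_integral_cong, simp add: riesz_kernel_def dist_norm algebra_simps norm_minus_commute)
    also have "\<dots> \<le> (\<integral>\<^sup>+y. (\<integral>\<^sup>+h. riesz_kernel 1 (x - y) h * indicator {h. dist (x - y) h < r} h
        + ennreal ((1 + \<kappa>) * kern e ((x - y - h, 0) :: 'a \<times> real)) \<partial>\<sigma>) \<partial>\<mu>)"
    proof (intro nn_integral_mono)
      fix y h :: 'a
      have "(1 + e / r\<^sup>2) powr ((real DIM('a) - 1) / 2) * kern e ((x - y - h, 0) :: 'a \<times> real) \<le> (1 + \<kappa>) * kern e ((x - y - h, 0) :: 'a \<times> real)"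
        using e(2) by (intro mult_right_mono) (auto simp: kern_def)
      then show "riesz_kernel 1 (x - y) h \<le> riesz_kernel 1 (x - y) h * indicator {h. dist (x - y) h < r} h
        + ennreal ((1 + \<kappa>) * kern e ((x - y - h, 0) :: 'a \<times> real))"
        using order_trans[OF riesz_kernel_le_local_plus_kern[OF r(1) e(1), of "x - y" h] add_left_mono[OF ennreal_leI]] by blast
    qed
    also have "\<dots> = (\<integral>\<^sup>+y. (\<integral>\<^sup>+h. riesz_kernel 1 (x - y) h * indicator {h. dist (x - y) h < r} h \<partial>\<sigma>) \<partial>\<mu>)
        + (\<integral>\<^sup>+y. (\<integral>\<^sup>+h. ennreal ((1 + \<kappa>) * kern e ((x - y - h, 0) :: 'a \<times> real)) \<partial>\<sigma>) \<partial>\<mu>)"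
      by (subst nn_integral_add[symmetric]) (measurable, simp add: nn_integral_add)
    also have "(\<integral>\<^sup>+y. (\<integral>\<^sup>+h. riesz_kernel 1 (x - y) h * indicator {h. dist (x - y) h < r} h \<partial>\<sigma>) \<partial>\<mu>)
        \<le> (\<integral>\<^sup>+y. ennreal \<kappa> \<partial>\<mu>)"
      using ball_measure_local_potential[OF d r(1), where 'a='a] r(2) by (intro nn_integral_mono) (simp add: \<sigma>_def)
    also have "\<dots> = ennreal \<kappa>" using m.emeasure_space_1 by simp
    also have "(\<integral>\<^sup>+y. (\<integral>\<^sup>+h. ennreal ((1 + \<kappa>) * kern e ((x - y - h, 0) :: 'a \<times> real)) \<partial>\<sigma>) \<partial>\<mu>)
        = (\<integral>\<^sup>+p. ennreal ((1 + \<kappa>) * kern e ((x, 0) - T p)) \<partial>(\<mu> \<Otimes>\<^sub>M \<sigma>))"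
      by (subst s.nn_integral_fst[symmetric]) (auto simp: T_def algebra_simps)
    also have "\<dots> = (\<integral>\<^sup>+w. ennreal ((1 + \<kappa>) * kern e ((x, 0) - w)) \<partial>\<nu>)"
      unfolding \<nu>_def by (subst nn_integral_distr) auto
    also have "\<dots> = ennreal (\<integral>w. (1 + \<kappa>) * kern e ((x, 0) - w) \<partial>\<nu>)"
      by (rule nn_integral_eq_integral) (use pot_regular(5)[of e "(x,0)"] e \<kappa> in \<open>auto simp: kern_def\<close>)
    also have "(\<integral>w. (1 + \<kappa>) * kern e ((x, 0) - w) \<partial>\<nu>) = (1 + \<kappa>) * pot e \<nu> (x, 0)" by (simp add: pot_def)
    also have "ennreal \<kappa> + ennreal ((1 + \<kappa>) * pot e \<nu> (x, 0)) = ennreal (\<kappa> + (1 + \<kappa>) * pot e \<nu> (x, 0))"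
      using \<kappa> pot_nonneg[of e "(x,0)"] by (subst ennreal_plus) auto
    finally have "ennreal (i - \<kappa>) \<le> ennreal (\<kappa> + (1 + \<kappa>) * pot e \<nu> (x, 0))" by simp
    then have "i - \<kappa> \<le> \<kappa> + (1 + \<kappa>) * pot e \<nu> (x, 0)"
      using \<kappa> pot_nonneg[of e "(x,0)"] by (subst (asm) ennreal_le_iff) auto
    then show ?thesis by simp
  qed
  then show ?thesis using that compact_potential_axioms e n.prob_space by blast
qed


section \<open>Measures with nearly bounded potential\<close>

text \<open>If the potential were large on a set \<open>H\<close> of positive mass, the lower bound on the mutual energy with the
  measure conditioned on the complement of \<open>H\<close> would make the total energy too large.\<close>

lemma near_minimizer_potential_bound:
  fixes K :: "'a::euclidean_space set"
  assumes i: "riesz_energy 1 K = ennreal i" "i \<ge> 0" and e: "\<epsilon> > 0" and k: "\<kappa> > 0"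
  obtains \<mu> where "riesz_admissible K \<mu>" "mutual \<mu> \<mu> < \<infinity>"
    "emeasure \<mu> {x. (\<integral>\<^sup>+y. riesz_kernel 1 x y \<partial>\<mu>) > ennreal (i + \<epsilon>)} \<le> ennreal \<kappa>"
proof -
  \<comment> \<open>A lower bound, known before \<mu> is chosen, for the mass \<open>a\<close>
    outside \<open>H\<close>: the energy is at most \<open>i + t\<close> with \<open>t\<close> at
    most \<epsilon>/2, so \<open>H\<close> cannot carry all the mass. It makes \<open>A\<close> a
    bound for the energy of the conditioned measure.\<close>
  define a0 where "a0 = (\<epsilon> / 2) / (i + \<epsilon>)"
  have a0: "a0 > 0" using e i by (auto simp: a0_def intro!: divide_pos_pos)
  define A where "A = (i + \<epsilon>) / a0\<^sup>2"
  have A: "A \<ge> 0" using a0 e i by (simp add: A_def)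
  \<comment> \<open>The final estimate is \<epsilon> (1-a) <= t + a \<eta> <= 2 \<eta>, hence
    \<epsilon> \<kappa> / 2; the bound \<epsilon>/2 is the one behind \<open>a0\<close>.\<close>
  define \<eta> where "\<eta> = min (\<epsilon> * \<kappa> / 2) (\<epsilon> / 2)"
  have \<eta>: "\<eta> > 0" "\<eta> \<le> \<epsilon> * \<kappa> / 2" "\<eta> \<le> \<epsilon> / 2" using e k by (auto simp: \<eta>_def)
  obtain t where t: "t > 0" "t \<le> \<eta>" and low: "\<And>\<mu> \<sigma>. riesz_admissible K \<mu> \<Longrightarrow> riesz_admissible K \<sigma> \<Longrightarrow>
      mutual \<mu> \<mu> \<le> ennreal (i + t) \<Longrightarrow> mutual \<sigma> \<sigma> \<le> ennreal A \<Longrightarrow> mutual \<mu> \<sigma> \<ge> ennreal (i - \<eta>)"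
    using mutual_energy_lower_bound[OF i A \<eta>(1)] by metis
  obtain \<mu> where m: "riesz_admissible K \<mu>" "mutual \<mu> \<mu> \<le> ennreal (i + t)" using near_minimizer[OF i t(1)] .
  interpret m: prob_space \<mu> by (rule riesz_admissible_prob[OF m(1)])
  note [measurable_cong] = riesz_admissible_prob(2)[OF m(1)]
  have sp: "space \<mu> = UNIV" by (rule riesz_admissible_prob[OF m(1)])
  define u where "u = (\<lambda>x. (\<integral>\<^sup>+y. riesz_kernel 1 x y \<partial>\<mu>))"
  have u [measurable]: "u \<in> borel_measurable borel" unfolding u_def by measurable
  define H where "H = {x. u x > ennreal (i + \<epsilon>)}"
  have H [measurable]: "H \<in> sets borel" unfolding H_def by measurable
  define a where "a = measure \<mu> (-H)"
  have mH: "measure \<mu> H = 1 - a" unfolding a_def Compl_eq_Diff_UNIV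
    using m.prob_compl[of H] sp riesz_admissible_prob(2)[OF m(1)] H by simp
  have a1: "0 \<le> a" "a \<le> 1" by (auto simp: a_def)
  have E: "mutual \<mu> \<mu> = (\<integral>\<^sup>+x. u x \<partial>\<mu>)" by (simp add: mutual_def u_def)
  have split: "(\<integral>\<^sup>+x. u x \<partial>\<mu>) = (\<integral>\<^sup>+x. u x * indicator H x \<partial>\<mu>) + (\<integral>\<^sup>+x. u x * indicator (-H) x \<partial>\<mu>)"
    by (subst nn_integral_add[symmetric]) (auto intro!: nn_integral_cong simp: indicator_def)
  have hi: "ennreal ((i + \<epsilon>) * (1 - a)) \<le> (\<integral>\<^sup>+x. u x * indicator H x \<partial>\<mu>)"
  proof -
    have "ennreal ((i + \<epsilon>) * (1 - a)) = (\<integral>\<^sup>+x. ennreal (i + \<epsilon>) * indicator H x \<partial>\<mu>)"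
      using H i e a1 mH riesz_admissible_prob(2)[OF m(1)]
      by (simp add: nn_integral_cmult_indicator m.emeasure_eq_measure ennreal_mult')
    also have "\<dots> \<le> (\<integral>\<^sup>+x. u x * indicator H x \<partial>\<mu>)"
      by (intro nn_integral_mono) (auto simp: indicator_def H_def)
    finally show ?thesis .
  qed
  have "ennreal ((i + \<epsilon>) * (1 - a)) \<le> ennreal (i + t)"
    using order_trans[OF hi] m(2) unfolding E split by (meson add_increasing2 order_trans order_refl zero_le)
  then have "(i + \<epsilon>) * (1 - a) \<le> i + t" using i t by (subst (asm) ennreal_le_iff) auto
  then have "\<epsilon> / 2 \<le> (i + \<epsilon>) * a" using t \<eta> by (simp add: algebra_simps)
  then have aa: "a \<ge> a0" unfolding a0_def using i e by (subst pos_divide_le_eq) (auto simp: mult.commute)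
  then have apos: "a > 0" using a0 by simp
  define \<sigma> where "\<sigma> = uniform_measure \<mu> (-H)"
  have emH: "emeasure \<mu> (-H) = ennreal a" by (simp add: a_def m.emeasure_eq_measure)
  have inv: "x / ennreal a = ennreal (1/a) * x" for x
    using apos by (simp add: divide_ennreal_def inverse_ennreal mult.commute divide_inverse)
  have s_int: "(\<integral>\<^sup>+x. f x \<partial>\<sigma>) = ennreal (1/a) * (\<integral>\<^sup>+x. f x * indicator (-H) x \<partial>\<mu>)" if "f \<in> borel_measurable borel" for f
    unfolding \<sigma>_def using that by (subst nn_integral_uniform_measure) (auto simp: emH inv)
  have s: "riesz_admissible K \<sigma>"
  proof (rule riesz_admissibleI)
    show "prob_space \<sigma>" unfolding \<sigma>_def by (rule prob_space_uniform_measure) (use emH apos in auto)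
    show "sets \<sigma> = sets borel" by (simp add: \<sigma>_def riesz_admissible_prob(2)[OF m(1)])
    show K: "K \<in> sets borel" using m(1) emeasure_notin_sets[of K \<mu>] by (auto simp: riesz_admissible_def)
    show "AE x in \<sigma>. x \<in> K" unfolding \<sigma>_def
      by (rule AE_uniform_measureI) (use riesz_admissible_AE[OF m(1)] in \<open>auto elim: eventually_mono\<close>)
  qed
  have ms: "mutual \<mu> \<sigma> = ennreal (1/a) * (\<integral>\<^sup>+x. u x * indicator (-H) x \<partial>\<mu>)"
    unfolding mutual_commute[OF m(1) s] unfolding mutual_def u_def[symmetric] by (rule s_int) measurable
  have mle: "mutual \<mu> \<sigma> \<le> ennreal (1/a) * mutual \<mu> \<mu>"
    unfolding ms E by (intro mult_left_mono nn_integral_mono) (auto simp: indicator_def)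
  interpret s: prob_space \<sigma> by (rule riesz_admissible_prob[OF s])
  note [measurable_cong] = riesz_admissible_prob(2)[OF s]
  have "mutual \<sigma> \<sigma> = ennreal (1/a) * (\<integral>\<^sup>+x. (\<integral>\<^sup>+y. riesz_kernel 1 x y \<partial>\<sigma>) * indicator (-H) x \<partial>\<mu>)"
    unfolding mutual_def[of \<sigma> \<sigma>] by (rule s_int) measurable
  also have "\<dots> \<le> ennreal (1/a) * mutual \<mu> \<sigma>"
    unfolding mutual_def by (intro mult_left_mono nn_integral_mono) (auto simp: indicator_def)
  also have "\<dots> \<le> ennreal (1/a) * (ennreal (1/a) * mutual \<mu> \<mu>)" by (intro mult_left_mono mle) auto
  also have "\<dots> \<le> ennreal (1/a) * (ennreal (1/a) * ennreal (i + t))" by (intro mult_left_mono m) auto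
  also have "\<dots> = ennreal ((i + t) / a\<^sup>2)"
    using apos i t by (simp add: ennreal_mult[symmetric] power2_eq_square ennreal_plus[symmetric] del: ennreal_plus)
  also have "\<dots> \<le> ennreal A" unfolding A_def using aa a0 i t \<eta> e by (intro ennreal_leI frac_le power_mono) auto
  finally have "mutual \<sigma> \<sigma> \<le> ennreal A" .
  from low[OF m(1) s m(2) this] have "ennreal (i - \<eta>) \<le> ennreal (1/a) * (\<integral>\<^sup>+x. u x * indicator (-H) x \<partial>\<mu>)" unfolding ms .
  then have "ennreal a * ennreal (i - \<eta>) \<le> ennreal a * (ennreal (1/a) * (\<integral>\<^sup>+x. u x * indicator (-H) x \<partial>\<mu>))" by (rule mult_left_mono) simp
  then have lo: "ennreal (a * (i - \<eta>)) \<le> (\<integral>\<^sup>+x. u x * indicator (-H) x \<partial>\<mu>)"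
    using apos by (simp add: ennreal_mult' mult.assoc[symmetric]) (simp add: ennreal_mult'[symmetric])
  have sum: "ennreal ((i + \<epsilon>) * (1 - a)) + ennreal (a * (i - \<eta>)) \<le> ennreal (i + t)"
    using add_mono[OF hi lo] m(2) unfolding E split by (rule order_trans)
  \<comment> \<open>\<open>ennreal\<close> maps negative reals to 0, so the two terms merge directly
    only if the second is nonnegative.\<close>
  then have "ennreal ((i + \<epsilon>) * (1 - a) + a * (i - \<eta>)) \<le> ennreal (i + t)"
  proof (cases "a * (i - \<eta>) \<ge> 0")
    case True
    moreover have "(i + \<epsilon>) * (1 - a) \<ge> 0" using i e a1 by simp
    ultimately show ?thesis using sum by (simp only: ennreal_plus)
  next
    case False
    then have "ennreal ((i + \<epsilon>) * (1 - a) + a * (i - \<eta>)) \<le> ennreal ((i + \<epsilon>) * (1 - a))" by (intro ennreal_leI) simp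
    with sum show ?thesis by (meson add_increasing2 order_trans order_refl zero_le)
  qed
  then have "(i + \<epsilon>) * (1 - a) + a * (i - \<eta>) \<le> i + t" using i t by (subst (asm) ennreal_le_iff) auto
  then have "\<epsilon> * (1 - a) \<le> t + a * \<eta>" by (simp add: algebra_simps)
  also have "\<dots> \<le> \<eta> + 1 * \<eta>" using t a1 \<eta> by (intro add_mono mult_right_mono) auto
  also have "\<dots> \<le> \<epsilon> * \<kappa>" using \<eta> by simp
  finally have "1 - a \<le> \<kappa>" using e by simp
  then have "emeasure \<mu> H \<le> ennreal \<kappa>" by (simp add: m.emeasure_eq_measure mH ennreal_leI)
  moreover have "mutual \<mu> \<mu> < \<infinity>" by (rule le_less_trans[OF m(2)]) simp
  ultimately show ?thesis using that m(1) by (simp add: H_def u_def)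
qed

text \<open>Finite energy makes the diagonal null for the product measure, since the kernel is
  infinite there. Off the diagonal the truncated kernels are eventually 0, and the kernel itself
  dominates them.\<close>

lemma local_energy_small:
  fixes \<mu> :: "'a::euclidean_space measure"
  assumes m: "riesz_admissible K \<mu>" and fin: "mutual \<mu> \<mu> < \<infinity>" and e: "\<epsilon> > 0"
  obtains \<rho> where "\<rho> > 0" "(\<integral>\<^sup>+x. (\<integral>\<^sup>+y. riesz_kernel 1 x y * indicator {y. dist x y < \<rho>} y \<partial>\<mu>) \<partial>\<mu>) \<le> ennreal \<epsilon>"
proof -
  interpret m: prob_space \<mu> by (rule riesz_admissible_prob[OF m])
  note [measurable_cong] = riesz_admissible_prob(2)[OF m]
  let ?k = "\<lambda>p :: 'a \<times> 'a. riesz_kernel 1 (fst p) (snd p)"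
  let ?f = "\<lambda>n p. ?k p * indicator {p. dist (fst p) (snd p) < 1 / real (Suc n)} p"
  have E: "mutual \<mu> \<mu> = (\<integral>\<^sup>+p. ?k p \<partial>(\<mu> \<Otimes>\<^sub>M \<mu>))"
    unfolding mutual_def by (subst m.nn_integral_fst[symmetric]) auto
  have [measurable]: "{p :: 'a \<times> 'a. dist (fst p) (snd p) < c} \<in> sets (\<mu> \<Otimes>\<^sub>M \<mu>)" for c
  proof -
    have "{p \<in> space (\<mu> \<Otimes>\<^sub>M \<mu>). dist (fst p) (snd p) < c} \<in> sets (\<mu> \<Otimes>\<^sub>M \<mu>)" by measurable
    then show ?thesis by (simp add: space_pair_measure riesz_admissible_prob(3)[OF m])
  qed
  have "(\<lambda>n. \<integral>\<^sup>+p. ?f n p \<partial>(\<mu> \<Otimes>\<^sub>M \<mu>)) \<longlonglongrightarrow> (\<integral>\<^sup>+p. 0 \<partial>(\<mu> \<Otimes>\<^sub>M \<mu>))"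
  proof (rule nn_integral_dominated_convergence[where w="?k"])
    show "(\<integral>\<^sup>+p. ?k p \<partial>(\<mu> \<Otimes>\<^sub>M \<mu>)) < \<infinity>" using fin E by simp
    show "AE p in \<mu> \<Otimes>\<^sub>M \<mu>. ?f n p \<le> ?k p" for n by (auto simp: indicator_def)
    have "AE p in \<mu> \<Otimes>\<^sub>M \<mu>. ?k p \<noteq> \<infinity>"
      using fin unfolding E by (intro nn_integral_PInf_AE) auto
    then show "AE p in \<mu> \<Otimes>\<^sub>M \<mu>. (\<lambda>n. ?f n p) \<longlonglongrightarrow> 0"
    proof eventually_elim
      case (elim p)
      then have "dist (fst p) (snd p) > 0" by (auto simp: riesz_kernel_def split: if_splits)
      then have "\<forall>\<^sub>F n in sequentially. 1 / real (Suc n) < dist (fst p) (snd p)"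
        using order_tendstoD(2)[OF LIMSEQ_inverse_real_of_nat] by (simp add: inverse_eq_divide)
      then have "\<forall>\<^sub>F n in sequentially. ?f n p = 0" by eventually_elim (auto simp: indicator_def)
      then show ?case by (rule tendsto_eventually)
    qed
  qed measurable
  then have "\<forall>\<^sub>F n in sequentially. (\<integral>\<^sup>+p. ?f n p \<partial>(\<mu> \<Otimes>\<^sub>M \<mu>)) < ennreal \<epsilon>"
    using e by (auto dest!: order_tendstoD(2)[where a="ennreal \<epsilon>"])
  then obtain n where n: "(\<integral>\<^sup>+p. ?f n p \<partial>(\<mu> \<Otimes>\<^sub>M \<mu>)) < ennreal \<epsilon>" by (auto simp: eventually_sequentially)
  have "(\<integral>\<^sup>+p. ?f n p \<partial>(\<mu> \<Otimes>\<^sub>M \<mu>)) = (\<integral>\<^sup>+x. (\<integral>\<^sup>+y. ?f n (x, y) \<partial>\<mu>) \<partial>\<mu>)"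
    by (subst m.nn_integral_fst) auto
  also have "\<dots> = (\<integral>\<^sup>+x. (\<integral>\<^sup>+y. riesz_kernel 1 x y * indicator {y. dist x y < 1 / real (Suc n)} y \<partial>\<mu>) \<partial>\<mu>)"
    by (intro nn_integral_cong) (auto simp: indicator_def)
  finally show ?thesis using that[of "1 / real (Suc n)"] n by simp
qed

text \<open>The maximum principle needs a bound near the support.  If \<open>c\<close> is almost the nearest point of \<open>C\<close> to
  \<open>z\<close>, the kernel at \<open>z\<close> is at most \<open>(1-\<theta>)\<close> to the power \<open>-s\<close> times the kernel at \<open>c\<close> for sources far from \<open>c\<close>, and
  at most \<open>3\<close> to the power \<open>s\<close> times it for the sources near \<open>c\<close>, whose contribution is small.\<close>

lemma riesz_energy_frostman_measure:
  fixes K :: "'a::euclidean_space set"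
  assumes dim: "DIM('a) \<ge> 2" and cK: "compact K" and i: "riesz_energy 1 K = ennreal i" "i \<ge> 0" and \<kappa>: "0 < \<kappa>" "\<kappa> < 1"
  obtains \<nu> :: "('a \<times> real) measure" where "compact_potential ((\<lambda>x. (x, 0)) ` K) \<nu>"
    "measure \<nu> (space \<nu>) \<ge> 1 - \<kappa>" "\<And>z. z \<notin> (\<lambda>x. (x, 0)) ` K \<Longrightarrow> pot 0 \<nu> z \<le> i + \<kappa>"
proof -
  define s where "s = real DIM('a) - 1"
  have s: "s > 0" "2 * kexp TYPE('a \<times> real) = s" using dim by (auto simp: s_def kexp_prod_real)
  define emb where "emb = (\<lambda>x::'a. (x, 0::real))"
  have emb_m [measurable]: "emb \<in> borel_measurable borel" unfolding emb_def by measurable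
  have emb_dist: "dist (emb x) (emb y) = dist x y" for x y by (simp add: emb_def dist_Pair_Pair)
  have \<kappa>3: "\<kappa> / 3 > 0" "\<kappa> / 2 > 0" using \<kappa> by auto
  obtain \<mu> where m: "riesz_admissible K \<mu>" "mutual \<mu> \<mu> < \<infinity>"
    and bad: "emeasure \<mu> {x. (\<integral>\<^sup>+y. riesz_kernel 1 x y \<partial>\<mu>) > ennreal (i + \<kappa>/3)} \<le> ennreal (\<kappa>/2)"
    using near_minimizer_potential_bound[OF i \<kappa>3] .
  interpret m: prob_space \<mu> by (rule riesz_admissible_prob[OF m(1)])
  note sm [measurable_cong] = riesz_admissible_prob(2)[OF m(1)]
  have sp: "space \<mu> = UNIV" by (rule riesz_admissible_prob[OF m(1)])
  \<comment> \<open>One third of \<kappa> is left for near sources, whose kernel grows by at most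
    the factor 3^s. The other two thirds go to the potential bound off \<open>H\<close> and to the
    factor (1-\<theta>)^(-s).\<close>
  define \<epsilon> where "\<epsilon> = \<kappa> / 3 / 3 powr s"
  have \<epsilon>: "\<epsilon> > 0" using \<kappa> by (simp add: \<epsilon>_def)
  obtain \<rho> where \<rho>: "\<rho> > 0"
    and loc: "(\<integral>\<^sup>+x. (\<integral>\<^sup>+y. riesz_kernel 1 x y * indicator {y. dist x y < \<rho>} y \<partial>\<mu>) \<partial>\<mu>) \<le> ennreal (\<epsilon> * (\<kappa> / 2))"
    using local_energy_small[OF m, of "\<epsilon> * (\<kappa>/2)"] \<epsilon> \<kappa> by auto
  define u where "u = (\<lambda>x. (\<integral>\<^sup>+y. riesz_kernel 1 x y \<partial>\<mu>))"
  define f where "f = (\<lambda>x. (\<integral>\<^sup>+y. riesz_kernel 1 x y * indicator {y. dist x y < \<rho>} y \<partial>\<mu>))"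
  have [measurable]: "u \<in> borel_measurable borel" unfolding u_def by measurable
  have [measurable]: "f \<in> borel_measurable borel"
  proof -
    have "f = (\<lambda>x. (\<integral>\<^sup>+y. (if dist x y < \<rho> then riesz_kernel 1 x y else 0) \<partial>\<mu>))"
      unfolding f_def by (intro ext nn_integral_cong) (auto simp: indicator_def)
    moreover have "\<dots> \<in> borel_measurable borel" by measurable
    ultimately show ?thesis by simp
  qed
  define H where "H = {x. u x > ennreal (i + \<kappa>/3)}"
  define B where "B = {x. f x > ennreal \<epsilon>}"
  have [measurable]: "H \<in> sets borel" "B \<in> sets borel" unfolding H_def B_def by measurable
  have Kb [measurable]: "K \<in> sets borel" using cK by (intro borel_closed compact_imp_closed)
  have mB: "emeasure \<mu> B \<le> ennreal (\<kappa> / 2)"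
  proof -
    have "ennreal \<epsilon> * emeasure \<mu> B = (\<integral>\<^sup>+x. ennreal \<epsilon> * indicator B x \<partial>\<mu>)"
      by (subst nn_integral_cmult_indicator) auto
    also have "\<dots> \<le> (\<integral>\<^sup>+x. f x \<partial>\<mu>)" by (intro nn_integral_mono) (auto simp: indicator_def B_def)
    also have "\<dots> \<le> ennreal \<epsilon> * ennreal (\<kappa> / 2)" using loc \<epsilon> \<kappa> by (simp add: f_def ennreal_mult[symmetric])
    finally show ?thesis using \<epsilon> by (subst (asm) ennreal_mult_le_mult_iff) auto
  qed
  \<comment> \<open>\<open>H\<close> is small by the choice of \<mu>, and \<open>B\<close> by
    Markov's inequality; restricting to \<open>C\<close> costs at most \<kappa> of the mass.\<close>
  define C where "C = K - (H \<union> B)"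
  have Cm [measurable]: "C \<in> sets borel" unfolding C_def by measurable
  have mHB: "measure \<mu> H \<le> \<kappa>/2" "measure \<mu> B \<le> \<kappa>/2"
  proof -
    have "emeasure \<mu> H \<le> ennreal (\<kappa>/2)" using bad unfolding H_def u_def .
    then show "measure \<mu> H \<le> \<kappa>/2" "measure \<mu> B \<le> \<kappa>/2" using mB \<kappa> by (auto simp: m.emeasure_eq_measure)
  qed
  have mK: "measure \<mu> K = 1" using m(1) by (simp add: riesz_admissible_def measure_def)
  have mC: "measure \<mu> C \<ge> 1 - \<kappa>"
  proof -
    have "measure \<mu> K \<le> measure \<mu> (C \<union> (H \<union> B))"
      by (intro m.finite_measure_mono) (auto simp: C_def sm)
    also have "\<dots> \<le> measure \<mu> C + measure \<mu> (H \<union> B)" by (intro measure_Un_le) (auto simp: sm)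
    also have "measure \<mu> (H \<union> B) \<le> measure \<mu> H + measure \<mu> B" by (intro measure_Un_le) (auto simp: sm)
    finally show ?thesis using mHB mK by linarith
  qed
  have "((\<lambda>\<theta>. (1 - \<theta>) powr (-s) * (i + \<kappa>/3)) \<longlongrightarrow> (1 - 0) powr (-s) * (i + \<kappa>/3)) (at_right 0)"
    by (intro tendsto_intros) auto
  then have "\<forall>\<^sub>F \<theta> in at_right 0. (1 - \<theta>) powr (-s) * (i + \<kappa>/3) < i + 2 * \<kappa> / 3"
    using \<kappa> by (auto dest!: order_tendstoD(2)[where a="i + 2 * \<kappa> / 3"])
  moreover have "\<forall>\<^sub>F \<theta>::real in at_right 0. 0 < \<theta>" by (rule eventually_at_right_less)
  moreover have "\<forall>\<^sub>F \<theta>::real in at_right 0. \<theta> < 1" using eventually_at_right_field[of "\<lambda>\<theta>. \<theta> < 1" "0::real"] zero_less_one by blast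
  ultimately have "\<forall>\<^sub>F \<theta> in at_right 0. (1 - \<theta>) powr (-s) * (i + \<kappa>/3) < i + 2 * \<kappa> / 3 \<and> 0 < \<theta> \<and> \<theta> < 1"
    by eventually_elim auto
  then obtain \<theta> where th: "(1 - \<theta>) powr (-s) * (i + \<kappa>/3) < i + 2 * \<kappa> / 3" "0 < \<theta>" "\<theta> < 1"
    using eventually_happens[of _ "at_right (0::real)"] by (auto simp: trivial_limit_at_right_real)
  define \<nu> where "\<nu> = distr (density \<mu> (indicator C)) borel emb"
  have memb: "emb \<in> borel_measurable (density \<mu> (indicator C))" by measurable
  have nmass: "emeasure \<nu> (space \<nu>) = ennreal (measure \<mu> C)"
  proof -
    have "emeasure \<nu> (space \<nu>) = emeasure (density \<mu> (indicator C)) UNIV"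
      unfolding \<nu>_def using emeasure_distr[OF memb, of UNIV] by (simp add: sp)
    also have "\<dots> = (\<integral>\<^sup>+x. indicator C x * indicator UNIV x \<partial>\<mu>)" by (subst emeasure_density) (auto simp: sm)
    also have "\<dots> = emeasure \<mu> C" by (simp add: sm)
    finally show ?thesis by (simp add: m.emeasure_eq_measure)
  qed
  have n_int: "(\<integral>\<^sup>+w. g w \<partial>\<nu>) = (\<integral>\<^sup>+y. indicator C y * g (emb y) \<partial>\<mu>)" if [measurable]: "g \<in> borel_measurable borel" for g
    unfolding \<nu>_def by (subst nn_integral_distr[OF memb]) (auto simp: nn_integral_density)
  have fin: "finite_measure \<nu>" using nmass by (intro finite_measureI) simp
  have massn: "measure \<nu> (space \<nu>) = measure \<mu> C" using nmass by (simp add: measure_def)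
  have massp: "measure \<nu> (space \<nu>) > 0" using mC \<kappa> massn by simp
  have aeC: "AE w in \<nu>. w \<in> L" if "emb ` C \<subseteq> L" "closed L" for L
    unfolding \<nu>_def using that by (subst AE_distr_iff[OF memb]) (auto simp: AE_density indicator_def split: if_splits intro!: AE_I2 borel_closed)
  have cont: "continuous_on A emb" for A unfolding emb_def by (intro continuous_intros)
  have embK: "compact (emb ` K)" by (intro compact_continuous_image cont cK)
  \<comment> \<open>The maximum principle is applied off the closure of \<open>C\<close> rather than
    off \<open>K\<close>, since potentials are controlled at points of \<open>C\<close>
    only.\<close>
  define L where "L = closure (emb ` C)"
  have LK: "L \<subseteq> emb ` K" unfolding L_def by (rule closure_minimal) (use embK in \<open>auto simp: C_def compact_imp_closed\<close>)
  have L: "compact L" using embK LK by (metis L_def closed_closure compact_Int_closed inf.absorb_iff2 inf_commute)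
  have dim3: "DIM('a \<times> real) \<ge> 3" using dim by simp
  have cpK: "compact_potential (emb ` K) \<nu>"
    by (rule compact_potential.intro[OF dim3 embK fin _ aeC massp]) (auto simp: \<nu>_def C_def embK compact_imp_closed)
  have cpL: "compact_potential L \<nu>"
    by (rule compact_potential.intro[OF dim3 L fin _ aeC massp]) (auto simp: \<nu>_def L_def closure_subset)
  interpret cpL: compact_potential L \<nu> by (rule cpL)
  have near: "pot 0 \<nu> z \<le> i + \<kappa>" if z: "z \<notin> L" and zd: "infdist z L < \<theta> * \<rho> / 2" for z
  proof -
    define d where "d = infdist z L"
    have d: "d > 0" unfolding d_def using infdist_pos_not_in_closed[of L z] z cpL.K_ne L by (simp add: compact_imp_closed)
    obtain w where w: "w \<in> L" "dist z w = d"
      using infdist_attains_inf[OF compact_imp_closed[OF L] cpL.K_ne, of z] unfolding d_def by metis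
    \<comment> \<open>The nearest point \<open>w\<close> may fail to come from \<open>C\<close>.
      Replacing it by a point that does, within \<open>d\<close>, at most doubles the distance to
      \<open>z\<close>; below this gives b <= a + 2 d <= 3 a.\<close>
    then obtain c where c: "c \<in> C" "dist (emb c) w < d" using d unfolding L_def closure_approachable by blast
    have zc: "dist z (emb c) < 2 * d" using w c dist_triangle[of z "emb c" w] by (simp add: dist_commute)
    have pw: "indicator C y * ennreal (kern 0 (z - emb y)) \<le> ennreal ((1 - \<theta>) powr (-s)) * riesz_kernel 1 c y
      + ennreal (3 powr s) * (riesz_kernel 1 c y * indicator {y. dist c y < \<rho>} y)" for y
    proof (cases "y \<in> C \<and> y \<noteq> c")
      case False
      \<comment> \<open>At \<open>y = c\<close> the right-hand side is infinite, so an atom at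
        \<open>c\<close> does no harm.\<close>
      have "ennreal ((1 - \<theta>) powr (-s)) * riesz_kernel 1 c y = \<infinity>" if "y = c"
        using that th by (simp add: riesz_kernel_def ennreal_mult_top)
      then show ?thesis using False by auto
    next
      case True
      define a where "a = dist z (emb y)"
      define b where "b = dist c y"
      have b: "b > 0" using True by (auto simp: b_def)
      have ad: "a \<ge> d" unfolding a_def d_def using True by (intro infdist_le) (auto simp: L_def intro: subsetD[OF closure_subset])
      have ba: "b \<le> a + 2 * d" using dist_triangle[of "emb c" "emb y" z] zc by (simp add: b_def a_def emb_dist dist_commute)
      have a0: "a > 0" using ad d by simp
      have ka: "kern 0 (z - emb y) = a powr (-s)"
        unfolding kern_def a_def dist_norm using square_powr[of "norm (z - emb y)" "kexp TYPE('a \<times> real)"] a0 s(2)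
        by (simp add: power2_norm_eq_inner a_def dist_norm)
      have kb: "riesz_kernel 1 c y = ennreal (b powr (-s))" using True by (auto simp: riesz_kernel_def b_def s_def)
      show ?thesis
      proof (cases "b < \<rho>")
        case near: True
        have "a powr (-s) \<le> (b / 3) powr (-s)" using ba ad b s by (intro powr_mono2') auto
        also have "\<dots> = 3 powr s * b powr (-s)" using b by (simp add: powr_divide powr_minus field_simps)
        finally have "ennreal (kern 0 (z - emb y)) \<le> ennreal (3 powr s) * (riesz_kernel 1 c y * indicator {y. dist c y < \<rho>} y)"
          using near unfolding ka kb by (simp add: b_def ennreal_mult[symmetric] ennreal_leI)
        then show ?thesis using True by (simp add: add_increasing)
      next
        case far: False
        have "2 * d \<le> \<theta> * \<rho>" using zd by (simp add: d_def)
        also have "\<dots> \<le> \<theta> * b" using far th by (intro mult_left_mono) auto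
        finally have "(1 - \<theta>) * b \<le> a" using ba by (simp add: algebra_simps)
        then have "a powr (-s) \<le> ((1 - \<theta>) * b) powr (-s)" using th b s by (intro powr_mono2') auto
        also have "\<dots> = (1 - \<theta>) powr (-s) * b powr (-s)" using th b by (simp add: powr_mult)
        finally have "ennreal (kern 0 (z - emb y)) \<le> ennreal ((1 - \<theta>) powr (-s)) * riesz_kernel 1 c y"
          unfolding ka kb by (simp add: ennreal_mult[symmetric] ennreal_leI)
        then show ?thesis using True by (simp add: add_increasing2)
      qed
    qed
    have "ennreal (pot 0 \<nu> z) = (\<integral>\<^sup>+w. ennreal (kern 0 (z - w)) \<partial>\<nu>)"
      unfolding pot_def using cpL.pot_regular(5)[of 0 z] z by (intro nn_integral_eq_integral[symmetric]) (auto simp: kern_def)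
    also have "\<dots> = (\<integral>\<^sup>+y. indicator C y * ennreal (kern 0 (z - emb y)) \<partial>\<mu>)" by (rule n_int) measurable
    also have "\<dots> \<le> (\<integral>\<^sup>+y. ennreal ((1 - \<theta>) powr (-s)) * riesz_kernel 1 c y
      + ennreal (3 powr s) * (riesz_kernel 1 c y * indicator {y. dist c y < \<rho>} y) \<partial>\<mu>)"
      by (intro nn_integral_mono pw)
    also have "\<dots> = ennreal ((1 - \<theta>) powr (-s)) * u c + ennreal (3 powr s) * f c"
      unfolding u_def f_def by (subst nn_integral_add) (auto simp: nn_integral_cmult)
    also have "\<dots> \<le> ennreal ((1 - \<theta>) powr (-s)) * ennreal (i + \<kappa>/3) + ennreal (3 powr s) * ennreal \<epsilon>"
      using c by (intro add_mono mult_left_mono) (auto simp: C_def H_def B_def)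
    also have "\<dots> = ennreal ((1 - \<theta>) powr (-s) * (i + \<kappa>/3) + 3 powr s * \<epsilon>)"
      using i \<kappa> \<epsilon> by (simp add: ennreal_mult[symmetric] ennreal_plus[symmetric] del: ennreal_plus)
    finally have "pot 0 \<nu> z \<le> (1 - \<theta>) powr (-s) * (i + \<kappa>/3) + 3 powr s * \<epsilon>"
      using i \<kappa> \<epsilon> by (subst (asm) ennreal_le_iff) auto
    also have "3 powr s * \<epsilon> = \<kappa> / 3" by (simp add: \<epsilon>_def)
    finally show ?thesis using th(1) by simp
  qed
  have "pot 0 \<nu> z \<le> i + \<kappa>" if "z \<notin> emb ` K" for z
    by (rule cpL.pot_max_principle[of "\<theta> * \<rho> / 2"]) (use th \<rho> i \<kappa> near that LK in auto)
  then show ?thesis using that cpK mC massn unfolding emb_def by metis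
qed


section \<open>The Brunn-Minkowski inequality\<close>

text \<open>The kernel decreases with the distance. The bound keeps the energy positive, hence the
  capacity finite.\<close>

lemma riesz_energy_ge:
  fixes K :: "'a::euclidean_space set"
  assumes "\<And>x y. x \<in> K \<Longrightarrow> y \<in> K \<Longrightarrow> dist x y \<le> D" "D > 0"
  shows "riesz_energy 1 K \<ge> ennreal (D powr (- (real DIM('a) - 1)))"
proof -
  let ?c = "ennreal (D powr (- (real DIM('a) - 1)))"
  have N: "real DIM('a) - 1 \<ge> 0" by (simp add: Suc_leI DIM_positive)
  have k: "?c \<le> riesz_kernel 1 x y" if "x \<in> K" "y \<in> K" for x y
    using assms(1)[OF that] N by (auto simp: riesz_kernel_def intro!: ennreal_leI powr_mono2')
  have "?c \<le> mutual \<mu> \<mu>" if m: "riesz_admissible K \<mu>" for \<mu>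
  proof -
    interpret prob_space \<mu> by (rule riesz_admissible_prob[OF m])
    have "?c = (\<integral>\<^sup>+x. (\<integral>\<^sup>+y. ?c \<partial>\<mu>) \<partial>\<mu>)" by (simp add: emeasure_space_1)
    also have "\<dots> \<le> mutual \<mu> \<mu>" unfolding mutual_def
    proof (rule nn_integral_mono_AE)
      show "AE x in \<mu>. (\<integral>\<^sup>+y. ?c \<partial>\<mu>) \<le> (\<integral>\<^sup>+y. riesz_kernel 1 x y \<partial>\<mu>)"
        using riesz_admissible_AE[OF m]
      proof eventually_elim
        case (elim x)
        show ?case by (rule nn_integral_mono_AE) (use riesz_admissible_AE[OF m] k[OF elim] in \<open>auto elim: eventually_mono\<close>)
      qed
    qed
    finally show ?thesis .
  qed
  then show ?thesis unfolding riesz_energy_def mutual_def by (intro INF_greatest) auto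
qed

lemma riesz_energy_finite:
  fixes K :: "'a::euclidean_space set"
  assumes d: "\<delta> > 0" and K: "cball c \<delta> \<subseteq> K" "compact K"
  shows "riesz_energy 1 K < \<infinity>"
proof -
  note bm = ball_measure[OF d, where 'a='a]
  interpret s: prob_space "ball_measure \<delta> :: 'a measure" by (rule bm)
  note [measurable_cong] = bm(2)
  define \<tau> where "\<tau> = distr (ball_measure \<delta>) borel (\<lambda>h. c - h)"
  have tau: "riesz_admissible K \<tau>"
  proof (rule riesz_admissibleI)
    show "prob_space \<tau>" unfolding \<tau>_def by (rule s.prob_space_distr) measurable
    show "AE y in \<tau>. y \<in> K" unfolding \<tau>_def
    proof (subst AE_distr_iff)
      show "AE h in ball_measure \<delta>. c - h \<in> K" using bm(3)
        by eventually_elim (use K in \<open>auto simp: subset_iff dist_norm\<close>)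
    qed (use K in \<open>auto intro!: borel_closed compact_imp_closed\<close>)
  qed (use K in \<open>auto simp: \<tau>_def intro!: borel_closed compact_imp_closed\<close>)
  have "mutual \<tau> \<tau> = mutual (ball_measure \<delta>) (ball_measure \<delta> :: 'a measure)"
    unfolding mutual_def \<tau>_def by (simp add: nn_integral_distr riesz_kernel_translate)
  then have "riesz_energy 1 K \<le> mutual (ball_measure \<delta>) (ball_measure \<delta> :: 'a measure)" using riesz_energy_le[OF tau] by simp
  also have "\<dots> \<le> ennreal (2 ^ DIM('a) * (2 * \<delta>) / \<delta> ^ DIM('a))" by (rule ball_measure_energy[OF d])
  also have "\<dots> < \<infinity>" by simp
  finally show ?thesis .
qed

text \<open>The inner ball makes the energy finite and boundedness makes it positive. This allows
  real arithmetic with capacities, as \<open>enn2real\<close> would send an infinite capacity to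
  0.\<close>

lemma riesz_energy_real:
  fixes K :: "'a::euclidean_space set"
  assumes "\<delta> > 0" "cball c \<delta> \<subseteq> K" "compact K"
  obtains i where "i > 0" "riesz_energy 1 K = ennreal i"
proof -
  obtain B where B: "\<And>x. x \<in> K \<Longrightarrow> norm x \<le> B" using compact_imp_bounded[OF assms(3)] by (auto simp: bounded_iff)
  have "dist x y \<le> 2 * \<bar>B\<bar> + 1" if "x \<in> K" "y \<in> K" for x y
    using B[OF that(1)] B[OF that(2)] norm_triangle_ineq4[of x y] by (simp add: dist_norm)
  then have "riesz_energy 1 K \<ge> ennreal ((2 * \<bar>B\<bar> + 1) powr (- (real DIM('a) - 1)))" by (rule riesz_energy_ge) (auto intro: add_nonneg_pos)
  moreover have "(2 * \<bar>B\<bar> + 1) powr (- (real DIM('a) - 1)) > 0" by (auto intro: add_nonneg_pos)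
  ultimately have "riesz_energy 1 K > 0" by (metis ennreal_less_zero_iff less_le_trans)
  then show ?thesis using riesz_energy_finite[OF assms] that
    by (cases "riesz_energy 1 K") (auto simp: less_le)
qed

text \<open>The kernel is homogeneous of degree -(N-1), so pushing a near-minimizer forward scales
  its energy by exactly this power of \<open>c\<close>.\<close>

lemma riesz_energy_affine_le:
  fixes K :: "'a::euclidean_space set"
  assumes i: "riesz_energy 1 K = ennreal i" "i \<ge> 0" and i': "riesz_energy 1 ((\<lambda>x. a + c *\<^sub>R x) ` K) = ennreal i'" "i' \<ge> 0"
    and c: "c > 0" and K: "compact K"
  shows "i' \<le> c powr (- (real DIM('a) - 1)) * i"
proof (rule field_le_epsilon)
  fix e :: real assume e: "e > 0"
  let ?T = "\<lambda>x::'a. a + c *\<^sub>R x" and ?k = "c powr (- (real DIM('a) - 1))"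
  have k: "?k > 0" using c by simp
  obtain \<mu> where m: "riesz_admissible K \<mu>" "mutual \<mu> \<mu> \<le> ennreal (i + e / ?k)" using near_minimizer[OF i, of "e / ?k"] e k by auto
  interpret m: prob_space \<mu> by (rule riesz_admissible_prob[OF m(1)])
  note [measurable_cong] = riesz_admissible_prob(2)[OF m(1)]
  define \<tau> where "\<tau> = distr \<mu> borel ?T"
  have "compact (?T ` K)" by (intro compact_continuous_image continuous_intros K)
  then have TK: "?T ` K \<in> sets borel" by (intro borel_closed compact_imp_closed)
  have tau: "riesz_admissible (?T ` K) \<tau>"
  proof (rule riesz_admissibleI)
    show "prob_space \<tau>" unfolding \<tau>_def by (rule m.prob_space_distr) measurable
    show "AE y in \<tau>. y \<in> ?T ` K" unfolding \<tau>_def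
      by (subst AE_distr_iff) (use riesz_admissible_AE[OF m(1)] TK in \<open>auto elim: eventually_mono\<close>)
  qed (use TK in \<open>auto simp: \<tau>_def\<close>)
  have kT: "riesz_kernel 1 (?T x) (?T y) = ennreal ?k * riesz_kernel 1 x y" for x y
  proof (cases "x = y")
    case True
    then show ?thesis using k by (simp add: riesz_kernel_def ennreal_mult_top)
  next
    case False
    have "dist (?T x) (?T y) = c * dist x y" using c by (simp add: dist_norm scaleR_diff_right[symmetric])
    then show ?thesis using False c by (simp add: riesz_kernel_def powr_mult ennreal_mult)
  qed
  have "mutual \<tau> \<tau> = (\<integral>\<^sup>+x. (\<integral>\<^sup>+y. ennreal ?k * riesz_kernel 1 x y \<partial>\<mu>) \<partial>\<mu>)"
    unfolding mutual_def \<tau>_def by (simp add: nn_integral_distr kT)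
  also have "\<dots> = ennreal ?k * mutual \<mu> \<mu>" unfolding mutual_def by (simp add: nn_integral_cmult)
  also have "\<dots> \<le> ennreal ?k * ennreal (i + e / ?k)" by (intro mult_left_mono m) auto
  also have "\<dots> = ennreal (?k * (i + e / ?k))" using k i e by (simp add: ennreal_mult[symmetric] ennreal_plus[symmetric] del: ennreal_plus)
  finally have "ennreal i' \<le> ennreal (?k * (i + e / ?k))" using riesz_energy_le[OF tau] i' by (simp add: order_trans)
  then have "i' \<le> ?k * (i + e / ?k)" using k i e by (subst (asm) ennreal_le_iff) auto
  also have "\<dots> = ?k * i + e" using k by (simp add: distrib_left)
  finally show "i' \<le> ?k * i + e" .
qed

text \<open>The room \<delta> inside \<open>K\<close> stays fixed as the averaging radius while
  \<kappa> tends to 0. In the limit the levels \<open>i1 + \<kappa>\<close>,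
  \<open>i0 + \<kappa>\<close> and \<open>V\<close> become the energies, and the lower bounds for
  the masses become 1.\<close>

lemma riesz_energy_comparison:
  fixes K1 K0 K :: "'a::euclidean_space set"
  assumes dim: "DIM('a) \<ge> 2" and l: "0 < l" "l < 1" and cK: "compact K1" "compact K0" "compact K" and cv: "convex K1" "convex K0"
    and i1: "riesz_energy 1 K1 = ennreal i1" "i1 > 0" and i0: "riesz_energy 1 K0 = ennreal i0" "i0 > 0"
    and i: "riesz_energy 1 K = ennreal i" "i > 0" and d: "\<delta> > 0"
    and sub: "\<And>x1 x0. x1 \<in> K1 \<Longrightarrow> x0 \<in> K0 \<Longrightarrow> cball (l *\<^sub>R x1 + (1-l) *\<^sub>R x0) \<delta> \<subseteq> K"
  shows "l * (1 / i1) powr (1 / (real DIM('a) - 1)) + (1-l) * (1 / i0) powr (1 / (real DIM('a) - 1)) \<le> (1 / i) powr (1 / (real DIM('a) - 1))"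
proof -
  define q where "q = 1 / (real DIM('a) - 1)"
  have q: "q > 0" using dim by (simp add: q_def)
  define emb where "emb = (\<lambda>x::'a. (x, 0::real))"
  have lin: "linear emb" unfolding emb_def by (intro linearI) auto
  have main: "l * ((1 - \<kappa>) / (i1 + \<kappa>)) powr q + (1-l) * ((1 - \<kappa>) / (i0 + \<kappa>)) powr q \<le> ((1 + \<kappa>) / (i - 2 * \<kappa>)) powr q"
    if \<kappa>: "0 < \<kappa>" "\<kappa> < 1" "2 * \<kappa> < i" for \<kappa>
  proof -
    obtain \<nu>1 where n1: "compact_potential (emb ` K1) \<nu>1" "measure \<nu>1 (space \<nu>1) \<ge> 1 - \<kappa>" "\<And>z. z \<notin> emb ` K1 \<Longrightarrow> pot 0 \<nu>1 z \<le> i1 + \<kappa>"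
      using riesz_energy_frostman_measure[OF dim cK(1) i1(1) less_imp_le[OF i1(2)] \<kappa>(1,2)] unfolding emb_def by metis
    obtain \<nu>0 where n0: "compact_potential (emb ` K0) \<nu>0" "measure \<nu>0 (space \<nu>0) \<ge> 1 - \<kappa>" "\<And>z. z \<notin> emb ` K0 \<Longrightarrow> pot 0 \<nu>0 z \<le> i0 + \<kappa>"
      using riesz_energy_frostman_measure[OF dim cK(2) i0(1) less_imp_le[OF i0(2)] \<kappa>(1,2)] unfolding emb_def by metis
    obtain \<nu> :: "('a \<times> real) measure" and e K' where n: "compact_potential K' \<nu>" "e > 0" "measure \<nu> (space \<nu>) = 1"
      "\<And>x. cball x \<delta> \<subseteq> K \<Longrightarrow> i - 2 * \<kappa> \<le> (1 + \<kappa>) * pot e \<nu> (x, 0)"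
      using averaged_potential_lower_bound[OF dim cK(3) i(1) less_imp_le[OF i(2)] d \<kappa>(1)] by metis
    define V where "V = (i - 2 * \<kappa>) / (1 + \<kappa>)"
    have V: "V > 0" "i1 + \<kappa> > 0" "i0 + \<kappa> > 0" using \<kappa> i1 i0 by (auto simp: V_def)
    have cv': "convex (emb ` K1)" "convex (emb ` K0)" using cv lin by (auto intro: convex_linear_image)
    have "l * (measure \<nu>1 (space \<nu>1) / (i1 + \<kappa>)) powr (1 / (real DIM('a \<times> real) - 2))
     + (1-l) * (measure \<nu>0 (space \<nu>0) / (i0 + \<kappa>)) powr (1 / (real DIM('a \<times> real) - 2))
     \<le> (measure \<nu> (space \<nu>) / V) powr (1 / (real DIM('a \<times> real) - 2))"
    proof (rule mass_comparison[OF l n1(1) cv'(1) n0(1) cv'(2) n(1,2) V(2,3,1) n1(3) n0(3)])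
      fix z1 z0 assume "z1 \<in> emb ` K1" "z0 \<in> emb ` K0"
      then obtain x1 x0 where x: "x1 \<in> K1" "x0 \<in> K0" "z1 = emb x1" "z0 = emb x0" by auto
      have "l *\<^sub>R z1 + (1-l) *\<^sub>R z0 = (l *\<^sub>R x1 + (1-l) *\<^sub>R x0, 0)" by (simp add: x emb_def)
      then show "V \<le> pot e \<nu> (l *\<^sub>R z1 + (1-l) *\<^sub>R z0)"
        using n(4)[OF sub[OF x(1,2)]] \<kappa> by (simp add: V_def field_simps)
    qed
    moreover have "1 / (real DIM('a \<times> real) - 2) = q" by (simp add: q_def)
    moreover have "l * ((1 - \<kappa>) / (i1 + \<kappa>)) powr q \<le> l * (measure \<nu>1 (space \<nu>1) / (i1 + \<kappa>)) powr q"
      using n1(2) V \<kappa> q l by (intro mult_left_mono powr_mono2 divide_right_mono) auto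
    moreover have "(1-l) * ((1 - \<kappa>) / (i0 + \<kappa>)) powr q \<le> (1-l) * (measure \<nu>0 (space \<nu>0) / (i0 + \<kappa>)) powr q"
      using n0(2) V \<kappa> q l by (intro mult_left_mono powr_mono2 divide_right_mono) auto
    ultimately show ?thesis by (simp add: n(3) V_def)
  qed
  have "\<forall>\<^sub>F \<kappa> in at_right 0. 0 < \<kappa> \<and> \<kappa> < min 1 (i / 2)"
    by (intro eventually_conj eventually_at_right_less) (use i in \<open>auto simp: eventually_at_right_field intro!: exI[of _ "min 1 (i / 2)"]\<close>)
  then have ev: "\<forall>\<^sub>F \<kappa> in at_right 0. l * ((1 - \<kappa>) / (i1 + \<kappa>)) powr q + (1-l) * ((1 - \<kappa>) / (i0 + \<kappa>)) powr q \<le> ((1 + \<kappa>) / (i - 2 * \<kappa>)) powr q"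
    by eventually_elim (auto intro!: main)
  have L1: "((\<lambda>\<kappa>. l * ((1 - \<kappa>) / (i1 + \<kappa>)) powr q + (1-l) * ((1 - \<kappa>) / (i0 + \<kappa>)) powr q)
      \<longlongrightarrow> l * ((1 - 0) / (i1 + 0)) powr q + (1-l) * ((1 - 0) / (i0 + 0)) powr q) (at_right 0)"
    using i1 i0 by (intro tendsto_intros) auto
  have L2: "((\<lambda>\<kappa>. ((1 + \<kappa>) / (i - 2 * \<kappa>)) powr q) \<longlongrightarrow> ((1 + 0) / (i - 2 * 0)) powr q) (at_right 0)"
    using i by (intro tendsto_intros) auto
  show ?thesis using tendsto_le[OF _ L2 L1 ev] by (simp add: q_def)
qed

section \<open>Shrinking the bodies and the final limit\<close>

lemma riesz_cap_real:
  assumes "riesz_energy 1 K = ennreal i" "i > 0"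
  shows "enn2real (riesz_cap 1 K) = 1 / i"
  using assms by (simp add: riesz_cap_def inverse_ennreal divide_inverse)

lemma convex_body_cball:
  assumes "convex_body K"
  obtains c \<delta> where "\<delta> > 0" "cball c \<delta> \<subseteq> K"
  using assms unfolding convex_body_def by (metis all_not_in_conv mem_interior_cball)

text \<open>\<open>x + h\<close> is a convex combination of \<open>c + h /\<^sub>R s\<close>, which
  stays in the ball around \<open>c\<close>, and a point of \<open>K\<close>.\<close>

lemma cball_subset_shrunk:
  fixes K :: "'a::euclidean_space set"
  assumes K: "convex K" and c: "cball c \<delta> \<subseteq> K" and s: "0 < s" "s < 1" and x: "x \<in> (\<lambda>x. s *\<^sub>R c + (1-s) *\<^sub>R x) ` K"
    and h: "norm h \<le> s * \<delta>"
  shows "x + h \<in> K"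
proof -
  obtain y where y: "y \<in> K" "x = s *\<^sub>R c + (1-s) *\<^sub>R y" using x by auto
  have "norm (h /\<^sub>R s) \<le> \<delta>" using h s by (simp add: field_simps)
  then have "c + h /\<^sub>R s \<in> K" using c by (auto simp: subset_iff dist_norm)
  then have "s *\<^sub>R (c + h /\<^sub>R s) + (1-s) *\<^sub>R y \<in> K" using K y s by (intro convexD) auto
  also have "s *\<^sub>R (c + h /\<^sub>R s) + (1-s) *\<^sub>R y = x + h" using s by (simp add: y scaleR_add_right)
  finally show ?thesis .
qed

theorem theorem1:
  fixes K0 K1 :: "'a::euclidean_space set" and l :: real
  assumes "DIM('a) \<ge> 2"
    and "convex_body K0" and "convex_body K1"
    and "0 \<le> l" and "l \<le> 1"
  shows "enn2real (riesz_cap 1 (minkowski_comb l K1 K0)) powr (1 / (real DIM('a) - 1))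
     \<ge> l * enn2real (riesz_cap 1 K1) powr (1 / (real DIM('a) - 1))
       + (1 - l) * enn2real (riesz_cap 1 K0) powr (1 / (real DIM('a) - 1))"
proof -
  have K: "compact K1" "convex K1" "compact K0" "convex K0" using assms(2,3) by (auto simp: convex_body_def)
  obtain c1 d1 where c1: "d1 > 0" "cball c1 d1 \<subseteq> K1" using convex_body_cball[OF assms(3)] .
  obtain c0 d0 where c0: "d0 > 0" "cball c0 d0 \<subseteq> K0" using convex_body_cball[OF assms(2)] .
  have ne: "c1 \<in> K1" "c0 \<in> K0" using c1 c0 by auto
  consider "l = 0" | "l = 1" | "0 < l" "l < 1" using assms(4,5) by linarith
  then show ?thesis
  proof cases
    case 1
    have "minkowski_comb l K1 K0 = K0" using ne 1 by (auto simp: minkowski_comb_def)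
    then show ?thesis using 1 by simp
  next
    case 2
    have "minkowski_comb l K1 K0 = K1" using ne 2 by (auto simp: minkowski_comb_def)
    then show ?thesis using 2 by simp
  next
    case l: 3
    define L where "L = minkowski_comb l K1 K0"
    define q where "q = 1 / (real DIM('a) - 1)"
    have q: "q > 0" using assms(1) by (simp add: q_def)
    have "L = {x + y |x y. x \<in> (*\<^sub>R) l ` K1 \<and> y \<in> (*\<^sub>R) (1-l) ` K0}"
      unfolding L_def minkowski_comb_def by blast
    moreover have "compact \<dots>" by (intro compact_sums compact_scaling K)
    ultimately have cL: "compact L" by simp
    \<comment> \<open>Moving both points by the same \<open>h\<close> moves the combination by
      \<open>h\<close>, so equal room in both bodies gives that room in \<open>L\<close>.\<close>
    have sumL: "l *\<^sub>R x1 + (1-l) *\<^sub>R x0 + h \<in> L" if "x1 + h \<in> K1" "x0 + h \<in> K0" for x1 x0 h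
    proof -
      have "l *\<^sub>R x1 + (1-l) *\<^sub>R x0 + h = l *\<^sub>R (x1 + h) + (1-l) *\<^sub>R (x0 + h)" by (simp add: algebra_simps)
      then show ?thesis unfolding L_def minkowski_comb_def using that by blast
    qed
    define d where "d = min d1 d0"
    have d: "d > 0" "cball c1 d \<subseteq> K1" "cball c0 d \<subseteq> K0" using c1 c0 by (auto simp: d_def subset_iff)
    have "cball (l *\<^sub>R c1 + (1-l) *\<^sub>R c0) d \<subseteq> L"
    proof
      fix y assume y: "y \<in> cball (l *\<^sub>R c1 + (1-l) *\<^sub>R c0) d"
      define h where "h = y - (l *\<^sub>R c1 + (1-l) *\<^sub>R c0)"
      have "norm h \<le> d" using y by (simp add: h_def dist_norm norm_minus_commute)
      then have "c1 + h \<in> K1" "c0 + h \<in> K0" using d by (auto simp: subset_iff dist_norm)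
      from sumL[OF this] show "y \<in> L" by (simp add: h_def)
    qed
    then obtain i where i: "i > 0" "riesz_energy 1 L = ennreal i" using riesz_energy_real[OF d(1) _ cL] by blast
    obtain i1 where i1: "i1 > 0" "riesz_energy 1 K1 = ennreal i1" using riesz_energy_real[OF c1 K(1)] .
    obtain i0 where i0: "i0 > 0" "riesz_energy 1 K0 = ennreal i0" using riesz_energy_real[OF c0 K(3)] .
    \<comment> \<open>By homogeneity the shrunk body loses at most the factor \<open>t\<close> in
      the capacity to the power \<open>q\<close>, because the exponents N-1 and \<open>q\<close>
      cancel.\<close>
    have shrunk: "\<exists>j>0. riesz_energy 1 ((\<lambda>x. (1-t) *\<^sub>R c + t *\<^sub>R x) ` K') = ennreal j \<and> t * (1 / i') powr q \<le> (1 / j) powr q"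
      if t: "0 < t" "t < 1" and K': "compact K'" "cball c \<delta> \<subseteq> K'" "\<delta> > 0" "riesz_energy 1 K' = ennreal i'" "i' > 0"
      for t c \<delta> i' and K' :: "'a set"
    proof -
      let ?S = "(\<lambda>x. (1-t) *\<^sub>R c + t *\<^sub>R x) ` K'"
      have cS: "compact ?S" by (intro compact_continuous_image continuous_intros K')
      have "cball c (t * \<delta>) \<subseteq> ?S"
      proof
        fix y assume y: "y \<in> cball c (t * \<delta>)"
        have "norm ((y - c) /\<^sub>R t) = dist c y / t" using t by (simp add: dist_norm norm_minus_commute divide_inverse mult.commute)
        also have "\<dots> \<le> \<delta>" using y t by (simp add: pos_divide_le_eq mult.commute)
        finally have "norm ((y - c) /\<^sub>R t) \<le> \<delta>" .
        then have "c + (y - c) /\<^sub>R t \<in> K'" using K'(2) by (auto simp: subset_iff dist_norm)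
        moreover have "y = (1-t) *\<^sub>R c + t *\<^sub>R (c + (y - c) /\<^sub>R t)" using t by (simp add: scaleR_add_right scaleR_diff_left)
        ultimately show "y \<in> ?S" by blast
      qed
      then obtain j where j: "j > 0" "riesz_energy 1 ?S = ennreal j"
        using riesz_energy_real[of "t * \<delta>" c ?S] cS t K' by auto
      have "j \<le> t powr (- (real DIM('a) - 1)) * i'"
        by (rule riesz_energy_affine_le[OF K'(4) _ j(2)]) (use j t K' in auto)
      then have "1 / (t powr (- (real DIM('a) - 1)) * i') \<le> 1 / j" using j by (intro divide_left_mono) (use t K' in auto)
      then have "(1 / (t powr (- (real DIM('a) - 1)) * i')) powr q \<le> (1 / j) powr q"
        using q t K' by (intro powr_mono2) auto
      moreover have "1 / (t powr (- (real DIM('a) - 1)) * i') = t powr (real DIM('a) - 1) * (1 / i')"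
        using t K' by (simp only: powr_minus) (simp add: field_simps)
      moreover have "(t powr (real DIM('a) - 1) * (1 / i')) powr q = t * (1 / i') powr q"
        using t K' assms(1) by (subst powr_mult) (auto simp: powr_powr q_def)
      ultimately show ?thesis using j by auto
    qed
    \<comment> \<open>It suffices to bound \<open>t\<close> times the left-hand side for all
      \<open>t\<close> strictly between 0 and 1, and this factor is exactly the loss from
      shrinking.\<close>
    have "l * (1 / i1) powr q + (1-l) * (1 / i0) powr q \<le> (1 / i) powr q"
    proof (rule field_le_mult_one_interval)
      fix t :: real assume t: "0 < t" "t < 1"
      let ?S1 = "(\<lambda>x. (1-t) *\<^sub>R c1 + t *\<^sub>R x) ` K1" and ?S0 = "(\<lambda>x. (1-t) *\<^sub>R c0 + t *\<^sub>R x) ` K0"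
      obtain j1 where j1: "j1 > 0" "riesz_energy 1 ?S1 = ennreal j1" "t * (1 / i1) powr q \<le> (1 / j1) powr q"
        using shrunk[OF t K(1) c1(2,1) i1(2,1)] by auto
      obtain j0 where j0: "j0 > 0" "riesz_energy 1 ?S0 = ennreal j0" "t * (1 / i0) powr q \<le> (1 / j0) powr q"
        using shrunk[OF t K(3) c0(2,1) i0(2,1)] by auto
      have "l * (1 / j1) powr q + (1-l) * (1 / j0) powr q \<le> (1 / i) powr q"
        unfolding q_def
      proof (rule riesz_energy_comparison[OF assms(1) l _ _ cL _ _ j1(2,1) j0(2,1) i(2,1)])
        show "compact ?S1" "compact ?S0" by (intro compact_continuous_image continuous_intros K)+
        show "convex ?S1" "convex ?S0"
          using convex_affinity[OF K(2), of "(1-t) *\<^sub>R c1" t] convex_affinity[OF K(4), of "(1-t) *\<^sub>R c0" t] by auto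
        show "(1-t) * d > 0" using t d by simp
        fix x1 x0 assume x: "x1 \<in> ?S1" "x0 \<in> ?S0"
        show "cball (l *\<^sub>R x1 + (1-l) *\<^sub>R x0) ((1-t) * d) \<subseteq> L"
        proof
          fix y assume y: "y \<in> cball (l *\<^sub>R x1 + (1-l) *\<^sub>R x0) ((1-t) * d)"
          define h where "h = y - (l *\<^sub>R x1 + (1-l) *\<^sub>R x0)"
          have h: "norm h \<le> (1-t) * d" using y by (simp add: h_def dist_norm norm_minus_commute)
          have "x1 + h \<in> K1" by (rule cball_subset_shrunk[OF K(2) d(2) _ _ _ h]) (use t x in auto)
          moreover have "x0 + h \<in> K0" by (rule cball_subset_shrunk[OF K(4) d(3) _ _ _ h]) (use t x in auto)
          ultimately have "l *\<^sub>R x1 + (1-l) *\<^sub>R x0 + h \<in> L" by (rule sumL)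
          then show "y \<in> L" by (simp add: h_def)
        qed
      qed
      moreover have "l * (t * (1 / i1) powr q) \<le> l * (1 / j1) powr q" "(1-l) * (t * (1 / i0) powr q) \<le> (1-l) * (1 / j0) powr q"
        using j1(3) j0(3) l by (auto intro!: mult_left_mono)
      ultimately show "t * (l * (1 / i1) powr q + (1-l) * (1 / i0) powr q) \<le> (1 / i) powr q"
        by (simp add: algebra_simps)
    qed
    then show ?thesis
      unfolding riesz_cap_real[OF i1(2,1)] riesz_cap_real[OF i0(2,1)] L_def[symmetric] riesz_cap_real[OF i(2,1)] q_def .
  qed
qed

end
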